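(* There is a deterministic algorithm which, given pairwise coprime $m_1,\ldots,m_d\in\mathbb{N}$, sets $\mathcal{A}_i\subseteq\mathbb{Z}/m_i\mathbb{Z}$ and their cardinalities $\kappa_i=|\mathcal{A}_i|$ ($i=1,\ldots,d$) with $\kappa_1\ge\kappa_2\ge\cdots\ge\kappa_d$, outputs (lists) all elements of the set \[ \mathcal{A}:=\{x\in\mathbb{Z}/M\mathbb{Z} : \exists(\alpha_1,\ldots,\alpha_d)\in\textstyle\prod_{i=1}^d\mathcal{A}_i \text{ with } x\equiv\alpha_i \bmod m_i \text{ for } 1\le i\le d\},\qquad M:=\prod_{i=1}^d m_i. \] Assuming $|\mathcal{A}|\ge \sum_{i=1}^d\kappa_i\cdot\log M$, its runtime is bounded by $O(|\mathcal{A}|\cdot\log M)$ bit operations.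
   Context: Complexities are measured as bit operations in the multitape Turing machine model. *)

theory Defs
  imports Complex_Main "HOL-Number_Theory.Cong"
begin

text \<open>
  Deterministic multitape Turing machines. States and tape symbols are initial segments of the
  naturals, so that one can quantify over all machines inside a formula. Conventions:
  state 0 is the start state, state 1 the halting state; symbol 0 is the blank; tapes are
  two-way infinite; tape 0 initially holds the input, tape 1 finally holds the output.
\<close>

datatype move = Move_Left | Move_Stay | Move_Right

record turing_machine =
  num_tapes :: nat
  num_symbols :: nat
  num_states :: nat
  delta :: "nat \<Rightarrow> nat list \<Rightarrow> nat \<times> (nat \<times> move) list"

text \<open>
  Symbols 0, ..., 4 are used by the input and output encodings below; a machine may use
  further ones. Only the (finitely many) values of \<open>delta\<close> constrained here are ever used.
\<close>

definition wf_tm :: "turing_machine \<Rightarrow> bool" where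
  "wf_tm T \<longleftrightarrow> num_tapes T \<ge> 2 \<and> num_symbols T \<ge> 5 \<and> num_states T \<ge> 2 \<and>
     (\<forall>q<num_states T. \<forall>vs. length vs = num_tapes T \<and> set vs \<subseteq> {..<num_symbols T} \<longrightarrow>
        (case delta T q vs of (q', acts) \<Rightarrow>
           q' < num_states T \<and> length acts = num_tapes T \<and>
           fst ` set acts \<subseteq> {..<num_symbols T}))"

type_synonym tape = "(int \<Rightarrow> nat) \<times> int"  \<comment> \<open>cell contents and head position\<close>

type_synonym config = "nat \<times> tape list"

definition tape_content :: "nat list \<Rightarrow> int \<Rightarrow> nat" where
  "tape_content w p = (if 0 \<le> p \<and> p < int (length w) then w ! nat p else 0)"

definition init_config :: "turing_machine \<Rightarrow> nat list \<Rightarrow> config" where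
  "init_config T w =
     (0, (tape_content w, 0) # replicate (num_tapes T - 1) (tape_content [], 0))"

fun read_tape :: "tape \<Rightarrow> nat" where
  "read_tape (c, p) = c p"

fun move_offset :: "move \<Rightarrow> int" where
  "move_offset Move_Left = -1"
| "move_offset Move_Stay = 0"
| "move_offset Move_Right = 1"

fun act_tape :: "nat \<times> move \<Rightarrow> tape \<Rightarrow> tape" where
  "act_tape (s, mv) (c, p) = (c(p := s), p + move_offset mv)"

definition step :: "turing_machine \<Rightarrow> config \<Rightarrow> config" where
  "step T cfg = (case cfg of (q, ts) \<Rightarrow>
     if q = 1 then cfg
     else case delta T q (map read_tape ts) of (q', acts) \<Rightarrow> (q', map2 act_tape acts ts))"

definition run :: "turing_machine \<Rightarrow> nat list \<Rightarrow> nat \<Rightarrow> config" where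
  "run T w t = (step T ^^ t) (init_config T w)"

definition halts :: "turing_machine \<Rightarrow> nat list \<Rightarrow> bool" where
  "halts T w \<longleftrightarrow> (\<exists>t. fst (run T w t) = 1)"

text \<open>The number of steps until the machine halts; meaningful only if \<open>halts T w\<close>.\<close>

definition runtime :: "turing_machine \<Rightarrow> nat list \<Rightarrow> nat" where
  "runtime T w = (LEAST t. fst (run T w t) = 1)"

definition outputs :: "turing_machine \<Rightarrow> nat list \<Rightarrow> nat list \<Rightarrow> bool" where
  "outputs T w v \<longleftrightarrow>
     halts T w \<and> fst (snd (run T w (runtime T w)) ! 1) = tape_content v"

text \<open>
  Numbers are written in binary, least significant bit first, without superfluous zeros (so 0 is
  the empty digit string). Symbols: 1 and 2 are the bits 0 and 1, 3 ends a number, 4 ends a block.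
\<close>

fun binary :: "nat \<Rightarrow> nat list" where
  "binary n = (if n = 0 then [] else (if even n then 1 else 2) # binary (n div 2))"

declare binary.simps [simp del]

definition encode_list :: "nat list \<Rightarrow> nat list" where
  "encode_list xs = concat (map (\<lambda>x. binary x @ [3]) xs)"

definition lists_set :: "nat list \<Rightarrow> nat set \<Rightarrow> bool" where
  "lists_set xs S \<longleftrightarrow> distinct xs \<and> set xs = S"

text \<open>
  The \<open>i\<close>-th block of an input word consists of \<open>m i\<close>, \<open>\<kappa> i\<close> and the elements of \<open>A i\<close>. A set may
  be listed in any order, so an instance has several input words.
\<close>

definition encodes_instance ::
  "nat list \<Rightarrow> nat \<Rightarrow> (nat \<Rightarrow> nat) \<Rightarrow> (nat \<Rightarrow> nat set) \<Rightarrow> (nat \<Rightarrow> nat) \<Rightarrow> bool" where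
  "encodes_instance w d m A \<kappa> \<longleftrightarrow>
     (\<exists>L. (\<forall>i\<in>{1..d}. lists_set (L i) (A i)) \<and>
          w = concat (map (\<lambda>i. encode_list (m i # \<kappa> i # L i) @ [4]) [1..<Suc d]))"

text \<open>Residue classes modulo \<open>n\<close> are represented by their least nonnegative elements.\<close>

definition residue_classes :: "nat \<Rightarrow> nat set" where
  "residue_classes n = {..<n}"

definition crt_set :: "nat \<Rightarrow> (nat \<Rightarrow> nat) \<Rightarrow> (nat \<Rightarrow> nat set) \<Rightarrow> nat set" where
  "crt_set d m A = {x \<in> residue_classes (\<Prod>i=1..d. m i).
     \<exists>\<alpha>. (\<forall>i\<in>{1..d}. \<alpha> i \<in> A i) \<and> (\<forall>i\<in>{1..d}. [x = \<alpha> i] (mod m i))}"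

end

theory Submission
  imports Defs
begin

text \<open>
  For every index \<open>i\<close> and every \<open>a \<in> A i\<close> let \<open>e i a\<close> be the residue modulo \<open>M\<close> that is \<open>a\<close> modulo
  \<open>m i\<close> and 0 modulo the other moduli. The elements of the CRT set are the sums modulo \<open>M\<close> of one
  \<open>e i (\<alpha> i)\<close> for each \<open>i\<close>. The lifts can be computed with quadratic arithmetic, in
  \<open>(\<Sum>i. \<kappa> i) * (ln M)\<^sup>2\<close> steps up to a constant, which the hypothesis bounds by \<open>N * ln M\<close>.
  The sums are formed index by index, starting with the smallest sets: the list of partial sums is
  replaced by the list of all its translates, with one addition modulo \<open>M\<close> per entry. As the
  partial products of the cardinalities are 1 at first and then at least double in each step,
  there are at most \<open>2 * N + d\<close> partial sums.

  The Turing machine is compiled from a structured program over stacks; each stack lives on a tape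
  of its own, with its top at the head position.
\<close>

section \<open>Stack programs and their compilation to Turing machines\<close>

text \<open>Two budgets shape the algorithm. A residue may cost only the square of the number of
  digits, while Euclid's algorithm makes linearly many divisions, and dividing at full length each
  time would give a cubic cost. Division is therefore charged by the length of its quotient, and
  these lengths are amortised over all rounds. An element of the CRT set may cost only linearly many
  steps, so it cannot be assembled from its \<open>d\<close> summands separately. Sharing partial
  sums solves this only in the right order: with the largest sets first, a long tail of singletons
  would recopy a list of length \<open>N\<close> up to \<open>d\<close> times. With the smallest
  sets first, the singletons act on a list of length 1. Different choices of residues give different
  sums, so the list lengths are exact products and no duplicates have to be removed. Every block
  also has an overhead that is quadratic in the digits, even if its modulus is 1. If the CRT set is
  nonempty, all sets are nonempty, so \<open>d\<close> is at most the sum of the cardinalities and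
  this overhead fits the first budget.\<close>

type_synonym store = "nat \<Rightarrow> nat list"

text \<open>Stack 1 is the output. Its tape is written from left to right and the head waits on the
  blank behind the last symbol, so it always reads 0. An empty stack reads 0 as well; this is why
  stored symbols are restricted to 1, ..., 4.\<close>

definition tops :: "store \<Rightarrow> nat \<Rightarrow> nat" where
  "tops \<sigma> r = (if r = 1 \<or> \<sigma> r = [] then 0 else hd (\<sigma> r))"

datatype com =
    Skip
  | Push nat "(nat \<Rightarrow> nat) \<Rightarrow> nat"
  | Put nat "(nat \<Rightarrow> nat) \<Rightarrow> nat"
  | Pop nat
  | Out "(nat \<Rightarrow> nat) \<Rightarrow> nat"
  | Seq com com  (infixr ";;" 60)
  | Cond "(nat \<Rightarrow> nat) \<Rightarrow> bool" com com
  | While "(nat \<Rightarrow> nat) \<Rightarrow> bool" com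

text \<open>The times are the exact step counts of the compiled code: \<open>Push\<close> moves left
  and then writes, a taken \<open>Cond\<close> jumps at the test and again over the other branch,
  and a \<open>While\<close> round jumps at the test and back.\<close>

inductive exec :: "com \<Rightarrow> store \<Rightarrow> nat \<Rightarrow> store \<Rightarrow> bool" where
  Skip: "exec Skip \<sigma> 0 \<sigma>"
| Push: "s = g ((tops \<sigma>)(r := 0)) \<Longrightarrow> s \<in> {1..4} \<Longrightarrow> exec (Push r g) \<sigma> 2 (\<sigma>(r := s # \<sigma> r))"
| Put: "s = g (tops \<sigma>) \<Longrightarrow> s \<in> {1..4} \<Longrightarrow> exec (Put r g) \<sigma> 1 (\<sigma>(r := s # tl (\<sigma> r)))"
| Pop: "exec (Pop r) \<sigma> 1 (\<sigma>(r := tl (\<sigma> r)))"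
| Out: "s = g (tops \<sigma>) \<Longrightarrow> s \<in> {1..4} \<Longrightarrow> exec (Out g) \<sigma> 1 (\<sigma>(1 := \<sigma> 1 @ [s]))"
| Seq: "exec c1 \<sigma> t1 \<sigma>1 \<Longrightarrow> exec c2 \<sigma>1 t2 \<sigma>2 \<Longrightarrow> exec (c1;; c2) \<sigma> (t1 + t2) \<sigma>2"
| CondT: "b (tops \<sigma>) \<Longrightarrow> exec c1 \<sigma> t \<sigma>' \<Longrightarrow> exec (Cond b c1 c2) \<sigma> (t + 2) \<sigma>'"
| CondF: "\<not> b (tops \<sigma>) \<Longrightarrow> exec c2 \<sigma> t \<sigma>' \<Longrightarrow> exec (Cond b c1 c2) \<sigma> (t + 1) \<sigma>'"
| WhileF: "\<not> b (tops \<sigma>) \<Longrightarrow> exec (While b c) \<sigma> 1 \<sigma>"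
| WhileT: "b (tops \<sigma>) \<Longrightarrow> exec c \<sigma> t1 \<sigma>1 \<Longrightarrow> exec (While b c) \<sigma>1 t2 \<sigma>2
    \<Longrightarrow> exec (While b c) \<sigma> (t1 + t2 + 2) \<sigma>2"

fun stacks_ok :: "nat \<Rightarrow> com \<Rightarrow> bool" where
  "stacks_ok k Skip = True"
| "stacks_ok k (Push r g) = (r < k \<and> r \<noteq> 1)"
| "stacks_ok k (Put r g) = (r < k \<and> r \<noteq> 1)"
| "stacks_ok k (Pop r) = (r < k \<and> r \<noteq> 1)"
| "stacks_ok k (Out g) = True"
| "stacks_ok k (c1;; c2) = (stacks_ok k c1 \<and> stacks_ok k c2)"
| "stacks_ok k (Cond b c1 c2) = (stacks_ok k c1 \<and> stacks_ok k c2)"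
| "stacks_ok k (While b c) = stacks_ok k c"

text \<open>An instruction writes on one tape, moves its head and computes the next program counter.\<close>

type_synonym instr = "nat \<times> ((nat \<Rightarrow> nat) \<Rightarrow> nat) \<times> move \<times> ((nat \<Rightarrow> nat) \<Rightarrow> nat)"

text \<open>Every instruction writes, so a pure jump rewrites the symbol that it reads on tape
  0.\<close>

definition jump :: "((nat \<Rightarrow> nat) \<Rightarrow> nat) \<Rightarrow> instr" where
  "jump f = (0, (\<lambda>\<tau>. \<tau> 0), Move_Stay, f)"

fun clen :: "com \<Rightarrow> nat" where
  "clen Skip = 0"
| "clen (Push r g) = 2"
| "clen (Put r g) = 1"
| "clen (Pop r) = 1"
| "clen (Out g) = 1"
| "clen (c1;; c2) = clen c1 + clen c2"
| "clen (Cond b c1 c2) = clen c1 + clen c2 + 2"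
| "clen (While b c) = clen c + 2"

fun compile :: "com \<Rightarrow> nat \<Rightarrow> instr list" where
  "compile Skip p = []"
| "compile (Push r g) p = [(r, \<lambda>\<tau>. \<tau> r, Move_Left, \<lambda>_. p + 1), (r, g, Move_Stay, \<lambda>_. p + 2)]"
| "compile (Put r g) p = [(r, g, Move_Stay, \<lambda>_. p + 1)]"
| "compile (Pop r) p = [(r, \<lambda>_. 0, Move_Right, \<lambda>_. p + 1)]"
| "compile (Out g) p = [(1, g, Move_Right, \<lambda>_. p + 1)]"
| "compile (c1;; c2) p = compile c1 p @ compile c2 (p + clen c1)"
| "compile (Cond b c1 c2) p =
     jump (\<lambda>\<tau>. if b \<tau> then p + 1 else p + clen c1 + 2) # compile c1 (p + 1) @
     jump (\<lambda>_. p + clen c1 + clen c2 + 2) # compile c2 (p + clen c1 + 2)"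
| "compile (While b c) p =
     jump (\<lambda>\<tau>. if b \<tau> then p + 1 else p + clen c + 2) # compile c (p + 1) @ [jump (\<lambda>_. p)]"

lemma length_compile [simp]: "length (compile c p) = clen c"
  by (induction c arbitrary: p) auto

text \<open>State 1 must be the halting state, so positive program counters are shifted by one and
  every counter beyond the code halts. The truncated \<open>q - 1\<close> in \<open>machine\<close>
  inverts this, also for state 0.\<close>

definition state_of :: "nat \<Rightarrow> nat \<Rightarrow> nat" where
  "state_of n p = (if p = 0 then 0 else if p < n then p + 1 else 1)"

text \<open>The function \<open>g\<close> of an instruction is arbitrary; cutting its value off at 5
  makes the machine well-formed for any code.\<close>

definition machine :: "nat \<Rightarrow> instr list \<Rightarrow> turing_machine" where
  "machine k code = \<lparr>num_tapes = k, num_symbols = 5, num_states = length code + 1,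
     delta = (\<lambda>q vs. case code ! (q - 1) of (r, g, mv, nx) \<Rightarrow>
       let \<tau> = (\<lambda>i. if i < length vs then vs ! i else 0) in
       (state_of (length code) (nx \<tau>),
        map (\<lambda>i. if i = r then (if g \<tau> < 5 then g \<tau> else 0, mv) else (vs ! i, Move_Stay)) [0..<k]))\<rparr>"

lemma wf_machine:
  assumes "k \<ge> 2" "code \<noteq> []"
  shows "wf_tm (machine k code)"
proof -
  have q: "state_of (length code) p < length code + 1" for p
    using assms by (cases code) (auto simp: state_of_def)
  have "vs ! i < 5" if "i < length vs" "set vs \<subseteq> {..<5::nat}" for vs i
    using that nth_mem by blast
  moreover have "length code \<ge> 1" using assms(2) by (cases code) auto
  ultimately show ?thesis using q assms(1)
    unfolding wf_tm_def machine_def by (auto simp: Let_def split: prod.splits)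
qed

section \<open>Simulation of stack programs by machine steps\<close>

definition reads :: "tape list \<Rightarrow> nat \<Rightarrow> nat" where
  "reads ts i = (if i < length ts then read_tape (ts ! i) else 0)"

lemma step_machine:
  assumes "code ! p = (r, g, mv, nx)" "p < length code" "length ts = k" "g (reads ts) < 5"
  shows "step (machine k code) (state_of (length code) p, ts) =
    (state_of (length code) (nx (reads ts)), ts[r := act_tape (g (reads ts), mv) (ts ! r)])"
proof -
  have q: "state_of (length code) p \<noteq> 1" "state_of (length code) p - 1 = p"
    using assms(2) by (auto simp: state_of_def)
  have \<tau>: "(\<lambda>i. if i < length ts then map read_tape ts ! i else 0) = reads ts"
    by (auto simp: reads_def)
  then have \<tau>': "(\<lambda>i. if i < k then map read_tape ts ! i else 0) = reads ts"
    using assms(3) by simp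
  have stay: "act_tape (read_tape x, Move_Stay) x = x" for x
    by (cases x) auto
  have "map2 act_tape (map (\<lambda>i. if i = r then (g (reads ts), mv) else (map read_tape ts ! i, Move_Stay)) [0..<k]) ts
      = ts[r := act_tape (g (reads ts), mv) (ts ! r)]"
    by (rule nth_equalityI) (use assms(3) in \<open>auto simp: nth_list_update stay\<close>)
  then show ?thesis
    using q assms by (simp add: step_def machine_def Let_def \<tau> \<tau>' del: map_eq_conv cong del: if_weak_cong)
qed

text \<open>A stack is described relative to its head: the top lies under the head and everything to
  the left is blank. Only the output tape has absolute positions, as \<open>outputs\<close>
  demands.\<close>

definition tape_rel :: "nat \<Rightarrow> nat list \<Rightarrow> tape \<Rightarrow> bool" where
  "tape_rel r xs tp \<longleftrightarrow> set xs \<subseteq> {1..4} \<and>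
     (if r = 1 then tp = (tape_content xs, int (length xs))
      else fst tp = (\<lambda>q. tape_content xs (q - snd tp)))"

text \<open>Stacks without a tape have to be empty, so that \<open>reads\<close> and
  \<open>tops\<close> agree on all indices.\<close>

definition store_rel :: "store \<Rightarrow> tape list \<Rightarrow> bool" where
  "store_rel \<sigma> ts \<longleftrightarrow> (\<forall>r. if r < length ts then tape_rel r (\<sigma> r) (ts ! r) else \<sigma> r = [])"

lemma tape_rel_read:
  assumes "tape_rel r xs tp"
  shows "read_tape tp = (if r = 1 \<or> xs = [] then 0 else hd xs)"
  using assms by (cases tp; cases xs; cases "r = 1") (auto simp: tape_rel_def tape_content_def)

lemma reads_tops: "store_rel \<sigma> ts \<Longrightarrow> reads ts = tops \<sigma>"
proof
  fix r
  assume "store_rel \<sigma> ts"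
  then have "if r < length ts then tape_rel r (\<sigma> r) (ts ! r) else \<sigma> r = []"
    by (simp add: store_rel_def)
  then show "reads ts r = tops \<sigma> r"
    using tape_rel_read[of r "\<sigma> r" "ts ! r"] by (auto simp: reads_def tops_def split: if_splits)
qed

lemma store_rel_update:
  assumes "store_rel \<sigma> ts" "r < length ts" "tape_rel r xs tp"
  shows "store_rel (\<sigma>(r := xs)) (ts[r := tp])"
  using assms by (auto simp: store_rel_def nth_list_update)

lemma tape_content_Cons: "tape_content (s # xs) = (\<lambda>q. tape_content xs (q - 1))(0 := s)"
  by (rule ext) (auto simp: tape_content_def nth_Cons' nat_diff_distrib)

lemma tape_content_tl: "(tape_content xs)(0 := 0) = (\<lambda>q. tape_content (tl xs) (q - 1))"
  by (rule ext) (cases xs; auto simp: tape_content_def nth_Cons' nat_diff_distrib)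

lemma tape_content_snoc: "tape_content (xs @ [s]) = (tape_content xs)(int (length xs) := s)"
  by (rule ext) (auto simp: tape_content_def nth_append nat_less_iff)

lemma shift_upd: "(\<lambda>q::int. f (q - p))(p := s) = (\<lambda>q. (f(0 := s)) (q - p))"
  by (rule ext) auto

lemma tape_rel_push:
  assumes "tape_rel r xs tp" "r \<noteq> 1" "s \<in> {1..4}"
  shows "tape_rel r (s # xs) (act_tape (s, Move_Stay) (act_tape (read_tape tp, Move_Left) tp))"
  using assms
  by (cases tp) (auto simp: tape_rel_def tape_content_Cons shift_upd algebra_simps)

lemma tape_rel_put:
  assumes "tape_rel r xs tp" "r \<noteq> 1" "s \<in> {1..4}"
  shows "tape_rel r (s # tl xs) (act_tape (s, Move_Stay) tp)"
proof -
  have "(tape_content xs)(0 := s) = (tape_content (s # tl xs))"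
    by (rule ext) (cases xs; auto simp: tape_content_def nth_Cons' nat_diff_distrib)
  then show ?thesis using assms
    by (cases tp; cases xs) (auto simp: tape_rel_def shift_upd)
qed

lemma tape_rel_pop:
  assumes "tape_rel r xs tp" "r \<noteq> 1"
  shows "tape_rel r (tl xs) (act_tape (0, Move_Right) tp)"
  using assms
  by (cases tp; cases xs) (auto simp: tape_rel_def shift_upd tape_content_tl algebra_simps)

lemma tape_rel_out:
  assumes "tape_rel 1 xs tp" "s \<in> {1..4}"
  shows "tape_rel 1 (xs @ [s]) (act_tape (s, Move_Right) tp)"
  using assms by (auto simp: tape_rel_def tape_content_snoc)

definition code_at :: "instr list \<Rightarrow> nat \<Rightarrow> instr list \<Rightarrow> bool" where
  "code_at code p is \<longleftrightarrow> (\<exists>xs ys. code = xs @ is @ ys \<and> length xs = p)"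

lemma code_at_Cons: "code_at code p (i # is) \<longleftrightarrow> p < length code \<and> code ! p = i \<and> code_at code (p + 1) is"
proof
  assume "code_at code p (i # is)"
  then obtain xs ys where "code = xs @ (i # is) @ ys" "length xs = p" by (auto simp: code_at_def)
  then show "p < length code \<and> code ! p = i \<and> code_at code (p + 1) is"
    unfolding code_at_def
    by (intro conjI exI[of _ "xs @ [i]"] exI[of _ ys]) auto
next
  assume a: "p < length code \<and> code ! p = i \<and> code_at code (p + 1) is"
  then obtain xs ys where x: "code = xs @ is @ ys" "length xs = p + 1" by (auto simp: code_at_def)
  then obtain xs' where "xs = xs' @ [i]" "length xs' = p"
    using a by (cases xs rule: rev_cases) (auto simp: nth_append)
  with x show "code_at code p (i # is)" unfolding code_at_def by auto
qed

lemma code_at_append: "code_at code p (is @ js) \<Longrightarrow> code_at code p is \<and> code_at code (p + length is) js"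
  unfolding code_at_def
  by (metis append.assoc length_append)

lemma step_jump:
  assumes "code ! p = jump f" "p < length code" "store_rel \<sigma> ts" "length ts = k" "k \<ge> 2"
  shows "step (machine k code) (state_of (length code) p, ts) = (state_of (length code) (f (tops \<sigma>)), ts)"
proof -
  have "tape_rel 0 (\<sigma> 0) (ts ! 0)" using assms by (auto simp: store_rel_def)
  then have "read_tape (ts ! 0) < 5"
    using tape_rel_read[of 0 "\<sigma> 0" "ts ! 0"] by (cases "\<sigma> 0") (auto simp: tape_rel_def)
  moreover have "reads ts 0 = read_tape (ts ! 0)" using assms by (auto simp: reads_def)
  moreover have "ts[0 := act_tape (read_tape (ts ! 0), Move_Stay) (ts ! 0)] = ts"
    using assms by (cases "ts ! 0"; cases ts) auto
  ultimately show ?thesis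
    using step_machine[OF assms(1)[unfolded jump_def] assms(2,4)] reads_tops[OF assms(3)] by simp
qed

text \<open>The code may start at any position \<open>p\<close> inside a larger program; this
  generality lets the induction on \<open>exec\<close> treat subprograms in place.\<close>

lemma compile_exec:
  assumes "exec c \<sigma> t \<sigma>'" "store_rel \<sigma> ts" "length ts = k" "stacks_ok k c" "k \<ge> 2"
    "code_at code p (compile c p)"
  shows "\<exists>ts'. (step (machine k code) ^^ t) (state_of (length code) p, ts) =
      (state_of (length code) (p + clen c), ts') \<and> store_rel \<sigma>' ts' \<and> length ts' = k"
  using assms
proof (induction arbitrary: ts p rule: exec.induct)
  case (Skip \<sigma>)
  then show ?case by auto
next
  case (Push s g \<sigma> r)
  let ?ts1 = "ts[r := act_tape (read_tape (ts ! r), Move_Left) (ts ! r)]"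
  let ?ts2 = "?ts1[r := act_tape (s, Move_Stay) (?ts1 ! r)]"
  from Push.prems have c: "p < length code" "code ! p = (r, \<lambda>\<tau>. \<tau> r, Move_Left, \<lambda>_. p + 1)"
    "Suc p < length code" "code ! Suc p = (r, g, Move_Stay, \<lambda>_. p + 2)" and r: "r < k" "r \<noteq> 1"
    by (auto simp: code_at_Cons)
  have tr: "tape_rel r (\<sigma> r) (ts ! r)" using Push.prems r by (auto simp: store_rel_def)
  have rt: "reads ts r = read_tape (ts ! r)" using r Push.prems by (simp add: reads_def)
  have "read_tape (ts ! r) < 5"
    using tape_rel_read[OF tr] tr by (cases "\<sigma> r") (auto simp: tape_rel_def)
  then have s1: "step (machine k code) (state_of (length code) p, ts) = (state_of (length code) (p + 1), ?ts1)"
    using step_machine[OF c(2,1), of ts k] Push.prems by (simp add: rt)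
  \<comment> \<open>The head has moved to the blank cell left of the top. Hence the function of a
    \<open>Push\<close> sees 0 on its own stack, as the rule in \<open>exec\<close> says.\<close>
  have "read_tape (act_tape (read_tape (ts ! r), Move_Left) (ts ! r)) = 0"
    using tr r by (cases "ts ! r") (auto simp: tape_rel_def tape_content_def)
  then have rd: "reads ?ts1 = (tops \<sigma>)(r := 0)"
    using reads_tops[OF Push.prems(1)] r Push.prems(2)
    by (auto simp: reads_def fun_eq_iff nth_list_update split: if_splits)
  have s2: "step (machine k code) (state_of (length code) (p + 1), ?ts1) = (state_of (length code) (p + 2), ?ts2)"
    using step_machine[OF c(4,3), of ?ts1 k] Push.prems Push.hyps rd by simp
  have "store_rel (\<sigma>(r := s # \<sigma> r)) ?ts2"
    using store_rel_update[OF Push.prems(1), of r "s # \<sigma> r"] tape_rel_push[OF tr] r Push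
    by simp
  with s1 s2 show ?case using Push.prems(2) by (auto simp: numeral_2_eq_2 simp del: fun_upd_apply)
next
  case (Put s g \<sigma> r)
  from Put.prems have c: "p < length code" "code ! p = (r, g, Move_Stay, \<lambda>_. p + 1)"
    and r: "r < k" "r \<noteq> 1"
    by (auto simp: code_at_Cons)
  have tr: "tape_rel r (\<sigma> r) (ts ! r)" using Put.prems r by (auto simp: store_rel_def)
  show ?case
    using step_machine[OF c(2,1), of ts k] Put reads_tops[OF Put.prems(1)]
      store_rel_update[OF Put.prems(1), of r] tape_rel_put[OF tr] r by (simp del: fun_upd_apply)
next
  case (Pop r \<sigma>)
  from Pop.prems have c: "p < length code" "code ! p = (r, \<lambda>_. 0, Move_Right, \<lambda>_. p + 1)"
    and r: "r < k" "r \<noteq> 1"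
    by (auto simp: code_at_Cons)
  have tr: "tape_rel r (\<sigma> r) (ts ! r)" using Pop.prems r by (auto simp: store_rel_def)
  show ?case
    using step_machine[OF c(2,1), of ts k] Pop reads_tops[OF Pop.prems(1)]
      store_rel_update[OF Pop.prems(1), of r] tape_rel_pop[OF tr] r by (simp del: fun_upd_apply)
next
  case (Out s g \<sigma>)
  from Out.prems have c: "p < length code" "code ! p = (1, g, Move_Right, \<lambda>_. p + 1)"
    by (auto simp: code_at_Cons)
  have tr: "tape_rel 1 (\<sigma> 1) (ts ! 1)" using Out.prems by (auto simp: store_rel_def)
  show ?case
    using step_machine[OF c(2,1), of ts k] Out reads_tops[OF Out.prems(1)]
      store_rel_update[OF Out.prems(1), of 1] tape_rel_out[OF tr] by (simp del: fun_upd_apply)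
next
  case (Seq c1 \<sigma> t1 \<sigma>1 c2 t2 \<sigma>2)
  from Seq.prems have at: "code_at code p (compile c1 p)" "code_at code (p + clen c1) (compile c2 (p + clen c1))"
    using code_at_append by fastforce+
  from Seq.IH(1)[OF Seq.prems(1,2) _ Seq.prems(4) at(1)] Seq.prems obtain ts1 where
    1: "(step (machine k code) ^^ t1) (state_of (length code) p, ts) = (state_of (length code) (p + clen c1), ts1)"
      "store_rel \<sigma>1 ts1" "length ts1 = k" by auto
  from Seq.IH(2)[OF 1(2,3) _ Seq.prems(4) at(2)] Seq.prems obtain ts2 where
    2: "(step (machine k code) ^^ t2) (state_of (length code) (p + clen c1), ts1) = (state_of (length code) (p + clen c1 + clen c2), ts2)"
      "store_rel \<sigma>2 ts2" "length ts2 = k" by auto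
  have "(step (machine k code) ^^ (t1 + t2)) (state_of (length code) p, ts)
      = (step (machine k code) ^^ t2) ((step (machine k code) ^^ t1) (state_of (length code) p, ts))"
    by (subst add.commute) (simp only: funpow_add comp_def)
  with 1 2 show ?case by (simp add: add.assoc)
next
  case (CondT b \<sigma> c1 t \<sigma>' c2)
  let ?j = "\<lambda>\<tau>. if b \<tau> then p + 1 else p + clen c1 + 2"
  from CondT.prems have "code_at code p ([jump ?j] @ compile c1 (p + 1) @
       [jump (\<lambda>_. p + clen c1 + clen c2 + 2)] @ compile c2 (p + clen c1 + 2))" by simp
  then have c: "p < length code" "code ! p = jump ?j" "code_at code (p + 1) (compile c1 (p + 1))"
    "p + 1 + clen c1 < length code" "code ! (p + 1 + clen c1) = jump (\<lambda>_. p + clen c1 + clen c2 + 2)"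
    by (auto simp: code_at_Cons dest!: code_at_append)
  have s1: "step (machine k code) (state_of (length code) p, ts) = (state_of (length code) (p + 1), ts)"
    using step_jump[OF c(2,1) CondT.prems(1,2)] CondT by simp
  from CondT.IH[OF CondT.prems(1,2) _ CondT.prems(4) c(3)] CondT.prems obtain ts1 where
    1: "(step (machine k code) ^^ t) (state_of (length code) (p + 1), ts) = (state_of (length code) (p + 1 + clen c1), ts1)"
      "store_rel \<sigma>' ts1" "length ts1 = k" by auto
  have s2: "step (machine k code) (state_of (length code) (p + 1 + clen c1), ts1) = (state_of (length code) (p + clen c1 + clen c2 + 2), ts1)"
    using step_jump[OF c(5,4) 1(2,3)] CondT.prems by simp
  have "(step (machine k code) ^^ (Suc (t + 1))) (state_of (length code) p, ts)
     = (step (machine k code)) ((step (machine k code) ^^ t) (step (machine k code) (state_of (length code) p, ts)))"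
    by (simp only: funpow_Suc_right[symmetric] funpow.simps(2) comp_def funpow_add) (simp add: funpow_swap1)
  with s1 1 s2 show ?case by (auto simp: add.assoc)
next
  case (CondF b \<sigma> c2 t \<sigma>' c1)
  let ?j = "\<lambda>\<tau>. if b \<tau> then p + 1 else p + clen c1 + 2"
  from CondF.prems have "code_at code p ([jump ?j] @ compile c1 (p + 1) @
       [jump (\<lambda>_. p + clen c1 + clen c2 + 2)] @ compile c2 (p + clen c1 + 2))" by simp
  then have c: "p < length code" "code ! p = jump ?j" "code_at code (p + clen c1 + 2) (compile c2 (p + clen c1 + 2))"
    by (auto simp: code_at_Cons dest!: code_at_append)
  have s1: "step (machine k code) (state_of (length code) p, ts) = (state_of (length code) (p + clen c1 + 2), ts)"
    using step_jump[OF c(2,1) CondF.prems(1,2)] CondF by simp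
  from CondF.IH[OF CondF.prems(1,2) _ CondF.prems(4) c(3)] CondF.prems s1
  show ?case by (auto simp: funpow_swap1 algebra_simps)
next
  case (WhileF b \<sigma> c)
  let ?j = "\<lambda>\<tau>. if b \<tau> then p + 1 else p + clen c + 2"
  from WhileF.prems have c: "p < length code" "code ! p = jump ?j"
    by (auto simp: code_at_Cons)
  show ?case
    using step_jump[OF c(2,1) WhileF.prems(1,2)] WhileF by auto
next
  case (WhileT b \<sigma> c t1 \<sigma>1 t2 \<sigma>2)
  let ?j = "\<lambda>\<tau>. if b \<tau> then p + 1 else p + clen c + 2"
  from WhileT.prems have "code_at code p ([jump ?j] @ compile c (p + 1) @ [jump (\<lambda>_. p)])" by simp
  then have c: "p < length code" "code ! p = jump ?j" "code_at code (p + 1) (compile c (p + 1))"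
    "p + 1 + clen c < length code" "code ! (p + 1 + clen c) = jump (\<lambda>_. p)"
    by (auto simp: code_at_Cons dest!: code_at_append)
  have s1: "step (machine k code) (state_of (length code) p, ts) = (state_of (length code) (p + 1), ts)"
    using step_jump[OF c(2,1) WhileT.prems(1,2)] WhileT by simp
  from WhileT.IH(1)[OF WhileT.prems(1,2) _ WhileT.prems(4) c(3)] WhileT.prems obtain ts1 where
    1: "(step (machine k code) ^^ t1) (state_of (length code) (p + 1), ts) = (state_of (length code) (p + 1 + clen c), ts1)"
      "store_rel \<sigma>1 ts1" "length ts1 = k" by auto
  have s2: "step (machine k code) (state_of (length code) (p + 1 + clen c), ts1) = (state_of (length code) p, ts1)"
    using step_jump[OF c(5,4) 1(2,3)] WhileT.prems by simp
  from WhileT.IH(2)[OF 1(2,3) _ WhileT.prems(4,5)] WhileT.prems obtain ts2 where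
    2: "(step (machine k code) ^^ t2) (state_of (length code) p, ts1) = (state_of (length code) (p + clen (While b c)), ts2)"
      "store_rel \<sigma>2 ts2" "length ts2 = k" by auto
  have "t1 + t2 + 2 = t2 + (1 + (t1 + 1))" by simp
  then have "(step (machine k code) ^^ (t1 + t2 + 2)) (state_of (length code) p, ts)
     = (step (machine k code) ^^ t2) (step (machine k code) ((step (machine k code) ^^ t1) (step (machine k code) (state_of (length code) p, ts))))"
    by (simp only: funpow_add comp_def One_nat_def funpow.simps id_def)
  with s1 1 s2 2 show ?case by auto
qed

lemma step_halted: "fst cfg = 1 \<Longrightarrow> (step T ^^ n) cfg = cfg"
  by (induction n) (auto simp: step_def split: prod.splits)

theorem machine_exec:
  assumes "exec c ((\<lambda>_. [])(0 := w)) t \<sigma>'" "stacks_ok k c" "k \<ge> 2" "clen c > 0" "set w \<subseteq> {1..4}"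
  defines "T \<equiv> machine k (compile c 0)"
  shows "outputs T w (\<sigma>' 1)" "runtime T w \<le> t"
proof -
  have rel: "store_rel ((\<lambda>_. [])(0 := w)) (snd (init_config T w))"
    using assms(3,5) unfolding store_rel_def
    by (auto simp: T_def init_config_def machine_def tape_rel_def tape_content_def nth_Cons')
  have "state_of (clen c) 0 = fst (init_config T w)"
    by (simp add: state_of_def init_config_def)
  moreover have "length (snd (init_config T w)) = k"
    using assms(3) by (simp add: init_config_def T_def machine_def)
  moreover have "code_at (compile c 0) 0 (compile c 0)"
    by (auto simp: code_at_def)
  ultimately obtain ts' where ts': "(step T ^^ t) (init_config T w) = (state_of (clen c) (clen c), ts')"
      "store_rel \<sigma>' ts'" "length ts' = k"
    using compile_exec[OF assms(1) rel _ assms(2,3), of "compile c 0" 0]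
    unfolding T_def by (metis add_0 length_compile prod.collapse)
  have h: "fst (run T w t) = 1"
    using ts' assms(4) by (simp add: run_def state_of_def)
  then show "runtime T w \<le> t" unfolding runtime_def by (rule Least_le)
  have h2: "fst (run T w (runtime T w)) = 1"
    unfolding runtime_def using h by (rule LeastI)
  \<comment> \<open>The output is read at the first halting time, which may precede
    \<open>t\<close>; a halted configuration no longer changes.\<close>
  have "run T w (t - runtime T w + runtime T w) = (step T ^^ (t - runtime T w)) (run T w (runtime T w))"
    by (simp only: run_def funpow_add comp_def)
  then have "run T w (runtime T w) = run T w t"
    using step_halted[OF h2] \<open>runtime T w \<le> t\<close> by simp
  moreover have "halts T w" unfolding halts_def using h by blast
  moreover have "tape_rel 1 (\<sigma>' 1) (ts' ! 1)" using ts' assms(3) by (auto simp: store_rel_def)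
  ultimately show "outputs T w (\<sigma>' 1)"
    using ts' by (simp add: outputs_def run_def tape_rel_def)
qed

section \<open>Binary numbers\<close>

abbreviation blen :: "nat \<Rightarrow> nat" where
  "blen n \<equiv> length (binary n)"

fun bval :: "nat list \<Rightarrow> nat" where
  "bval [] = 0"
| "bval (s # ds) = (s - 1) + 2 * bval ds"

lemma binary_0 [simp]: "binary 0 = []"
  by (simp add: binary.simps)

lemma binary_eq_Nil [simp]: "binary n = [] \<longleftrightarrow> n = 0"
  by (subst binary.simps) simp

lemma binary_1 [simp]: "binary (Suc 0) = [2]"
  by (simp add: binary.simps)

lemma binary_double: "n > 0 \<Longrightarrow> binary (2 * n) = 1 # binary n"
  by (subst binary.simps) simp

lemma tl_binary: "tl (binary n) = binary (n div 2)"
  by (subst binary.simps) simp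

lemma set_binary: "set (binary n) \<subseteq> {1, 2}"
proof (induction n rule: less_induct)
  case (less n)
  then show ?case by (cases "n = 0") (simp_all add: binary.simps[of n])
qed

lemma bval_binary [simp]: "bval (binary n) = n"
proof (induction n rule: less_induct)
  case (less n)
  show ?case
  proof (cases "n = 0")
    case False
    then have "bval (binary (n div 2)) = n div 2" by (intro less) simp
    with False show ?thesis by (subst binary.simps) (auto elim: oddE)
  qed simp
qed

lemma bval_append: "bval (xs @ ys) = bval xs + 2 ^ length xs * bval ys"
  by (induction xs) (simp_all add: algebra_simps)

lemma bval_replicate_1 [simp]: "bval (replicate k (Suc 0)) = 0"
  by (induction k) simp_all

lemma bval_less: "set ds \<subseteq> {1, 2} \<Longrightarrow> bval ds < 2 ^ length ds"
  by (induction ds) auto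

lemma less_power_blen: "n < 2 ^ blen n"
  using bval_less[OF set_binary, of n] by simp

lemma binary_bval:
  assumes "set ds \<subseteq> {1, 2}" "ds = [] \<or> last ds = 2"
  shows "binary (bval ds) = ds"
  using assms
proof (induction ds)
  case (Cons s ds)
  have IH: "binary (bval ds) = ds" using Cons by (cases ds) auto
  show ?case
  proof (cases "ds = []")
    case False
    then have "bval ds \<noteq> 0" using IH by (metis binary_0)
    then show ?thesis using Cons.prems IH by (subst binary.simps) auto
  qed (use Cons.prems in auto)
qed simp

text \<open>Results are collected with the most significant digit on top. Normalizing therefore
  means popping the symbol 1 from the top as long as possible, which is \<open>dropWhile\<close> on
  the reversed string.\<close>

lemma binary_bval_strip:
  assumes "set ds \<subseteq> {1, 2}"
  shows "binary (bval ds) = rev (dropWhile (\<lambda>s. s = 1) (rev ds))"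
proof -
  define es where "es = rev (dropWhile (\<lambda>s. s = 1) (rev ds))"
  define zs where "zs = takeWhile (\<lambda>s. s = 1) (rev ds)"
  have "rev ds = zs @ rev es" by (simp add: es_def zs_def)
  then have ds: "ds = es @ rev zs" by (metis rev_append rev_rev_ident)
  have "rev zs = replicate (length zs) 1"
    unfolding zs_def by (intro replicate_eqI) (auto dest: set_takeWhileD)
  with ds have "bval ds = bval es" by (simp add: bval_append)
  moreover have "es = [] \<or> last es = 2"
  proof (cases "dropWhile (\<lambda>s. s = 1) (rev ds)")
    case (Cons a list)
    then have "a \<noteq> 1" using hd_dropWhile[of "\<lambda>s. s = 1" "rev ds"] by simp
    moreover have "a \<in> set (dropWhile (\<lambda>s. s = 1) (rev ds))" using Cons by simp
    then have "a \<in> set (rev ds)" by (rule set_dropWhileD)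
    ultimately have "a = 2" using assms by auto
    with Cons show ?thesis by (simp add: es_def)
  qed (simp add: es_def)
  moreover have "set es \<subseteq> {1, 2}" using ds assms by auto
  ultimately show ?thesis using binary_bval[of es] es_def by simp
qed

lemma blen_le: "n < 2 ^ k \<Longrightarrow> blen n \<le> k"
proof (induction k arbitrary: n)
  case (Suc k)
  show ?case
  proof (cases "n = 0")
    case False
    have "blen (n div 2) \<le> k" using Suc by auto
    with False show ?thesis by (subst binary.simps) simp
  qed simp
qed simp

lemma power_blen_le: "n > 0 \<Longrightarrow> 2 ^ (blen n - 1) \<le> n"
  by (rule ccontr) (use blen_le[of n "blen n - 1"] in \<open>cases "binary n", auto\<close>)

lemma blen_mono: "a \<le> b \<Longrightarrow> blen a \<le> blen b"
  using less_power_blen[of b] by (intro blen_le) simp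

lemma blen_add: "blen a \<le> n \<Longrightarrow> blen b \<le> n \<Longrightarrow> blen (a + b) \<le> n + 1"
proof (rule blen_le)
  assume "blen a \<le> n" "blen b \<le> n"
  then have "a < 2 ^ n" "b < 2 ^ n"
    using less_power_blen by (meson less_le_trans one_le_numeral power_increasing)+
  then show "a + b < 2 ^ (n + 1)" by simp
qed

lemma blen_mult: "blen (a * b) \<le> blen a + blen b"
proof (rule blen_le)
  show "a * b < 2 ^ (blen a + blen b)"
    unfolding power_add using less_power_blen[of a] less_power_blen[of b]
    by (intro mult_strict_mono) auto
qed

lemma blen_double: "blen (2 * n) \<le> blen n + 1"
  by (cases "n = 0") (simp_all add: binary_double)

section \<open>Arithmetic programs\<close>

text \<open>Exact times depend on the digits involved; upper bounds can be weakened and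
  composed.\<close>

definition runs :: "com \<Rightarrow> store \<Rightarrow> nat \<Rightarrow> store \<Rightarrow> bool" where
  "runs c \<sigma> b \<sigma>' \<longleftrightarrow> (\<exists>t\<le>b. exec c \<sigma> t \<sigma>')"

lemma runs_weaken: "runs c \<sigma> b \<sigma>1 \<Longrightarrow> \<sigma>1 = \<sigma>' \<Longrightarrow> b \<le> b' \<Longrightarrow> runs c \<sigma> b' \<sigma>'"
  unfolding runs_def by (meson le_trans)

lemma runs_Skip: "runs Skip \<sigma> 0 \<sigma>"
  unfolding runs_def using exec.Skip by blast

lemma runs_Push: "g ((tops \<sigma>)(r := 0)) = s \<Longrightarrow> s \<in> {1..4} \<Longrightarrow> runs (Push r g) \<sigma> 2 (\<sigma>(r := s # \<sigma> r))"
  unfolding runs_def using exec.Push by blast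

lemma runs_Put: "g (tops \<sigma>) = s \<Longrightarrow> s \<in> {1..4} \<Longrightarrow> runs (Put r g) \<sigma> 1 (\<sigma>(r := s # tl (\<sigma> r)))"
  unfolding runs_def using exec.Put by blast

lemma runs_Pop: "runs (Pop r) \<sigma> 1 (\<sigma>(r := tl (\<sigma> r)))"
  unfolding runs_def using exec.Pop by blast

lemma runs_Out: "g (tops \<sigma>) = s \<Longrightarrow> s \<in> {1..4} \<Longrightarrow> runs (Out g) \<sigma> 1 (\<sigma>(1 := \<sigma> 1 @ [s]))"
  unfolding runs_def using exec.Out by blast

lemma runs_Seq: "runs c1 \<sigma> b1 \<sigma>1 \<Longrightarrow> runs c2 \<sigma>1 b2 \<sigma>2 \<Longrightarrow> runs (c1;; c2) \<sigma> (b1 + b2) \<sigma>2"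
  unfolding runs_def using exec.Seq by (meson add_mono)

lemma runs_CondT: "b (tops \<sigma>) \<Longrightarrow> runs c1 \<sigma> t \<sigma>' \<Longrightarrow> runs (Cond b c1 c2) \<sigma> (t + 2) \<sigma>'"
  unfolding runs_def using exec.CondT by (meson add_le_mono1)

lemma runs_CondF: "\<not> b (tops \<sigma>) \<Longrightarrow> runs c2 \<sigma> t \<sigma>' \<Longrightarrow> runs (Cond b c1 c2) \<sigma> (t + 1) \<sigma>'"
  unfolding runs_def using exec.CondF by (meson add_le_mono1)

lemma runs_WhileF: "\<not> b (tops \<sigma>) \<Longrightarrow> runs (While b c) \<sigma> 1 \<sigma>"
  unfolding runs_def using exec.WhileF by blast

lemma runs_WhileT: "b (tops \<sigma>) \<Longrightarrow> runs c \<sigma> t1 \<sigma>1 \<Longrightarrow> runs (While b c) \<sigma>1 t2 \<sigma>2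
    \<Longrightarrow> runs (While b c) \<sigma> (t1 + t2 + 2) \<sigma>2"
  unfolding runs_def using exec.WhileT[of b \<sigma> c _ \<sigma>1 _ \<sigma>2] by (meson add_le_mono add_le_mono1)

section \<open>Moving, copying and clearing digit strings\<close>

fun pushes :: "nat \<Rightarrow> nat list \<Rightarrow> com" where
  "pushes a [] = Skip"
| "pushes a (b # bs) = Push b (\<lambda>\<tau>. \<tau> a);; pushes a bs"

text \<open>The finite control holds no symbol between instructions, so symbols travel from top to
  top and arrive in reverse order. All moving, copying and clearing below is an instance of this
  loop.\<close>

definition transfer :: "(nat \<Rightarrow> bool) \<Rightarrow> nat \<Rightarrow> nat list \<Rightarrow> com" where
  "transfer P a bs = While (\<lambda>\<tau>. P (\<tau> a)) (pushes a bs;; Pop a)"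

lemma runs_pushes:
  assumes "a \<noteq> 1" "a \<notin> set bs" "distinct bs" "\<sigma> a = s # ds" "s \<in> {1..4}"
  shows "runs (pushes a bs) \<sigma> (2 * length bs) (\<lambda>r. if r \<in> set bs then s # \<sigma> r else \<sigma> r)"
  using assms
proof (induction bs arbitrary: \<sigma>)
  case Nil
  then show ?case using runs_Skip by simp
next
  case (Cons b bs)
  have "runs (Push b (\<lambda>\<tau>. \<tau> a)) \<sigma> 2 (\<sigma>(b := s # \<sigma> b))"
    using Cons.prems by (intro runs_Push) (auto simp: tops_def)
  moreover have "runs (pushes a bs) (\<sigma>(b := s # \<sigma> b)) (2 * length bs)
      (\<lambda>r. if r \<in> set bs then s # (\<sigma>(b := s # \<sigma> b)) r else (\<sigma>(b := s # \<sigma> b)) r)"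
    using Cons.prems by (intro Cons.IH) auto
  ultimately have "runs (pushes a (b # bs)) \<sigma> (2 + 2 * length bs)
      (\<lambda>r. if r \<in> set bs then s # (\<sigma>(b := s # \<sigma> b)) r else (\<sigma>(b := s # \<sigma> b)) r)"
    unfolding pushes.simps by (rule runs_Seq)
  then show ?case
    by (rule runs_weaken) (use Cons.prems in \<open>auto simp: fun_eq_iff\<close>)
qed

lemma runs_transfer:
  assumes "a \<noteq> 1" "a \<notin> set bs" "distinct bs" "\<sigma> a = ds @ rest" "set ds \<subseteq> {1..4}"
    "\<forall>s\<in>set ds. P s" "\<not> P (case rest of [] \<Rightarrow> 0 | s # _ \<Rightarrow> s)"
  shows "runs (transfer P a bs) \<sigma> ((2 * length bs + 3) * length ds + 1)
    (\<lambda>r. if r = a then rest else if r \<in> set bs then rev ds @ \<sigma> r else \<sigma> r)"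
  using assms
proof (induction ds arbitrary: \<sigma>)
  case Nil
  then have "\<not> P (tops \<sigma> a)" by (auto simp: tops_def split: list.splits)
  then have "runs (transfer P a bs) \<sigma> 1 \<sigma>"
    unfolding transfer_def by (rule runs_WhileF)
  then show ?case by (rule runs_weaken) (use Nil in auto)
next
  case (Cons s ds)
  let ?\<sigma>1 = "\<lambda>r. if r \<in> set bs then s # \<sigma> r else \<sigma> r"
  let ?\<sigma>2 = "?\<sigma>1(a := tl (?\<sigma>1 a))"
  have "runs (pushes a bs;; Pop a) \<sigma> (2 * length bs + 1) ?\<sigma>2"
    using Cons.prems by (intro runs_Seq[OF runs_pushes runs_Pop]) auto
  moreover have "P (tops \<sigma> a)" using Cons.prems by (auto simp: tops_def)
  moreover have "runs (transfer P a bs) ?\<sigma>2 ((2 * length bs + 3) * length ds + 1)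
      (\<lambda>r. if r = a then rest else if r \<in> set bs then rev ds @ ?\<sigma>2 r else ?\<sigma>2 r)"
    using Cons.prems by (intro Cons.IH) auto
  ultimately have "runs (transfer P a bs) \<sigma>
      (2 * length bs + 1 + ((2 * length bs + 3) * length ds + 1) + 2)
      (\<lambda>r. if r = a then rest else if r \<in> set bs then rev ds @ ?\<sigma>2 r else ?\<sigma>2 r)"
    unfolding transfer_def using runs_WhileT[of "\<lambda>\<tau>. P (\<tau> a)"] by fast
  then show ?case
    by (rule runs_weaken) (use Cons.prems in \<open>auto simp: fun_eq_iff\<close>)
qed

definition digit :: "nat \<Rightarrow> bool" where
  "digit s \<longleftrightarrow> s = 1 \<or> s = 2"

lemma digit_simps [simp]: "\<not> digit 0" "digit (Suc 0)" "digit 2" "\<not> digit 3" "\<not> digit 4"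
  by (auto simp: digit_def)

abbreviation nodigit :: "nat list \<Rightarrow> bool" where
  "nodigit xs \<equiv> \<not> digit (case xs of [] \<Rightarrow> 0 | s # _ \<Rightarrow> s)"

definition move :: "nat \<Rightarrow> nat \<Rightarrow> com" where
  "move a b = transfer digit a [b]"

lemma runs_move:
  assumes "a \<noteq> 1" "a \<noteq> b" "\<sigma> a = ds @ rest" "set ds \<subseteq> {1, 2}" "nodigit rest" "length ds \<le> n"
  shows "runs (move a b) \<sigma> (5 * n + 1) (\<sigma>(a := rest, b := rev ds @ \<sigma> b))"
  unfolding move_def
  by (rule runs_weaken, rule runs_transfer[where ds = ds and rest = rest])
    (use assms in \<open>auto simp: fun_eq_iff digit_def\<close>)

definition clear :: "nat \<Rightarrow> com" where
  "clear a = transfer digit a []"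

lemma runs_clear:
  assumes "a \<noteq> 1" "\<sigma> a = ds @ rest" "set ds \<subseteq> {1, 2}" "nodigit rest" "length ds \<le> n"
  shows "runs (clear a) \<sigma> (3 * n + 1) (\<sigma>(a := rest))"
  unfolding clear_def
  by (rule runs_weaken, rule runs_transfer[where ds = ds and rest = rest])
    (use assms in \<open>auto simp: fun_eq_iff digit_def\<close>)

lemma runs_clear_number:
  assumes "a \<noteq> 1" "\<sigma> a = binary k" "blen k \<le> n"
  shows "runs (clear a) \<sigma> (3 * n + 1) (\<sigma>(a := []))"
  by (rule runs_clear[where ds = "binary k"]) (use assms set_binary in auto)

text \<open>Stacks 2 to 5 are scratch space of the arithmetic programs.\<close>

definition scratch_empty :: "store \<Rightarrow> bool" where
  "scratch_empty \<sigma> \<longleftrightarrow> \<sigma> 2 = [] \<and> \<sigma> 3 = [] \<and> \<sigma> 4 = [] \<and> \<sigma> 5 = []"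

lemma scratch_empty_update [simp]: "5 < r \<Longrightarrow> scratch_empty (\<sigma>(r := xs)) = scratch_empty \<sigma>"
  "scratch_empty (\<sigma>(0 := xs)) = scratch_empty \<sigma>" "scratch_empty (\<sigma>(1 := xs)) = scratch_empty \<sigma>"
  by (auto simp: scratch_empty_def)

text \<open>The detour over stack 2 reverses twice and so restores the digit order on both
  stacks.\<close>

definition copy :: "nat \<Rightarrow> nat \<Rightarrow> com" where
  "copy a b = move a 2;; transfer digit 2 [a, b]"

lemma runs_copy:
  assumes "2 < a" "2 < b" "a \<noteq> b" "\<sigma> a = binary k" "\<sigma> b = []" "\<sigma> 2 = []" "blen k \<le> n"
  shows "runs (copy a b) \<sigma> (12 * n + 2) (\<sigma>(b := binary k))"
proof -
  let ?\<sigma>1 = "\<sigma>(a := [], 2 := rev (binary k) @ \<sigma> 2)"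
  have "runs (move a 2) \<sigma> (5 * n + 1) ?\<sigma>1"
    using assms set_binary by (intro runs_move) auto
  moreover have "runs (transfer digit 2 [a, b]) ?\<sigma>1 (7 * n + 1) (\<sigma>(b := binary k))"
    by (rule runs_weaken, rule runs_transfer[where ds = "rev (binary k)" and rest = "[]"])
      (use assms set_binary[of k] in \<open>auto simp: fun_eq_iff digit_def\<close>)
  ultimately show ?thesis
    unfolding copy_def by (intro runs_weaken[OF runs_Seq]) auto
qed

text \<open>
  Ripple-carry arithmetic, least significant bitval first: the carry or borrow is a digit on stack 3;
  the function \<open>g\<close> computes its next value. The sum or difference is collected on stack 2.
\<close>

definition bitval :: "nat \<Rightarrow> nat" where
  "bitval s = (if s = 2 then 1 else 0)"

definition digit_of :: "bool \<Rightarrow> nat" where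
  "digit_of b = (if b then 2 else 1)"

definition carry :: "nat \<Rightarrow> nat \<Rightarrow> nat \<Rightarrow> bool" where
  "carry a b c \<longleftrightarrow> bitval a + bitval b + bitval c \<ge> 2"

definition borrow :: "nat \<Rightarrow> nat \<Rightarrow> nat \<Rightarrow> bool" where
  "borrow a b c \<longleftrightarrow> bitval a < bitval b + bitval c"

definition ripple :: "(nat \<Rightarrow> nat \<Rightarrow> nat \<Rightarrow> bool) \<Rightarrow> nat \<Rightarrow> nat \<Rightarrow> com" where
  "ripple g x y = While (\<lambda>\<tau>. \<tau> x \<noteq> 0 \<or> \<tau> y \<noteq> 0)
     (Push 2 (\<lambda>\<tau>. digit_of (odd (bitval (\<tau> x) + bitval (\<tau> y) + bitval (\<tau> 3))));;
      Put 3 (\<lambda>\<tau>. digit_of (g (\<tau> x) (\<tau> y) (\<tau> 3)));; Pop x;; Pop y)"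

text \<open>The sign \<open>e\<close> is 1 for addition and -1 for subtraction; in both cases the
  result digit is the parity of the three bits. The premise is the identity for one digit position,
  and the conclusion sums it over all positions, leaving the last carry with weight
  \<open>e * 2 ^ length ds\<close>.\<close>

lemma runs_ripple:
  fixes e :: int
  assumes g: "\<And>a b c. int (bitval (digit_of (odd (bitval a + bitval b + bitval c)))) + 2 * e * int (bitval (digit_of (g a b c)))
      = int (bitval a) + e * int (bitval b + bitval c)"
    and "x > 3" "y > 3" "x \<noteq> y"
    and "\<sigma> x = xs" "\<sigma> y = ys" "set xs \<subseteq> {1, 2}" "set ys \<subseteq> {1, 2}" "\<sigma> 3 = [c]"
  shows "\<exists>ds c'. runs (ripple g x y) \<sigma> (7 * max (length xs) (length ys) + 1)
       (\<sigma>(x := [], y := [], 2 := rev ds @ \<sigma> 2, 3 := [c'])) \<and> set ds \<subseteq> {1, 2} \<and> 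
     length ds = max (length xs) (length ys) \<and> (c \<in> {1, 2} \<longrightarrow> c' \<in> {1, 2}) \<and>
     int (bval ds) + e * 2 ^ length ds * int (bitval c') = int (bval xs) + e * int (bval ys + bitval c)"
  using assms(2-)
proof (induction "max (length xs) (length ys)" arbitrary: \<sigma> xs ys c)
  case 0
  then have "runs (ripple g x y) \<sigma> 1 \<sigma>"
    unfolding ripple_def by (intro runs_WhileF) (auto simp: tops_def)
  then show ?case using 0
    by (intro exI[of _ "[]"] exI[of _ c]) (auto elim!: runs_weaken simp: fun_eq_iff)
next
  case (Suc n)
  \<comment> \<open>Past its end a number reads as blank, whose \<open>bitval\<close> is 0, so the
    shorter operand is padded with zeros implicitly.\<close>
  define a where "a = (case xs of [] \<Rightarrow> 0 | s # _ \<Rightarrow> s)"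
  define b where "b = (case ys of [] \<Rightarrow> 0 | s # _ \<Rightarrow> s)"
  define s where "s = digit_of (odd (bitval a + bitval b + bitval c))"
  define c1 where "c1 = digit_of (g a b c)"
  have ab: "tops \<sigma> x = a" "tops \<sigma> y = b" "tops \<sigma> 3 = c"
    using Suc.prems by (auto simp: tops_def a_def b_def split: list.splits)
  have s: "s \<in> {1, 2}" "c1 \<in> {1, 2}" by (auto simp: s_def c1_def digit_of_def)
  let ?\<sigma>1 = "\<sigma>(2 := s # \<sigma> 2)"
  let ?\<sigma>2 = "?\<sigma>1(3 := c1 # tl (?\<sigma>1 3))"
  let ?\<sigma>3 = "?\<sigma>2(x := tl (?\<sigma>2 x))"
  let ?\<sigma>4 = "?\<sigma>3(y := tl (?\<sigma>3 y))"
  have "runs (Push 2 (\<lambda>\<tau>. digit_of (odd (bitval (\<tau> x) + bitval (\<tau> y) + bitval (\<tau> 3))))) \<sigma> 2 ?\<sigma>1"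
    using ab s Suc.prems by (intro runs_Push) (auto simp: s_def)
  moreover have "runs (Put 3 (\<lambda>\<tau>. digit_of (g (\<tau> x) (\<tau> y) (\<tau> 3)))) ?\<sigma>1 1 ?\<sigma>2"
    using ab s Suc.prems by (intro runs_Put) (auto simp: c1_def tops_def)
  moreover have "runs (Pop x) ?\<sigma>2 1 ?\<sigma>3" "runs (Pop y) ?\<sigma>3 1 ?\<sigma>4"
    by (rule runs_Pop)+
  ultimately have body: "runs (Push 2 (\<lambda>\<tau>. digit_of (odd (bitval (\<tau> x) + bitval (\<tau> y) + bitval (\<tau> 3))));;
      Put 3 (\<lambda>\<tau>. digit_of (g (\<tau> x) (\<tau> y) (\<tau> 3)));; Pop x;; Pop y) \<sigma> (2 + (1 + (1 + 1))) ?\<sigma>4"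
    by (intro runs_Seq)
  have test: "tops \<sigma> x \<noteq> 0 \<or> tops \<sigma> y \<noteq> 0"
    using Suc.hyps(2) Suc.prems unfolding ab a_def b_def by (auto split: list.splits)
  have n: "n = max (length (tl xs)) (length (tl ys))" using Suc.hyps(2) by auto
  have sub: "set (tl xs) \<subseteq> {1, 2}" "set (tl ys) \<subseteq> {1, 2}"
    using Suc.prems(6,7) by (cases xs; cases ys; auto)+
  have "\<exists>ds c'. runs (ripple g x y) ?\<sigma>4 (7 * max (length (tl xs)) (length (tl ys)) + 1)
       (?\<sigma>4(x := [], y := [], 2 := rev ds @ ?\<sigma>4 2, 3 := [c'])) \<and> set ds \<subseteq> {1, 2} \<and> 
     length ds = max (length (tl xs)) (length (tl ys)) \<and> (c1 \<in> {1, 2} \<longrightarrow> c' \<in> {1, 2}) \<and>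
     int (bval ds) + e * 2 ^ length ds * int (bitval c') = int (bval (tl xs)) + e * int (bval (tl ys) + bitval c1)"
    by (rule Suc.hyps(1)[OF n]) (use Suc.prems sub in auto)
  from this[folded n] obtain ds c' where ds: "runs (ripple g x y) ?\<sigma>4 (7 * n + 1)
       (?\<sigma>4(x := [], y := [], 2 := rev ds @ ?\<sigma>4 2, 3 := [c']))" "set ds \<subseteq> {1, 2}"
     "length ds = n" "c1 \<in> {1, 2} \<longrightarrow> c' \<in> {1, 2}"
     "int (bval ds) + e * 2 ^ length ds * int (bitval c') = int (bval (tl xs)) + e * int (bval (tl ys) + bitval c1)"
    by (elim exE conjE) (rule that)
  have c': "c' \<in> {1, 2}" using ds(4) s(2) by blast
  have st: "?\<sigma>4(x := [], y := [], 2 := rev ds @ ?\<sigma>4 2, 3 := [c'])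
      = \<sigma>(x := [], y := [], 2 := rev (s # ds) @ \<sigma> 2, 3 := [c'])"
    using Suc.prems by (auto simp: fun_eq_iff)
  have r: "runs (ripple g x y) \<sigma> (2 + (1 + (1 + 1)) + (7 * n + 1) + 2)
      (\<sigma>(x := [], y := [], 2 := rev (s # ds) @ \<sigma> 2, 3 := [c']))"
    using runs_WhileT[OF _ body ds(1)[unfolded ripple_def]] test
    unfolding st ripple_def by simp
  have xs: "bval xs = bitval a + 2 * bval (tl xs)" and ys: "bval ys = bitval b + 2 * bval (tl ys)"
    using Suc.prems by (cases xs; cases ys; auto simp: a_def b_def bitval_def)+
  have "bval (s # ds) = bitval s + 2 * bval ds" using s by (auto simp: bitval_def)
  then have "int (bval (s # ds)) + e * 2 ^ length (s # ds) * int (bitval c')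
      = int (bitval s) + 2 * (int (bval ds) + e * 2 ^ length ds * int (bitval c'))"
    by (simp add: algebra_simps)
  also have "\<dots> = (int (bitval s) + 2 * e * int (bitval c1)) + 2 * int (bval (tl xs)) + 2 * e * int (bval (tl ys))"
    by (simp only: ds(5)) (simp add: algebra_simps)
  also have "\<dots> = int (bval xs) + e * int (bval ys + bitval c)"
    unfolding s_def c1_def g xs ys by (simp add: algebra_simps)
  finally have "int (bval (s # ds)) + e * 2 ^ length (s # ds) * int (bitval c')
      = int (bval xs) + e * int (bval ys + bitval c)" .
  moreover have "set (s # ds) \<subseteq> {1, 2}" using s(1) ds(2) by simp
  moreover have len: "length (s # ds) = max (length xs) (length ys)" using ds(3) Suc.hyps(2) by simp
  moreover have "runs (ripple g x y) \<sigma> (7 * max (length xs) (length ys) + 1)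
      (\<sigma>(x := [], y := [], 2 := rev (s # ds) @ \<sigma> 2, 3 := [c']))"
    by (rule runs_weaken[OF r]) (use len ds(3) in auto)
  ultimately show ?case using c' by blast
qed

definition strip :: com where
  "strip = transfer (\<lambda>s. s = 1) 2 []"

definition finish :: "nat \<Rightarrow> com" where
  "finish x = strip;; move 2 x"

lemma runs_finish:
  assumes "\<sigma> 2 = rev ds" "set ds \<subseteq> {1, 2}" "\<sigma> x = []" "x > 2" "length ds \<le> n"
  shows "runs (finish x) \<sigma> (8 * n + 2) (\<sigma>(2 := [], x := binary (bval ds)))"
proof -
  define zs where "zs = takeWhile (\<lambda>s. s = 1) (rev ds)"
  define es where "es = dropWhile (\<lambda>s. s = 1) (rev ds)"
  have ds: "rev ds = zs @ es" "binary (bval ds) = rev es"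
    using binary_bval_strip[OF assms(2)] by (auto simp: zs_def es_def)
  have "length (rev ds) = length zs + length es" unfolding ds(1) by simp
  then have len: "length zs \<le> n" "length es \<le> n" using assms(5) by auto
  have sub: "set zs \<subseteq> {1, 2}" "set es \<subseteq> {1, 2}"
    using assms(2) ds(1) by (metis set_append set_rev le_sup_iff)+
  have "\<forall>s\<in>set zs. s = 1" unfolding zs_def by (auto dest: set_takeWhileD)
  moreover have "(case es of [] \<Rightarrow> 0 | s # _ \<Rightarrow> s) \<noteq> 1"
  proof (cases es)
    case (Cons s es')
    then have "s \<noteq> 1" unfolding es_def using hd_dropWhile[of "\<lambda>s. s = 1" "rev ds"] by simp
    with Cons show ?thesis by simp
  qed simp
  ultimately have "runs strip \<sigma> (3 * n + 1) (\<sigma>(2 := es))"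
    unfolding strip_def using assms ds sub len
    by (intro runs_weaken[OF runs_transfer[where ds = zs and rest = es]]) (auto simp: fun_eq_iff)
  moreover have "runs (move 2 x) (\<sigma>(2 := es)) (5 * n + 1) ((\<sigma>(2 := es))(2 := [], x := rev es @ (\<sigma>(2 := es)) x))"
    using assms ds sub len by (intro runs_move) auto
  ultimately show ?thesis unfolding finish_def
    using ds assms by (intro runs_weaken[OF runs_Seq]) (auto simp: fun_eq_iff)
qed

definition arith :: "(nat \<Rightarrow> nat \<Rightarrow> nat \<Rightarrow> bool) \<Rightarrow> nat \<Rightarrow> nat \<Rightarrow> com" where
  "arith g x y = copy y 4;; Push 3 (\<lambda>_. 1);; ripple g x 4;;
     Cond (\<lambda>\<tau>. \<tau> 3 = 2) (Push 2 (\<lambda>_. 2)) Skip;; Pop 3;; finish x"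

lemma runs_arith:
  fixes e :: int
  assumes g: "\<And>a b c. int (bitval (digit_of (odd (bitval a + bitval b + bitval c)))) + 2 * e * int (bitval (digit_of (g a b c)))
      = int (bitval a) + e * int (bitval b + bitval c)"
    and "x > 5" "y > 5" "x \<noteq> y" "\<sigma> x = binary a" "\<sigma> y = binary b" "scratch_empty \<sigma>"
    and "blen a \<le> n" "blen b \<le> n" "int a + e * int b \<ge> 0" "e = 1 \<or> e = -1"
  shows "runs (arith g x y) \<sigma> (50 * (n + 1)) (\<sigma>(x := binary (nat (int a + e * int b))))"
proof -
  let ?\<sigma>1 = "\<sigma>(4 := binary b)"
  let ?\<sigma>2 = "?\<sigma>1(3 := 1 # ?\<sigma>1 3)"
  have e: "\<sigma> 2 = []" "\<sigma> 3 = []" "\<sigma> 4 = []" "\<sigma> 5 = []" using assms by (auto simp: scratch_empty_def)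
  have 1: "runs (copy y 4) \<sigma> (12 * n + 2) ?\<sigma>1"
    using assms e by (intro runs_copy) auto
  have 2: "runs (Push 3 (\<lambda>_. 1)) ?\<sigma>1 2 ?\<sigma>2"
    by (intro runs_Push) auto
  have "\<exists>ds c'. runs (ripple g x 4) ?\<sigma>2 (7 * max (blen a) (blen b) + 1)
       (?\<sigma>2(x := [], 4 := [], 2 := rev ds @ ?\<sigma>2 2, 3 := [c'])) \<and> set ds \<subseteq> {1, 2} \<and> 
     length ds = max (blen a) (blen b) \<and> ((1::nat) \<in> {1, 2} \<longrightarrow> c' \<in> {1, 2}) \<and>
     int (bval ds) + e * 2 ^ length ds * int (bitval c') = int (bval (binary a)) + e * int (bval (binary b) + bitval 1)"
    using assms e set_binary by (intro runs_ripple[OF g]) auto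
  then obtain ds c' where r: "runs (ripple g x 4) ?\<sigma>2 (7 * max (blen a) (blen b) + 1)
       (?\<sigma>2(x := [], 4 := [], 2 := rev ds @ ?\<sigma>2 2, 3 := [c']))" "set ds \<subseteq> {1, 2}"
     "length ds = max (blen a) (blen b)" "c' \<in> {1, 2}"
     "int (bval ds) + e * 2 ^ length ds * int (bitval c') = int a + e * int b"
    by (auto simp: bitval_def)
  let ?\<sigma>3 = "?\<sigma>2(x := [], 4 := [], 2 := rev ds @ ?\<sigma>2 2, 3 := [c'])"
  have 3: "runs (ripple g x 4) ?\<sigma>2 (7 * n + 1) ?\<sigma>3"
    by (rule runs_weaken[OF r(1)]) (use assms in auto)
  define ds' where "ds' = (if c' = 2 then ds @ [2] else ds)"
  have ds': "set ds' \<subseteq> {1, 2}" "length ds' \<le> n + 1" using r(2,3) assms by (auto simp: ds'_def)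
  have v: "bval ds' = nat (int a + e * int b)"
  proof (cases "c' = 2")
    case False
    then show ?thesis using r(5) by (auto simp: ds'_def bitval_def)
  next
    case True
    then have "int (bval ds) + e * 2 ^ length ds = int a + e * int b"
      using r(5) by (auto simp: bitval_def)
    moreover have "int (bval ds) < 2 ^ length ds" using bval_less[OF r(2)] by simp
    \<comment> \<open>A final borrow would make the result \<open>bval ds - 2 ^ length ds\<close>,
      which is negative. So a remaining carry belongs to an addition and becomes its leading
      digit.\<close>
    ultimately have "e \<noteq> -1" using assms(10) by (intro notI, hypsubst) linarith
    then have "e = 1" using assms(11) by blast
    then have "int (bval ds) + 2 ^ length ds = int a + int b"
      using \<open>int (bval ds) + e * 2 ^ length ds = int a + e * int b\<close> by simp
    moreover have "int (bval ds') = int (bval ds) + 2 ^ length ds"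
      using True by (simp add: ds'_def bval_append)
    ultimately show ?thesis using \<open>e = 1\<close> by simp
  qed
  let ?\<sigma>4 = "?\<sigma>3(2 := rev ds')"
  let ?\<sigma>5 = "?\<sigma>4(3 := tl (?\<sigma>4 3))"
  have 4: "runs (Cond (\<lambda>\<tau>. \<tau> 3 = 2) (Push 2 (\<lambda>_. 2)) Skip) ?\<sigma>3 4 ?\<sigma>4"
  proof (cases "c' = 2")
    case True
    then show ?thesis
      by (intro runs_weaken[OF runs_CondT[OF _ runs_Push]]) (auto simp: tops_def ds'_def fun_eq_iff e)
  next
    case False
    then show ?thesis
      by (intro runs_weaken[OF runs_CondF[OF _ runs_Skip]]) (auto simp: tops_def ds'_def fun_eq_iff e)
  qed
  have 5: "runs (finish x) ?\<sigma>5 (8 * (n + 1) + 2) (?\<sigma>5(2 := [], x := binary (bval ds')))"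
    using ds' assms by (intro runs_finish) auto
  have 6: "runs (Pop 3) ?\<sigma>4 1 ?\<sigma>5" by (rule runs_Pop)
  from 1 2 3 4 5 6 have "runs (arith g x y) \<sigma>
      (12 * n + 2 + (2 + (7 * n + 1 + (4 + (1 + (8 * (n + 1) + 2))))))
      (?\<sigma>5(2 := [], x := binary (bval ds')))"
    unfolding arith_def by (intro runs_Seq)
  then show ?thesis
    by (rule runs_weaken) (use assms e in \<open>auto simp: v fun_eq_iff\<close>)
qed

definition add :: "nat \<Rightarrow> nat \<Rightarrow> com" where
  "add = arith carry"

definition sub :: "nat \<Rightarrow> nat \<Rightarrow> com" where
  "sub = arith borrow"

lemma carry_digits: "int (bitval (digit_of (odd (bitval a + bitval b + bitval c)))) + 2 * 1 * int (bitval (digit_of (carry a b c)))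
      = int (bitval a) + 1 * int (bitval b + bitval c)"
  by (auto simp: bitval_def digit_of_def carry_def)

lemma borrow_digits: "int (bitval (digit_of (odd (bitval a + bitval b + bitval c)))) + 2 * (- 1) * int (bitval (digit_of (borrow a b c)))
      = int (bitval a) + (- 1) * int (bitval b + bitval c)"
  by (auto simp: bitval_def digit_of_def borrow_def)

lemma runs_add:
  assumes "scratch_empty \<sigma>" "x > 5" "y > 5" "x \<noteq> y" "\<sigma> x = binary a" "\<sigma> y = binary b"
    "blen a \<le> n" "blen b \<le> n"
  shows "runs (add x y) \<sigma> (50 * (n + 1)) (\<sigma>(x := binary (a + b)))"
  using runs_arith[OF carry_digits assms(2-6,1,7,8)] unfolding add_def by (simp add: nat_int_add)

lemma runs_sub:
  assumes "scratch_empty \<sigma>" "x > 5" "y > 5" "x \<noteq> y" "\<sigma> x = binary a" "\<sigma> y = binary b"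
    "blen a \<le> n" "b \<le> a"
  shows "runs (sub x y) \<sigma> (50 * (n + 1)) (\<sigma>(x := binary (a - b)))"
proof -
  have "blen b \<le> n" using blen_mono[OF assms(8)] assms(7) by simp
  moreover have "nat (int a - int b) = a - b" by simp
  ultimately show ?thesis
    using runs_arith[OF borrow_digits assms(2-6,1,7)] assms(8) unfolding sub_def by simp
qed

text \<open>Copies of the numbers are subtracted and the difference is thrown away: the final borrow
  on stack 3 is the truth value of the comparison.\<close>

definition less :: "nat \<Rightarrow> nat \<Rightarrow> com" where
  "less x y = copy x 5;; copy y 4;; Push 3 (\<lambda>_. 1);; ripple borrow 5 4;; clear 2"

lemma runs_less:
  assumes "scratch_empty \<sigma>" "x > 5" "y > 5" "\<sigma> x = binary a" "\<sigma> y = binary b"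
    "blen a \<le> n" "blen b \<le> n"
  shows "runs (less x y) \<sigma> (40 * (n + 1)) (\<sigma>(3 := [digit_of (a < b)]))"
proof -
  let ?\<sigma>1 = "\<sigma>(5 := binary a)"
  let ?\<sigma>2 = "?\<sigma>1(4 := binary b)"
  let ?\<sigma>3 = "?\<sigma>2(3 := 1 # ?\<sigma>2 3)"
  have e: "\<sigma> 2 = []" "\<sigma> 3 = []" "\<sigma> 4 = []" "\<sigma> 5 = []" using assms by (auto simp: scratch_empty_def)
  have 1: "runs (copy x 5) \<sigma> (12 * n + 2) ?\<sigma>1" "runs (copy y 4) ?\<sigma>1 (12 * n + 2) ?\<sigma>2"
    using assms e by (intro runs_copy; auto)+
  have 2: "runs (Push 3 (\<lambda>_. 1)) ?\<sigma>2 2 ?\<sigma>3"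
    by (intro runs_Push) auto
  have "\<exists>ds c'. runs (ripple borrow 5 4) ?\<sigma>3 (7 * max (blen a) (blen b) + 1)
       (?\<sigma>3(5 := [], 4 := [], 2 := rev ds @ ?\<sigma>3 2, 3 := [c'])) \<and> set ds \<subseteq> {1, 2} \<and> 
     length ds = max (blen a) (blen b) \<and> ((1::nat) \<in> {1, 2} \<longrightarrow> c' \<in> {1, 2}) \<and>
     int (bval ds) + (-1) * 2 ^ length ds * int (bitval c') = int (bval (binary a)) + (-1) * int (bval (binary b) + bitval 1)"
    using assms e set_binary by (intro runs_ripple[OF borrow_digits]) auto
  then obtain ds c' where r: "runs (ripple borrow 5 4) ?\<sigma>3 (7 * max (blen a) (blen b) + 1)
       (?\<sigma>3(5 := [], 4 := [], 2 := rev ds @ ?\<sigma>3 2, 3 := [c']))" "set ds \<subseteq> {1, 2}"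
     "length ds = max (blen a) (blen b)" "c' \<in> {1, 2}"
     "int (bval ds) - 2 ^ length ds * int (bitval c') = int a - int b"
    by (auto simp: bitval_def)
  have "int (bval ds) < 2 ^ length ds" using bval_less[OF r(2)] by simp
  moreover have "c' = 2 \<Longrightarrow> int (bval ds) - 2 ^ length ds = int a - int b"
    "c' = 1 \<Longrightarrow> int (bval ds) = int a - int b" using r(5) by (simp_all add: bitval_def)
  ultimately have "c' = 2 \<Longrightarrow> a < b" "c' = 1 \<Longrightarrow> \<not> a < b" by linarith+
  then have c': "c' = digit_of (a < b)" using r(4) by (auto simp: digit_of_def)
  let ?\<sigma>4 = "?\<sigma>3(5 := [], 4 := [], 2 := rev ds @ ?\<sigma>3 2, 3 := [c'])"
  have 3: "runs (ripple borrow 5 4) ?\<sigma>3 (7 * n + 1) ?\<sigma>4"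
    by (rule runs_weaken[OF r(1)]) (use assms in auto)
  have 4: "runs (clear 2) ?\<sigma>4 (3 * n + 1) (?\<sigma>4(2 := []))"
    using r assms by (intro runs_clear[where ds = "rev ds"]) (auto simp: e)
  from 1 2 3 4 have "runs (less x y) \<sigma>
      (12 * n + 2 + (12 * n + 2 + (2 + (7 * n + 1 + (3 * n + 1))))) (?\<sigma>4(2 := []))"
    unfolding less_def by (intro runs_Seq)
  then show ?thesis
    by (rule runs_weaken) (use e in \<open>auto simp: c' fun_eq_iff\<close>)
qed

definition if_less :: "nat \<Rightarrow> nat \<Rightarrow> com \<Rightarrow> com \<Rightarrow> com" where
  "if_less x y c1 c2 = less x y;; Cond (\<lambda>\<tau>. \<tau> 3 = 2) (Pop 3;; c1) (Pop 3;; c2)"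

lemma runs_if_less:
  assumes "scratch_empty \<sigma>" "x > 5" "y > 5" "\<sigma> x = binary a" "\<sigma> y = binary b"
    "blen a \<le> n" "blen b \<le> n" "runs (if a < b then c1 else c2) \<sigma> t \<sigma>'"
  shows "runs (if_less x y c1 c2) \<sigma> (43 * (n + 1) + t) \<sigma>'"
proof -
  let ?\<sigma>1 = "\<sigma>(3 := [digit_of (a < b)])"
  have "runs (Pop 3) ?\<sigma>1 1 \<sigma>"
    using runs_Pop by (rule runs_weaken) (use assms in \<open>auto simp: fun_eq_iff scratch_empty_def\<close>)
  then have "runs (Cond (\<lambda>\<tau>. \<tau> 3 = 2) (Pop 3;; c1) (Pop 3;; c2)) ?\<sigma>1 (1 + t + 2) \<sigma>'"
  proof (cases "a < b")
    case True
    then show ?thesis using assms(8) \<open>runs (Pop 3) ?\<sigma>1 1 \<sigma>\<close>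
      by (intro runs_CondT runs_Seq) (auto simp: tops_def digit_of_def)
  next
    case False
    then show ?thesis using assms(8) \<open>runs (Pop 3) ?\<sigma>1 1 \<sigma>\<close>
      by (intro runs_weaken[OF runs_CondF[OF _ runs_Seq]]) (auto simp: tops_def digit_of_def)
  qed
  with runs_less[OF assms(1-7)] show ?thesis
    unfolding if_less_def by (intro runs_weaken[OF runs_Seq]) auto
qed

text \<open>\<open>While\<close> can only test top symbols. The comparison is therefore made before
  the loop and again at the end of each round, and its one-digit result is popped before the body,
  which needs empty scratch stacks.\<close>

definition while_less :: "nat \<Rightarrow> nat \<Rightarrow> com \<Rightarrow> com" where
  "while_less x y c = less x y;; While (\<lambda>\<tau>. \<tau> 3 = 2) (Pop 3;; c;; less x y);; Pop 3"

lemma runs_while_less_False: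
  assumes "scratch_empty \<sigma>" "x > 5" "y > 5" "\<sigma> x = binary a" "\<sigma> y = binary b"
    "blen a \<le> n" "blen b \<le> n" "\<not> a < b"
  shows "runs (while_less x y c) \<sigma> (43 * (n + 1)) \<sigma>"
proof -
  let ?\<sigma>1 = "\<sigma>(3 := [digit_of (a < b)])"
  have "runs (Pop 3) ?\<sigma>1 1 \<sigma>"
    using runs_Pop by (rule runs_weaken) (use assms in \<open>auto simp: fun_eq_iff scratch_empty_def\<close>)
  moreover have "runs (While (\<lambda>\<tau>. \<tau> 3 = 2) (Pop 3;; c;; less x y)) ?\<sigma>1 1 ?\<sigma>1"
    using assms(8) by (intro runs_WhileF) (auto simp: tops_def digit_of_def)
  ultimately show ?thesis using runs_less[OF assms(1-7)]
    unfolding while_less_def by (intro runs_weaken[OF runs_Seq[OF _ runs_Seq]]) auto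
qed

lemma runs_while_less_True:
  assumes "scratch_empty \<sigma>" "x > 5" "y > 5" "\<sigma> x = binary a" "\<sigma> y = binary b"
    "blen a \<le> n" "blen b \<le> n" "a < b"
    "runs c \<sigma> t1 \<sigma>1" "runs (while_less x y c) \<sigma>1 t2 \<sigma>2"
  shows "runs (while_less x y c) \<sigma> (43 * (n + 1) + t1 + t2) \<sigma>2"
proof -
  let ?\<sigma>1 = "\<sigma>(3 := [digit_of (a < b)])"
  have p: "runs (Pop 3) ?\<sigma>1 1 \<sigma>"
    using runs_Pop by (rule runs_weaken) (use assms in \<open>auto simp: fun_eq_iff scratch_empty_def\<close>)
  have t: "tops ?\<sigma>1 3 = 2" using assms(8) by (simp add: tops_def digit_of_def)
  \<comment> \<open>The comparison that opens the remaining run is the same as the one that closes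
    the current round. Inverting \<open>exec\<close> detaches it, so that it can be regrouped with
    the body.\<close>
  from assms(10) obtain t' where t': "t' \<le> t2" "exec (while_less x y c) \<sigma>1 t' \<sigma>2"
    by (auto simp: runs_def)
  from t'(2)[unfolded while_less_def] obtain u1 u2 u3 \<sigma>3 \<sigma>4 where
    u: "exec (less x y) \<sigma>1 u1 \<sigma>3" "exec (While (\<lambda>\<tau>. \<tau> 3 = 2) (Pop 3;; c;; less x y)) \<sigma>3 u2 \<sigma>4"
      "exec (Pop 3) \<sigma>4 u3 \<sigma>2" "t' = u1 + (u2 + u3)"
    by (auto elim!: exec.cases[of "_;; _"])
  have "runs (While (\<lambda>\<tau>. \<tau> 3 = 2) (Pop 3;; c;; less x y)) ?\<sigma>1 ((1 + (t1 + u1)) + u2 + 2) \<sigma>4"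
    using p assms(9) u t by (intro runs_WhileT runs_Seq) (auto simp: runs_def)
  moreover have "runs (Pop 3) \<sigma>4 u3 \<sigma>2" using u by (auto simp: runs_def)
  ultimately show ?thesis using runs_less[OF assms(1-7)] t' u
    unfolding while_less_def by (intro runs_weaken[OF runs_Seq[OF _ runs_Seq]]) auto
qed

definition double :: "nat \<Rightarrow> com" where
  "double x = Cond (\<lambda>\<tau>. \<tau> x = 0) Skip (Push x (\<lambda>_. 1))"

lemma runs_double:
  assumes "x \<noteq> 1" "\<sigma> x = binary a"
  shows "runs (double x) \<sigma> 3 (\<sigma>(x := binary (2 * a)))"
proof (cases "a = 0")
  case True
  then show ?thesis unfolding double_def using assms
    by (intro runs_weaken[OF runs_CondT[OF _ runs_Skip]]) (auto simp: tops_def)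
next
  case False
  have "hd (binary a) \<noteq> 0"
    using set_binary[of a] False by (cases "binary a") auto
  then show ?thesis unfolding double_def using assms False
    by (intro runs_weaken[OF runs_CondF[OF _ runs_Push]]) (auto simp: tops_def binary_double)
qed

lemma runs_half:
  assumes "\<sigma> x = binary a"
  shows "runs (Pop x) \<sigma> 1 (\<sigma>(x := binary (a div 2)))"
  using runs_Pop by (rule runs_weaken) (simp_all add: assms tl_binary)

section \<open>Division and the Euclidean algorithm\<close>

text \<open>The number of doublings, hence of rounds, in the division of \<open>x\<close> by
  \<open>y\<close>: essentially the length of the quotient. It is the unit in which the cost of
  Euclid's algorithm is counted.\<close>

definition shifts :: "nat \<Rightarrow> nat \<Rightarrow> nat" where
  "shifts x y = (LEAST s. x \<le> 2 ^ s * y)"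

lemma shifts_le: "x \<le> 2 ^ s * y \<Longrightarrow> shifts x y \<le> s"
  unfolding shifts_def by (rule Least_le)

lemma le_shifts:
  assumes "y \<ge> 1"
  shows "x \<le> 2 ^ shifts x y * y"
proof -
  have "x \<le> 2 ^ blen x * y"
    using less_power_blen[of x] assms by (metis less_imp_le le_trans mult.right_neutral mult_le_mono2)
  then show ?thesis unfolding shifts_def by (rule LeastI)
qed

lemma shifts_le_blen: "y \<ge> 1 \<Longrightarrow> shifts x y \<le> blen x"
  using less_power_blen[of x]
  by (intro shifts_le) (metis less_imp_le le_trans mult.right_neutral mult_le_mono2)

lemma shifts_double:
  assumes "y \<ge> 1" "y < x"
  shows "shifts x y = Suc (shifts x (2 * y))"
proof -
  have "\<not> x \<le> 2 ^ 0 * y" using assms by simp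
  then have "shifts x y = Suc (LEAST s. x \<le> 2 ^ Suc s * y)"
    unfolding shifts_def using le_shifts[OF assms(1), of x] by (intro Least_Suc)
  then show ?thesis by (simp add: shifts_def algebra_simps)
qed

lemma shifts_eq_0: "x \<le> y \<Longrightarrow> shifts x y = 0"
  using shifts_le[of x 0 y] by simp

lemma power_shifts_less: "shifts x y > 0 \<Longrightarrow> 2 ^ (shifts x y - 1) * y < x"
  unfolding shifts_def using not_less_Least[of "shifts x y - 1" "\<lambda>s. x \<le> 2 ^ s * y"]
  by (simp add: shifts_def not_le)

text \<open>
  The remainder is taken in the interval from 1 to y, so that it is positive for positive x;
  the quotient is \<open>(x - 1) div y\<close>.
\<close>

definition quot :: "nat \<Rightarrow> nat \<Rightarrow> nat" where
  "quot x y = (x - 1) div y"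

definition rem :: "nat \<Rightarrow> nat \<Rightarrow> nat" where
  "rem x y = x - quot x y * y"

lemma quot_mult_le: "quot x y * y \<le> x"
  unfolding quot_def by (meson diff_le_self div_times_less_eq_dividend le_trans)

lemma rem_add_quot: "rem x y + quot x y * y = x"
  using quot_mult_le[of x y] by (simp add: rem_def)

lemma rem_le: "rem x y \<le> x"
  by (simp add: rem_def)

lemma rem_le_divisor:
  assumes "y \<ge> 1"
  shows "rem x y \<le> y"
proof -
  have "x - 1 = quot x y * y + (x - 1) mod y" by (simp add: quot_def)
  moreover have "(x - 1) mod y < y" using assms by simp
  ultimately show ?thesis using rem_add_quot[of x y] by linarith
qed

lemma rem_pos: "x \<ge> 1 \<Longrightarrow> rem x y \<ge> 1"
proof -
  assume "x \<ge> 1"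
  have "quot x y * y \<le> x - 1" unfolding quot_def by (rule div_times_less_eq_dividend)
  then show ?thesis using rem_add_quot[of x y] \<open>x \<ge> 1\<close> by linarith
qed

lemma quot_rem_le: "x \<le> y \<Longrightarrow> quot x y = 0" "x \<le> y \<Longrightarrow> rem x y = x"
  by (cases x; simp add: quot_def rem_def)+

lemma quot_diff:
  assumes "y \<ge> 1" "k * y < x"
  shows "quot x y = quot (x - k * y) y + k" "rem x y = rem (x - k * y) y"
proof -
  have "x - 1 = (x - k * y - 1) + k * y" using assms by simp
  then show 1: "quot x y = quot (x - k * y) y + k"
    unfolding quot_def using assms by (metis add.commute div_mult_self1 not_one_le_zero)
  show "rem x y = rem (x - k * y) y"
    using assms by (simp add: rem_def 1 algebra_simps)
qed

text \<open>If \<open>y < x\<close>, the quotient is at least 1, so \<open>x\<close> exceeds the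
  remainder by at least \<open>y\<close>, and the remainder is at most \<open>y\<close>.\<close>

lemma rem_half:
  assumes "y < x" "y \<ge> 1"
  shows "2 * rem x y \<le> x"
proof -
  have "quot x y \<ge> 1"
    using assms div_le_mono[of y "x - 1" y] by (simp add: quot_def)
  then have "y \<le> quot x y * y" by simp
  then show ?thesis using rem_add_quot[of x y] rem_le_divisor[OF assms(2), of x] by linarith
qed

text \<open>Shift and subtract, carrying a second row along: whenever \<open>2 ^ s * b\<close>
  leaves \<open>a\<close>, the amount \<open>2 ^ s * B\<close> enters \<open>A\<close>. The quotient
  itself is never stored. This is the row operation of the extended Euclidean algorithm; with
  \<open>B = 1\<close> it yields quotients, and dividing \<open>x + 1\<close> by 1 it yields the
  product of \<open>x\<close> and \<open>B\<close>. Stacks 6 and 7 hold the shifted \<open>b\<close>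
  and \<open>B\<close>, stack 8 counts the shifts in unary.\<close>

definition divide :: "nat \<Rightarrow> nat \<Rightarrow> nat \<Rightarrow> nat \<Rightarrow> com" where
  "divide a A b B =
     copy b 6;; copy B 7;;
     while_less 6 a (double 6;; double 7;; Push 8 (\<lambda>_. 1));;
     While (\<lambda>\<tau>. \<tau> 8 \<noteq> 0) (Pop 8;; Pop 6;; Pop 7;; if_less 6 a (sub a 6;; add A 7) Skip);;
     clear 6;; clear 7"

lemma runs_divide_up:
  assumes "scratch_empty \<sigma>" "a > 8" "\<sigma> a = binary x" "\<sigma> 6 = binary c" "\<sigma> 7 = binary C"
    "c \<ge> 1" "blen x + 1 \<le> n" "blen c \<le> n"
  shows "runs (while_less 6 a (double 6;; double 7;; Push 8 (\<lambda>_. 1))) \<sigma> ((shifts x c + 1) * (43 * (n + 1) + 8))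
    (\<sigma>(6 := binary (2 ^ shifts x c * c), 7 := binary (2 ^ shifts x c * C), 8 := replicate (shifts x c) 1 @ \<sigma> 8))"
  using assms
proof (induction "x - c" arbitrary: \<sigma> c C rule: less_induct)
  case less
  show ?case
  proof (cases "c < x")
    case False
    then have "runs (while_less 6 a (double 6;; double 7;; Push 8 (\<lambda>_. 1))) \<sigma> (43 * (n + 1)) \<sigma>"
      using less.prems by (intro runs_while_less_False) auto
    then show ?thesis
      by (rule runs_weaken) (use False less.prems in \<open>auto simp: shifts_eq_0 fun_eq_iff\<close>)
  next
    case True
    let ?\<sigma>1 = "\<sigma>(6 := binary (2 * c))"
    let ?\<sigma>2 = "?\<sigma>1(7 := binary (2 * C))"
    let ?\<sigma>3 = "?\<sigma>2(8 := 1 # ?\<sigma>2 8)"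
    have "runs (double 6) \<sigma> 3 ?\<sigma>1" "runs (double 7) ?\<sigma>1 3 ?\<sigma>2" "runs (Push 8 (\<lambda>_. 1)) ?\<sigma>2 2 ?\<sigma>3"
      using less.prems by (intro runs_double runs_Push; simp)+
    then have body: "runs (double 6;; double 7;; Push 8 (\<lambda>_. 1)) \<sigma> (3 + (3 + 2)) ?\<sigma>3"
      by (intro runs_Seq)
    let ?s = "shifts x (2 * c)"
    have s: "shifts x c = Suc ?s" using True less.prems by (intro shifts_double) auto
    \<comment> \<open>Since \<open>c < x\<close>, the doubled divisor has at most one digit more
      than \<open>x\<close>; this is the extra 1 in \<open>blen x + 1 \<le> n\<close>.\<close>
    have "blen (2 * c) \<le> n" using blen_mono[of c x] blen_double[of c] True less.prems by linarith
    then have IH: "runs (while_less 6 a (double 6;; double 7;; Push 8 (\<lambda>_. 1))) ?\<sigma>3 ((?s + 1) * (43 * (n + 1) + 8))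
      (?\<sigma>3(6 := binary (2 ^ ?s * (2 * c)), 7 := binary (2 ^ ?s * (2 * C)), 8 := replicate ?s 1 @ ?\<sigma>3 8))"
      using True less.prems by (intro less.hyps) auto
    have "runs (while_less 6 a (double 6;; double 7;; Push 8 (\<lambda>_. 1))) \<sigma>
        (43 * (n + 1) + (3 + (3 + 2)) + (?s + 1) * (43 * (n + 1) + 8))
      (?\<sigma>3(6 := binary (2 ^ ?s * (2 * c)), 7 := binary (2 ^ ?s * (2 * C)), 8 := replicate ?s 1 @ ?\<sigma>3 8))"
      using True less.prems by (intro runs_while_less_True[OF _ _ _ _ _ _ _ _ body IH]) auto
    then show ?thesis
      by (rule runs_weaken) (auto simp: s fun_eq_iff algebra_simps replicate_app_Cons_same)
  qed
qed

text \<open>Each round preserves the remainder and the value \<open>X + quot x y * Y\<close>, and it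
  restores \<open>x \<le> 2 ^ s * y\<close> for the next smaller \<open>s\<close>. At
  \<open>s = 0\<close> this says that \<open>x\<close> is its own remainder. The subtraction is made
  only under a strict inequality, so a positive \<open>x\<close> stays positive.\<close>

lemma runs_divide_down:
  assumes "scratch_empty \<sigma>" "a \<noteq> A" "a > 8" "A > 8"
    "\<sigma> a = binary x" "\<sigma> A = binary X" "\<sigma> 6 = binary (2 ^ s * y)" "\<sigma> 7 = binary (2 ^ s * Y)"
    "\<sigma> 8 = replicate s 1" "y \<ge> 1" "x \<le> 2 ^ s * y"
    "blen x \<le> n" "blen (2 ^ s * y) \<le> n" "blen (X + quot x y * Y) \<le> n"
  shows "runs (While (\<lambda>\<tau>. \<tau> 8 \<noteq> 0) (Pop 8;; Pop 6;; Pop 7;; if_less 6 a (sub a 6;; add A 7) Skip)) \<sigma>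
    (s * (150 * (n + 1)) + 1)
    (\<sigma>(a := binary (rem x y), A := binary (X + quot x y * Y), 6 := binary y, 7 := binary Y, 8 := []))"
  using assms
proof (induction s arbitrary: \<sigma> x X)
  case 0
  then have "runs (While (\<lambda>\<tau>. \<tau> 8 \<noteq> 0) (Pop 8;; Pop 6;; Pop 7;; if_less 6 a (sub a 6;; add A 7) Skip)) \<sigma> 1 \<sigma>"
    by (intro runs_WhileF) (auto simp: tops_def)
  then show ?case
    by (rule runs_weaken) (use 0 in \<open>auto simp: quot_rem_le fun_eq_iff\<close>)
next
  case (Suc s)
  let ?\<sigma>1 = "\<sigma>(8 := replicate s 1)"
  let ?\<sigma>2 = "?\<sigma>1(6 := binary (2 ^ s * y))"
  let ?\<sigma>3 = "?\<sigma>2(7 := binary (2 ^ s * Y))"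
  have 1: "runs (Pop 8) \<sigma> 1 ?\<sigma>1"
    using runs_Pop by (rule runs_weaken) (use Suc.prems in auto)
  have 2: "runs (Pop 6) ?\<sigma>1 1 ?\<sigma>2"
    by (rule runs_weaken[OF runs_half[of _ _ "2 ^ Suc s * y"]]) (use Suc.prems in auto)
  have 3: "runs (Pop 7) ?\<sigma>2 1 ?\<sigma>3"
    by (rule runs_weaken[OF runs_half[of _ _ "2 ^ Suc s * Y"]]) (use Suc.prems in auto)
  have len: "blen (2 ^ s * y) \<le> n" using Suc.prems(13) blen_mono[of "2 ^ s * y" "2 ^ Suc s * y"] by simp
  define x' where "x' = (if 2 ^ s * y < x then x - 2 ^ s * y else x)"
  define X' where "X' = (if 2 ^ s * y < x then X + 2 ^ s * Y else X)"
  let ?\<sigma>4 = "?\<sigma>3(a := binary x', A := binary X')"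
  have x': "x' \<le> 2 ^ s * y" "rem x' y = rem x y" "X' + quot x' y * Y = X + quot x y * Y" "x' \<le> x"
    using Suc.prems quot_diff[of y "2 ^ s" x] by (auto simp: x'_def X'_def algebra_simps)
  have "runs (if 2 ^ s * y < x then (sub a 6;; add A 7) else Skip) ?\<sigma>3 (50 * (n + 1) + 50 * (n + 1)) ?\<sigma>4"
  proof (cases "2 ^ s * y < x")
    case True
    have "2 ^ s * Y \<le> X + quot x y * Y" "X \<le> X + quot x y * Y"
      using x'(3) True by (auto simp: X'_def)
    then have l: "blen (2 ^ s * Y) \<le> n" "blen X \<le> n" using Suc.prems(14) blen_mono by (meson le_trans)+
    let ?\<sigma>5 = "?\<sigma>3(a := binary (x - 2 ^ s * y))"
    have "runs (sub a 6) ?\<sigma>3 (50 * (n + 1)) ?\<sigma>5"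
      using True Suc.prems by (intro runs_sub) auto
    moreover have "runs (add A 7) ?\<sigma>5 (50 * (n + 1)) (?\<sigma>5(A := binary (X + 2 ^ s * Y)))"
      using Suc.prems l by (intro runs_add) auto
    ultimately have "runs (sub a 6;; add A 7) ?\<sigma>3 (50 * (n + 1) + 50 * (n + 1)) (?\<sigma>5(A := binary (X + 2 ^ s * Y)))"
      by (rule runs_Seq)
    then show ?thesis using True by (simp add: x'_def X'_def)
  next
    case False
    then have "runs (if 2 ^ s * y < x then (sub a 6;; add A 7) else Skip) ?\<sigma>3 0 ?\<sigma>3"
      using runs_Skip by simp
    then show ?thesis
      by (rule runs_weaken) (use False Suc.prems in \<open>auto simp: x'_def X'_def fun_eq_iff\<close>)
  qed
  then have "runs (if_less 6 a (sub a 6;; add A 7) Skip) ?\<sigma>3 (43 * (n + 1) + (50 * (n + 1) + 50 * (n + 1))) ?\<sigma>4"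
    using Suc.prems len by (intro runs_if_less) auto
  with 1 2 3 have body: "runs (Pop 8;; Pop 6;; Pop 7;; if_less 6 a (sub a 6;; add A 7) Skip) \<sigma>
      (1 + (1 + (1 + (43 * (n + 1) + (50 * (n + 1) + 50 * (n + 1)))))) ?\<sigma>4"
    by (intro runs_Seq)
  have sc: "scratch_empty ?\<sigma>4" using Suc.prems(1,3,4) by simp
  have "blen x' \<le> n" using blen_mono[OF x'(4)] Suc.prems by simp
  then have "runs (While (\<lambda>\<tau>. \<tau> 8 \<noteq> 0) (Pop 8;; Pop 6;; Pop 7;; if_less 6 a (sub a 6;; add A 7) Skip)) ?\<sigma>4
    (s * (150 * (n + 1)) + 1)
    (?\<sigma>4(a := binary (rem x' y), A := binary (X' + quot x' y * Y), 6 := binary y, 7 := binary Y, 8 := []))"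
    using Suc.prems len x' by (intro Suc.IH[OF sc]) (auto simp: fun_upd_def)
  from runs_WhileT[OF _ body this] Suc.prems
  show ?case
    by (elim runs_weaken[OF meta_mp]) (auto simp: x' tops_def fun_eq_iff)
qed

text \<open>The bound is the number of shifts times the number of digits. Replacing the shifts by
  the digits of \<open>x\<close> here would make Euclid's algorithm cubic.\<close>

lemma runs_divide:
  assumes "scratch_empty \<sigma>" "\<sigma> 6 = []" "\<sigma> 7 = []" "\<sigma> 8 = []"
    "distinct [a, A, b, B]" "a > 8" "A > 8" "b > 8" "B > 8"
    "\<sigma> a = binary x" "\<sigma> A = binary X" "\<sigma> b = binary y" "\<sigma> B = binary Y"
    "y \<ge> 1" "blen x + 1 \<le> n" "blen y \<le> n" "blen Y \<le> n" "blen (X + quot x y * Y) \<le> n"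
  shows "runs (divide a A b B) \<sigma> ((shifts x y + 1) * (250 * (n + 1)))
    (\<sigma>(a := binary (rem x y), A := binary (X + quot x y * Y)))"
proof -
  let ?s = "shifts x y"
  let ?\<sigma>1 = "\<sigma>(6 := binary y)"
  let ?\<sigma>2 = "?\<sigma>1(7 := binary Y)"
  let ?\<sigma>3 = "?\<sigma>2(6 := binary (2 ^ ?s * y), 7 := binary (2 ^ ?s * Y), 8 := replicate ?s 1 @ ?\<sigma>2 8)"
  let ?\<sigma>4 = "?\<sigma>3(a := binary (rem x y), A := binary (X + quot x y * Y), 6 := binary y, 7 := binary Y, 8 := [])"
  let ?\<sigma>5 = "?\<sigma>4(6 := [])"
  have s2: "\<sigma> 2 = []" using assms(1) by (simp add: scratch_empty_def)
  have 1: "runs (copy b 6) \<sigma> (12 * n + 2) ?\<sigma>1"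
    using assms s2 by (intro runs_copy) auto
  have 2: "runs (copy B 7) ?\<sigma>1 (12 * n + 2) ?\<sigma>2"
    using assms s2 by (intro runs_copy) auto
  have 3: "runs (while_less 6 a (double 6;; double 7;; Push 8 (\<lambda>_. 1))) ?\<sigma>2 ((?s + 1) * (43 * (n + 1) + 8)) ?\<sigma>3"
    using assms by (intro runs_divide_up) auto
  \<comment> \<open>By minimality of \<open>shifts\<close>, half of the fully shifted divisor is
    still below \<open>x\<close>.\<close>
  have "blen (2 ^ ?s * y) \<le> n"
  proof (cases "?s = 0")
    case False
    then have s: "2 ^ ?s * y = 2 * (2 ^ (?s - 1) * y)" by (cases ?s) auto
    have "blen (2 ^ (?s - 1) * y) \<le> blen x"
      using power_shifts_less[of x y] False by (intro blen_mono) auto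
    then show ?thesis using blen_double[of "2 ^ (?s - 1) * y"] assms(15) by (subst s) linarith
  qed (use assms in auto)
  then have 4: "runs (While (\<lambda>\<tau>. \<tau> 8 \<noteq> 0) (Pop 8;; Pop 6;; Pop 7;; if_less 6 a (sub a 6;; add A 7) Skip)) ?\<sigma>3
      (?s * (150 * (n + 1)) + 1) ?\<sigma>4"
    using assms le_shifts[of y x] by (intro runs_divide_down) auto
  have 5: "runs (clear 6) ?\<sigma>4 (3 * n + 1) ?\<sigma>5"
    using assms by (intro runs_clear_number[where k = y]) auto
  have 6: "runs (clear 7) ?\<sigma>5 (3 * n + 1) (?\<sigma>5(7 := []))"
    using assms by (intro runs_clear_number[where k = Y]) auto
  from 1 2 3 4 5 6 have "runs (divide a A b B) \<sigma>
      (12 * n + 2 + (12 * n + 2 + ((?s + 1) * (43 * (n + 1) + 8) + (?s * (150 * (n + 1)) + 1 + (3 * n + 1 + (3 * n + 1))))))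
      (?\<sigma>5(7 := []))"
    unfolding divide_def by (intro runs_Seq)
  then show ?thesis
    by (rule runs_weaken) (use assms in \<open>auto simp: fun_eq_iff algebra_simps\<close>)
qed

text \<open>With \<open>s + 1\<close> shifts,
  \<open>2 ^ s * rem x y \<le> 2 ^ s * y \<le> x\<close>, which misses one factor 2. Multiplying by
  \<open>2 * rem x y \<le> x\<close> supplies it; this is why squares occur.\<close>

lemma rem_shifts_bound:
  assumes "y \<ge> 1"
  shows "2 ^ shifts x y * (rem x y)\<^sup>2 \<le> x\<^sup>2"
proof (cases "shifts x y")
  case 0
  then show ?thesis using rem_le[of x y] by (simp add: power_mono)
next
  case (Suc s)
  have "2 ^ s * rem x y \<le> 2 ^ s * y" using rem_le_divisor[OF assms] by simp
  also have "\<dots> \<le> x" using power_shifts_less[of x y] Suc by simp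
  finally have 1: "2 ^ s * rem x y \<le> x" .
  have "y < x" using shifts_eq_0[of x y] Suc by (cases "y < x") auto
  then have "2 * rem x y \<le> x" using assms by (rule rem_half)
  with 1 have "(2 ^ s * rem x y) * (2 * rem x y) \<le> x * x" by (rule mult_le_mono)
  then show ?thesis by (simp add: Suc power2_eq_square algebra_simps)
qed

lemma coprime_rem:
  assumes "coprime x y"
  shows "coprime (rem x y) y"
proof -
  have "gcd (rem x y + quot x y * y) y = gcd (rem x y) y"
    by (metis add.commute gcd_add_mult gcd.commute)
  then show ?thesis using assms by (simp add: rem_add_quot coprime_iff_gcd_eq_1)
qed

text \<open>Stack \<open>w\<close> holds the constant 1 for the comparison. Remainders of positive
  numbers are positive, so the loop stops with exactly 1 on \<open>x\<close>, and then
  \<open>A\<close> holds the wanted cofactor.\<close>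

definition euclid :: "nat \<Rightarrow> nat \<Rightarrow> nat \<Rightarrow> nat \<Rightarrow> nat \<Rightarrow> com" where
  "euclid w x A y B = while_less w x (divide x A y B;; divide y B x A)"

text \<open>
  The cofactors \<open>a'\<close>, \<open>b'\<close> represent the numbers \<open>a\<close>, \<open>b\<close> with opposite signs, so only additions
  occur, and \<open>a * b' + b * a'\<close> is invariant, which bounds the cofactors. A round with \<open>s\<close> and \<open>t\<close>
  shifts divides \<open>(a * b) ^ 5\<close> by at least \<open>2 ^ (s + t + 3)\<close>; hence the total number of
  arithmetic operations is linear in the number of digits.
\<close>

lemma runs_euclid:
  assumes "scratch_empty \<sigma>" "\<sigma> 6 = []" "\<sigma> 7 = []" "\<sigma> 8 = []"
    "distinct [w, x, A, y, B]" "w > 8" "x > 8" "A > 8" "y > 8" "B > 8" "\<sigma> w = binary 1"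
    "\<sigma> x = binary a" "\<sigma> A = binary a'" "\<sigma> y = binary b" "\<sigma> B = binary b'"
    "a \<ge> 1" "b \<ge> 1" "coprime a b" "blen a + 1 \<le> n" "blen b + 1 \<le> n" "blen (a * b' + b * a') \<le> n"
  shows "\<exists>U c d d'. runs (euclid w x A y B) \<sigma> (250 * (n + 1) * (U + 1))
      (\<sigma>(x := binary 1, A := binary c, y := binary d, B := binary d')) \<and>
    2 ^ U \<le> (a * b) ^ 5 \<and> c \<le> a * b' + b * a' \<and> d' \<le> a * b' + b * a' \<and> d \<le> b \<and>
    (\<forall>k u. [int a' = int a * u] (mod k) \<longrightarrow> [int b' = - (int b * u)] (mod k) \<longrightarrow> [int c = u] (mod k))"
  using assms
proof (induction "a * b" arbitrary: \<sigma> a a' b b' rule: less_induct)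
  case less
  show ?case
  proof (cases "1 < a")
    case False
    then have a: "a = 1" using less.prems by simp
    have "runs (euclid w x A y B) \<sigma> (43 * (n + 1)) \<sigma>"
      unfolding euclid_def using less.prems a by (intro runs_while_less_False[where a = 1 and b = a]) auto
    then have r: "runs (euclid w x A y B) \<sigma> (250 * (n + 1) * (0 + 1))
      (\<sigma>(x := binary 1, A := binary a', y := binary b, B := binary b'))"
      by (rule runs_weaken) (use less.prems a in \<open>auto simp: fun_eq_iff\<close>)
    have "2 ^ 0 \<le> (a * b) ^ 5" "b' \<le> a * b' + b * a'"
      using a less.prems(17) by simp_all
    moreover have "a' \<le> a * b' + b * a'"
      using less.prems(17) by (simp add: trans_le_add2)
    moreover have "[int a' = u] (mod k)" if "[int a' = int a * u] (mod k)" for k u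
      using that a by simp
    ultimately show ?thesis using r by blast
  next
    case True
    let ?N = "a * b' + b * a'"
    define q a1 a1' where "q = quot a b" "a1 = rem a b" "a1' = a' + q * b'"
    define r b1 b1' where "r = quot b a1" "b1 = rem b a1" "b1' = b' + r * a1'"
    note defs = q_a1_a1'_def r_b1_b1'_def
    have a: "a = a1 + q * b" and b: "b = b1 + r * a1" using rem_add_quot by (metis defs)+
    have a1: "a1 \<ge> 1" "a1 \<le> b" "a1 \<le> a"
      using less.prems rem_pos[of a b] rem_le_divisor[of b a] rem_le[of a b] by (auto simp: defs)
    have b1: "b1 \<ge> 1" "b1 \<le> b" using less.prems rem_pos[of b a1] rem_le[of b a1] by (auto simp: defs)
    have N1: "a1 * b' + b * a1' = ?N" unfolding a defs(3) by (simp add: algebra_simps)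
    have "a1 * b1' + b1 * a1' = a1 * b' + b * a1'" unfolding defs(6) b by (simp add: algebra_simps)
    then have N2: "a1 * b1' + b1 * a1' = ?N" using N1 by simp
    have "b' \<le> a * b'" "a1' \<le> b * a1'" "b1' \<le> a1 * b1'" using less.prems a1 by simp_all
    then have leN: "b' \<le> ?N" "a1' \<le> ?N" "b1' \<le> ?N" using N1 N2 by linarith+
    have lenN: "blen k \<le> n" if "k \<le> ?N" for k using blen_mono[OF that] less.prems by linarith
    have lena1: "blen a1 \<le> n" using blen_mono[OF a1(3)] less.prems by linarith
    have co1: "coprime a1 b" using less.prems coprime_rem by (simp add: defs)
    have co: "coprime a1 b1" using co1 coprime_rem[of b a1] by (simp add: defs coprime_commute)
    \<comment> \<open>One of the two divisions in a round is effective: the first if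
      \<open>b < a\<close>; otherwise it does nothing, coprimality and \<open>1 < a\<close> exclude
      \<open>a = b\<close>, and the second one halves \<open>b\<close>.\<close>
    have half: "2 * (a1 * b1) \<le> a * b"
    proof (cases "b < a")
      case True
      then have "2 * a1 \<le> a" using rem_half less.prems by (simp add: defs)
      then have "(2 * a1) * b1 \<le> a * b" using b1(2) by (rule mult_le_mono)
      then show ?thesis by (simp add: mult.assoc)
    next
      case False
      then have "a1 = a" by (simp add: defs quot_rem_le)
      moreover have "a \<noteq> b" using \<open>1 < a\<close> less.prems by auto
      ultimately have "2 * b1 \<le> b" using rem_half[of a1 b] a1 False by (simp add: defs)
      then have "a1 * (2 * b1) \<le> a * b" using a1(3) by (intro mult_le_mono)
      then show ?thesis by (simp add: mult.left_commute)
    qed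
    have smaller: "a1 * b1 < a * b" using half mult_le_mono[OF a1(1) b1(1)] by linarith
    let ?s = "shifts a b" and ?t = "shifts b a1"
    let ?\<sigma>1 = "\<sigma>(x := binary a1, A := binary a1')"
    let ?\<sigma>2 = "?\<sigma>1(y := binary b1, B := binary b1')"
    have "runs (divide x A y B) \<sigma> ((?s + 1) * (250 * (n + 1))) ?\<sigma>1"
      unfolding defs(2,3) unfolding defs(1) using less.prems lenN leN
      by (intro runs_divide) (auto simp: defs)
    moreover have "runs (divide y B x A) ?\<sigma>1 ((?t + 1) * (250 * (n + 1))) ?\<sigma>2"
      unfolding defs(5,6) unfolding defs(4) using less.prems lenN leN a1 lena1
      by (intro runs_divide) (auto simp: defs(4-6))
    ultimately have body: "runs (divide x A y B;; divide y B x A) \<sigma>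
        ((?s + 1) * (250 * (n + 1)) + (?t + 1) * (250 * (n + 1))) ?\<sigma>2"
      by (rule runs_Seq)
    have "\<exists>U c d d'. runs (euclid w x A y B) ?\<sigma>2 (250 * (n + 1) * (U + 1))
        (?\<sigma>2(x := binary 1, A := binary c, y := binary d, B := binary d')) \<and>
      2 ^ U \<le> (a1 * b1) ^ 5 \<and> c \<le> a1 * b1' + b1 * a1' \<and> d' \<le> a1 * b1' + b1 * a1' \<and> d \<le> b1 \<and>
      (\<forall>k u. [int a1' = int a1 * u] (mod k) \<longrightarrow> [int b1' = - (int b1 * u)] (mod k) \<longrightarrow> [int c = u] (mod k))"
      using less.prems a1 b1 co smaller lenN N2 blen_mono[OF a1(3)] blen_mono[OF b1(2)]
      by (intro less.hyps) auto
    then obtain U c d d' where IH: "runs (euclid w x A y B) ?\<sigma>2 (250 * (n + 1) * (U + 1))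
        (?\<sigma>2(x := binary 1, A := binary c, y := binary d, B := binary d'))"
      "2 ^ U \<le> (a1 * b1) ^ 5" "c \<le> ?N" "d' \<le> ?N" "d \<le> b1"
      "\<And>k u. [int a1' = int a1 * u] (mod k) \<Longrightarrow> [int b1' = - (int b1 * u)] (mod k) \<Longrightarrow> [int c = u] (mod k)"
      unfolding N2 by auto
    have "runs (euclid w x A y B) \<sigma>
        (43 * (n + 1) + ((?s + 1) * (250 * (n + 1)) + (?t + 1) * (250 * (n + 1))) + 250 * (n + 1) * (U + 1))
        (?\<sigma>2(x := binary 1, A := binary c, y := binary d, B := binary d'))"
      unfolding euclid_def using less.prems True
      by (intro runs_while_less_True[where a = 1 and b = a, OF _ _ _ _ _ _ _ _ body IH(1)[unfolded euclid_def]]) auto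
    \<comment> \<open>The 3 pays for the two divisions beyond their shifts and for the comparison of
      the loop test.\<close>
    then have "runs (euclid w x A y B) \<sigma> (250 * (n + 1) * ((U + ?s + ?t + 3) + 1))
        (\<sigma>(x := binary 1, A := binary c, y := binary d, B := binary d'))"
      by (rule runs_weaken) (use less.prems in \<open>auto simp: fun_eq_iff algebra_simps\<close>)
    moreover have "2 ^ (U + ?s + ?t + 3) \<le> (a * b) ^ 5"
    proof -
      \<comment> \<open>The exponent 5 is 2 + 3: the squares pay for the shifts, and the cube of the
        halved product pays for the constant 3.\<close>
      have "2 ^ ?s * a1\<^sup>2 \<le> a\<^sup>2" "2 ^ ?t * b1\<^sup>2 \<le> b\<^sup>2"
        using rem_shifts_bound less.prems a1 by (simp_all add: defs)
      then have "(2 ^ ?s * a1\<^sup>2) * (2 ^ ?t * b1\<^sup>2) \<le> a\<^sup>2 * b\<^sup>2" by (rule mult_le_mono)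
      moreover have "(2 * (a1 * b1)) ^ 3 \<le> (a * b) ^ 3" using half by (intro power_mono) auto
      ultimately have "(2 ^ ?s * a1\<^sup>2) * (2 ^ ?t * b1\<^sup>2) * (2 * (a1 * b1)) ^ 3 \<le> a\<^sup>2 * b\<^sup>2 * (a * b) ^ 3"
        by (rule mult_le_mono)
      also have "a\<^sup>2 * b\<^sup>2 * (a * b) ^ 3 = (a * b) ^ 5"
        by (simp add: power_mult_distrib[symmetric] power_add[symmetric])
      also have "(2 ^ ?s * a1\<^sup>2) * (2 ^ ?t * b1\<^sup>2) * (2 * (a1 * b1)) ^ 3 = 2 ^ (?s + ?t + 3) * (a1 * b1) ^ 5"
        by (simp add: power_mult_distrib power_add algebra_simps eval_nat_numeral)
      finally have "2 ^ (?s + ?t + 3) * (a1 * b1) ^ 5 \<le> (a * b) ^ 5" .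
      moreover have "2 ^ (?s + ?t + 3) * 2 ^ U \<le> (2::nat) ^ (?s + ?t + 3) * (a1 * b1) ^ 5"
        using IH(2) by (intro mult_le_mono2)
      ultimately have "2 ^ (?s + ?t + 3) * 2 ^ U \<le> (a * b) ^ 5" by (rule order_trans[rotated])
      then show ?thesis by (simp add: power_add mult_ac)
    qed
    \<comment> \<open>Opposite signs on the two rows turn the subtraction of \<open>q\<close> times
      the other row into an addition on the cofactors. At the end the first row represents 1, so its
      cofactor is \<open>u\<close>.\<close>
    moreover have "[int c = u] (mod k)"
      if "[int a' = int a * u] (mod k)" "[int b' = - (int b * u)] (mod k)" for k u
    proof (rule IH(6))
      have "[int a1' = int a * u + int q * - (int b * u)] (mod k)"
        unfolding defs(3) of_nat_add of_nat_mult using that by (intro cong_add cong_mult cong_refl)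
      also have "int a * u + int q * - (int b * u) = int a1 * u" unfolding a by (simp add: algebra_simps)
      finally show a1u: "[int a1' = int a1 * u] (mod k)" .
      have "[int b1' = - (int b * u) + int r * (int a1 * u)] (mod k)"
        unfolding defs(6) of_nat_add of_nat_mult using that a1u by (intro cong_add cong_mult cong_refl)
      also have "- (int b * u) + int r * (int a1 * u) = - (int b1 * u)" by (subst b) (simp add: algebra_simps)
      finally show "[int b1' = - (int b1 * u)] (mod k)" .
    qed
    moreover have "d \<le> b" using IH(5) b1 by simp
    ultimately show ?thesis using IH(3,4) by blast
  qed
qed

section \<open>The listing program\<close>

text \<open>
  Stack usage: 0 input, 1 output, 2 to 8 scratch space, 9 the constant 1, 10 the product \<open>M\<close>,
  11 the current modulus \<open>m\<close>, 13 the cofactor \<open>M div m\<close>, 14 the current residue, 15 its lift to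
  a residue modulo \<open>M\<close>, 20 the blocks, 21 the current list, 22 its backup, 23 the next list.
  The remaining stacks 12, 16 to 19, 24 and 25 hold temporary numbers.

  Lists of numbers on stacks have the digits in the opposite order compared to the input, so that
  moving digits to an empty stack yields a number with the least significant bit on top.
\<close>

definition renc :: "nat \<Rightarrow> nat list" where
  "renc x = rev (binary x) @ [3]"

definition rlist :: "nat list \<Rightarrow> nat list" where
  "rlist xs = concat (map renc xs)"

lemma rlist_simps [simp]: "rlist [] = []" "rlist (x # xs) = renc x @ rlist xs"
  "rlist (xs @ ys) = rlist xs @ rlist ys"
  by (simp_all add: rlist_def)

lemma set_renc: "set (renc x) \<subseteq> {1..4}"
  using set_binary[of x] by (auto simp: renc_def)

lemma set_rlist: "set (rlist xs) \<subseteq> {1..4}"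
  using set_renc by (induction xs) auto

lemma length_rlist:
  assumes "\<And>x. x \<in> set xs \<Longrightarrow> blen x \<le> n"
  shows "length (rlist xs) \<le> length xs * (n + 1)"
  using assms
proof (induction xs)
  case (Cons x xs)
  then have "length (rlist xs) \<le> length xs * (n + 1)" "blen x \<le> n" by auto
  then show ?case by (simp add: renc_def)
qed simp

text \<open>The states are given by a function \<open>S\<close> of the round number, so a loop
  invariant becomes an equation between stores.\<close>

lemma runs_While_iter:
  assumes "\<And>i. i < k \<Longrightarrow> b (tops (S i))" "\<And>i. i < k \<Longrightarrow> runs c (S i) (t i) (S (Suc i))"
    "\<not> b (tops (S k))"
  shows "runs (While b c) (S 0) ((\<Sum>i<k. t i + 2) + 1) (S k)"
  using assms
proof (induction k arbitrary: S t)
  case 0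
  then show ?case using runs_WhileF by simp
next
  case (Suc k)
  have "runs (While b c) (S (Suc 0)) ((\<Sum>i<k. t (Suc i) + 2) + 1) (S (Suc k))"
    using Suc.prems by (intro Suc.IH[of "\<lambda>i. S (Suc i)"]) auto
  then have "runs (While b c) (S 0) (t 0 + ((\<Sum>i<k. t (Suc i) + 2) + 1) + 2) (S (Suc k))"
    using Suc.prems by (intro runs_WhileT) auto
  then show ?case
    by (rule runs_weaken) (simp_all add: sum.lessThan_Suc_shift del: sum.lessThan_Suc)
qed

definition move_all :: "nat \<Rightarrow> nat \<Rightarrow> com" where
  "move_all a b = transfer (\<lambda>s. s \<noteq> 0) a [b]"

lemma runs_move_all:
  assumes "a \<noteq> 1" "a \<noteq> b" "set (\<sigma> a) \<subseteq> {1..4}" "length (\<sigma> a) \<le> n"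
  shows "runs (move_all a b) \<sigma> (5 * n + 1) (\<sigma>(a := [], b := rev (\<sigma> a) @ \<sigma> b))"
  unfolding move_all_def
  by (rule runs_weaken, rule runs_transfer[where ds = "\<sigma> a" and rest = "[]"])
    (use assms in \<open>auto simp: fun_eq_iff\<close>)

definition clear_all :: "nat \<Rightarrow> com" where
  "clear_all a = transfer (\<lambda>s. s \<noteq> 0) a []"

lemma runs_clear_all:
  assumes "a \<noteq> 1" "set (\<sigma> a) \<subseteq> {1..4}" "length (\<sigma> a) \<le> n"
  shows "runs (clear_all a) \<sigma> (3 * n + 1) (\<sigma>(a := []))"
  unfolding clear_all_def
  by (rule runs_weaken, rule runs_transfer[where ds = "\<sigma> a" and rest = "[]"])
    (use assms in \<open>auto simp: fun_eq_iff\<close>)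

definition pop_number :: "nat \<Rightarrow> nat \<Rightarrow> com" where
  "pop_number s r = move s r;; Pop s"

lemma runs_pop_number:
  assumes "s \<noteq> 1" "s \<noteq> r" "\<sigma> s = renc x @ rest" "\<sigma> r = []" "blen x \<le> n"
  shows "runs (pop_number s r) \<sigma> (5 * n + 2) (\<sigma>(s := rest, r := binary x))"
proof -
  let ?\<sigma>1 = "\<sigma>(s := 3 # rest, r := rev (rev (binary x)) @ \<sigma> r)"
  have "runs (move s r) \<sigma> (5 * n + 1) ?\<sigma>1"
    using assms set_binary[of x] by (intro runs_move[where ds = "rev (binary x)"]) (auto simp: renc_def)
  moreover have "runs (Pop s) ?\<sigma>1 1 (?\<sigma>1(s := tl (?\<sigma>1 s)))" by (rule runs_Pop)
  ultimately show ?thesis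
    unfolding pop_number_def
    by (intro runs_weaken[OF runs_Seq]) (use assms in \<open>auto simp: fun_eq_iff\<close>)
qed

definition push_number :: "nat \<Rightarrow> nat \<Rightarrow> com" where
  "push_number r s = Push s (\<lambda>_. 3);; move r s"

lemma runs_push_number:
  assumes "r \<noteq> 1" "s \<noteq> r" "\<sigma> r = binary x" "blen x \<le> n"
  shows "runs (push_number r s) \<sigma> (5 * n + 3) (\<sigma>(r := [], s := renc x @ \<sigma> s))"
proof -
  let ?\<sigma>1 = "\<sigma>(s := 3 # \<sigma> s)"
  have "runs (Push s (\<lambda>_. 3)) \<sigma> 2 ?\<sigma>1" by (intro runs_Push) auto
  moreover have "runs (move r s) ?\<sigma>1 (5 * n + 1) (?\<sigma>1(r := [], s := rev (binary x) @ ?\<sigma>1 s))"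
    using assms set_binary[of x] by (intro runs_move) auto
  ultimately show ?thesis
    unfolding push_number_def
    by (intro runs_weaken[OF runs_Seq]) (use assms in \<open>auto simp: fun_eq_iff renc_def\<close>)
qed

definition idle :: "store \<Rightarrow> bool" where
  "idle \<sigma> \<longleftrightarrow> (\<forall>r\<in>{2, 3, 4, 5, 6, 7, 8, 12, 14, 15, 16, 17, 18, 19, 22, 24, 25}. \<sigma> r = [])"

lemma idleD:
  assumes "idle \<sigma>"
  shows "scratch_empty \<sigma>" "\<sigma> 2 = []" "\<sigma> 6 = []" "\<sigma> 7 = []" "\<sigma> 8 = []" "\<sigma> 12 = []" "\<sigma> 14 = []"
    "\<sigma> 15 = []" "\<sigma> 16 = []" "\<sigma> 17 = []" "\<sigma> 18 = []" "\<sigma> 19 = []" "\<sigma> 22 = []" "\<sigma> 24 = []" "\<sigma> 25 = []"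
  using assms by (auto simp: idle_def scratch_empty_def)

lemma idle_update [simp]:
  "r \<notin> {2, 3, 4, 5, 6, 7, 8, 12, 14, 15, 16, 17, 18, 19, 22, 24, 25} \<Longrightarrow> idle (\<sigma>(r := xs)) = idle \<sigma>"
  by (auto simp: idle_def)

text \<open>Computes a number congruent to \<open>x\<close> modulo \<open>m\<close> and to 0 modulo \<open>Q\<close>.\<close>

definition lift_residue :: com where
  "lift_residue =
     add 14 9;; divide 14 15 9 13;; clear 14;;
     copy 13 25;; copy 11 16;;
     euclid 9 25 15 16 17;;
     clear 25;; clear 16;; clear 17;;
     divide 15 18 10 19"

text \<open>Euclid's algorithm starts with the cofactor \<open>x * Q\<close> for \<open>Q\<close>
  and 0 for \<open>m\<close>, instead of 1 and 0. Modulo \<open>m\<close> this represents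
  \<open>u = x\<close>, modulo \<open>Q\<close> it represents \<open>u = 0\<close>, so the final
  cofactor is already a lift: no inverse has to be multiplied afterwards. The last division reduces
  it modulo \<open>M\<close>; remainders lie between 1 and the divisor, so \<open>v = M\<close> is
  possible.\<close>

lemma runs_lift_residue:
  assumes "idle (\<sigma>(14 := []))" "\<sigma> 9 = binary 1" "\<sigma> 10 = binary M" "\<sigma> 11 = binary m" "\<sigma> 13 = binary Q"
    "\<sigma> 14 = binary x" "M = Q * m" "M \<ge> 1" "coprime Q m" "x < m" "2 * blen M + 2 \<le> n"
  shows "\<exists>v\<le>M. [v = x] (mod m) \<and> Q dvd v \<and>
    runs lift_residue \<sigma> (2100 * (n + 1)\<^sup>2) (\<sigma>(14 := [], 15 := binary v))"
proof -
  have idle: "scratch_empty \<sigma>" "\<sigma> 2 = []" "\<sigma> 6 = []" "\<sigma> 7 = []" "\<sigma> 8 = []" "\<sigma> 12 = []"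
    "\<sigma> 15 = []" "\<sigma> 16 = []" "\<sigma> 17 = []" "\<sigma> 18 = []" "\<sigma> 19 = []" "\<sigma> 22 = []" "\<sigma> 24 = []" "\<sigma> 25 = []"
    using idleD[OF assms(1)] by simp_all
  have pos: "Q \<ge> 1" "m \<ge> 1" using assms(7,8) by (auto simp: Suc_le_eq)
  then have le: "Q \<le> M" "m \<le> M" using assms(7) by simp_all
  have "x * Q \<le> m * Q" using assms(10) by simp
  then have xQ: "x * Q \<le> M" using assms(7) by (simp add: mult.commute)
  have len: "blen k + 1 \<le> n" if "k \<le> M" for k using blen_mono[OF that] assms(11) by linarith
  have len2: "blen k \<le> n" "blen k + 1 \<le> n" if "k \<le> M * M" for k
    using blen_mono[OF that] blen_mult[of M M] assms(11) by linarith+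
  have len1: "blen k \<le> n" if "k \<le> M" for k using len[OF that] by simp
  have "blen (x + 1) \<le> blen M" using assms(10) le by (intro blen_mono) linarith
  then have lx: "blen (x + 1) + 1 \<le> n" using assms(11) by linarith
  \<comment> \<open>The division of \<open>x + 1\<close> by 1 serves as multiplication: it adds
    \<open>Q\<close> exactly \<open>x\<close> times in effect and leaves remainder 1.\<close>
  have q: "quot (x + 1) 1 = x" "rem (x + 1) 1 = 1"
    "quot (Suc x) (Suc 0) = x" "rem (Suc x) (Suc 0) = 1" by (simp_all add: quot_def rem_def)
  let ?\<sigma>1 = "\<sigma>(14 := binary (x + 1))"
  let ?\<sigma>2 = "?\<sigma>1(14 := binary 1, 15 := binary (x * Q))"
  let ?\<sigma>3 = "?\<sigma>2(14 := [])"
  let ?\<sigma>4 = "?\<sigma>3(25 := binary Q)"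
  let ?\<sigma>5 = "?\<sigma>4(16 := binary m)"
  have 1: "runs (add 14 9) \<sigma> (50 * (n + 1)) ?\<sigma>1"
    using assms idle len1[of x] len1[of 1] le by (intro runs_add) auto
  have "runs (divide 14 15 9 13) ?\<sigma>1 ((shifts (x + 1) 1 + 1) * (250 * (n + 1)))
      (?\<sigma>1(14 := binary (rem (x + 1) 1), 15 := binary (0 + quot (x + 1) 1 * Q)))"
    using assms(2-8) idle len1[of 1] len1[of Q] len1[of "x * Q"] le lx xQ
    by (intro runs_divide) (auto simp: q)
  moreover have "shifts (x + 1) 1 \<le> n" using shifts_le_blen[of 1 "x + 1"] lx by linarith
  ultimately have 2: "runs (divide 14 15 9 13) ?\<sigma>1 ((n + 1) * (250 * (n + 1))) ?\<sigma>2"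
    by (elim runs_weaken) (auto simp: q intro: mult_le_mono1)
  have 3: "runs (clear 14) ?\<sigma>2 (3 * n + 1) ?\<sigma>3"
    using len1[of 1] assms by (intro runs_clear_number[where k = 1]) auto
  have 4: "runs (copy 13 25) ?\<sigma>3 (12 * n + 2) ?\<sigma>4"
    using assms idle len1[of Q] le by (intro runs_copy) auto
  have 5: "runs (copy 11 16) ?\<sigma>4 (12 * n + 2) ?\<sigma>5"
    using assms idle len1[of m] le by (intro runs_copy) auto
  \<comment> \<open>This is the invariant of Euclid's algorithm at the start. It bounds all
    cofactors, and \<open>M * M\<close> is the reason for allowing twice the digits of
    \<open>M\<close> in \<open>n\<close>.\<close>
  have N: "Q * 0 + m * (x * Q) \<le> M * M"
    using mult_le_mono[OF le(2) xQ] by simp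
  have "\<exists>U c d d'. runs (euclid 9 25 15 16 17) ?\<sigma>5 (250 * (n + 1) * (U + 1))
      (?\<sigma>5(25 := binary 1, 15 := binary c, 16 := binary d, 17 := binary d')) \<and>
    2 ^ U \<le> (Q * m) ^ 5 \<and> c \<le> Q * 0 + m * (x * Q) \<and> d' \<le> Q * 0 + m * (x * Q) \<and> d \<le> m \<and>
    (\<forall>k u. [int (x * Q) = int Q * u] (mod k) \<longrightarrow> [int 0 = - (int m * u)] (mod k) \<longrightarrow> [int c = u] (mod k))"
    using assms(2-5,9) idle pos len[of Q] len[of m] le len2(1)[OF N]
    by (intro runs_euclid) auto
  then obtain U c d d' where e: "runs (euclid 9 25 15 16 17) ?\<sigma>5 (250 * (n + 1) * (U + 1))
      (?\<sigma>5(25 := binary 1, 15 := binary c, 16 := binary d, 17 := binary d'))"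
    "2 ^ U \<le> (Q * m) ^ 5" "c \<le> Q * 0 + m * (x * Q)" "d' \<le> Q * 0 + m * (x * Q)" "d \<le> m"
    "\<forall>k u. [int (x * Q) = int Q * u] (mod k) \<longrightarrow> [int 0 = - (int m * u)] (mod k) \<longrightarrow> [int c = u] (mod k)"
    by (elim exE conjE) (rule that)
  note eU = e(2)[folded assms(7)] and ec = order_trans[OF e(3) N] and ed = order_trans[OF e(4) N]
    and econg = e(6)[rule_format]
  let ?\<sigma>6 = "?\<sigma>5(25 := binary 1, 15 := binary c, 16 := binary d, 17 := binary d')"
  \<comment> \<open>Since \<open>2 ^ U\<close> is at most the fifth power of \<open>M\<close>, the
    cost unit count \<open>U\<close> is linear in the number of digits.\<close>
  have "2 ^ U < (2::nat) ^ (5 * blen M)"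
  proof -
    have "M ^ 5 < (2 ^ blen M) ^ 5" using less_power_blen[of M] by (intro power_strict_mono) auto
    then show ?thesis using eU by (simp add: power_mult mult.commute)
  qed
  then have "U \<le> 5 * n" using assms(11) by simp
  then have "250 * (n + 1) * (U + 1) \<le> 250 * (n + 1) * (5 * n + 1)" by (intro mult_le_mono2) simp
  from runs_weaken[OF e(1) refl this]
  have 6: "runs (euclid 9 25 15 16 17) ?\<sigma>5 (250 * (n + 1) * (5 * n + 1)) ?\<sigma>6" .
  let ?\<sigma>7 = "?\<sigma>6(25 := [])"
  let ?\<sigma>8 = "?\<sigma>7(16 := [])"
  let ?\<sigma>9 = "?\<sigma>8(17 := [])"
  have 7: "runs (clear 25) ?\<sigma>6 (3 * n + 1) ?\<sigma>7"
    using len1[of 1] assms by (intro runs_clear_number[where k = 1]) auto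
  have 8: "runs (clear 16) ?\<sigma>7 (3 * n + 1) ?\<sigma>8"
    using len1[of d] e(5) le by (intro runs_clear_number[where k = d]) auto
  have 9: "runs (clear 17) ?\<sigma>8 (3 * n + 1) ?\<sigma>9"
    using len2(1)[of d'] ed by (intro runs_clear_number[where k = d']) auto
  define v where "v = rem c M"
  \<comment> \<open>Stacks 18 and 19 are empty and thus hold 0; only the remainder is
    wanted.\<close>
  have "runs (divide 15 18 10 19) ?\<sigma>9 ((shifts c M + 1) * (250 * (n + 1)))
      (?\<sigma>9(15 := binary (rem c M), 18 := binary (0 + quot c M * 0)))"
    using assms(3,8) idle len2[of c] ec len1[of M]
    by (intro runs_divide) auto
  moreover have "shifts c M \<le> n" using shifts_le_blen[of M c] assms(8) len2(1)[OF ec] by linarith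
  ultimately have 10: "runs (divide 15 18 10 19) ?\<sigma>9 ((n + 1) * (250 * (n + 1))) (?\<sigma>9(15 := binary v, 18 := []))"
    by (elim runs_weaken) (auto simp: v_def intro: mult_le_mono1)
  have final: "?\<sigma>9(15 := binary v, 18 := []) = \<sigma>(14 := [], 15 := binary v)"
    using idle by (auto simp: fun_eq_iff)
  from 1 2 3 4 5 6 7 8 9 10 have "runs lift_residue \<sigma>
    (50 * (n + 1) + ((n + 1) * (250 * (n + 1)) + (3 * n + 1 + (12 * n + 2 + (12 * n + 2 +
      (250 * (n + 1) * (5 * n + 1) + (3 * n + 1 + (3 * n + 1 + (3 * n + 1 + (n + 1) * (250 * (n + 1)))))))))))
    (?\<sigma>9(15 := binary v, 18 := []))"
    unfolding lift_residue_def by (intro runs_Seq)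
  then have run: "runs lift_residue \<sigma> (2100 * (n + 1)\<^sup>2) (\<sigma>(14 := [], 15 := binary v))"
    by (rule runs_weaken) (use final in \<open>simp_all add: power2_eq_square algebra_simps\<close>)
  have cv: "c = v + quot c M * M" using rem_add_quot by (simp add: v_def)
  have "[int c = int x] (mod int m)"
    by (rule econg) (simp_all add: cong_iff_dvd_diff mult.commute)
  moreover have "int c = int v + int (quot c M) * int Q * int m" by (subst cv) (simp add: assms(7))
  ultimately have "[int v = int x] (mod int m)"
    by (simp add: cong_def)
  then have "[v = x] (mod m)" by (simp add: cong_int_iff)
  moreover have "[int c = 0] (mod int Q)"
    by (rule econg) (simp_all add: cong_iff_dvd_diff)
  then have "Q dvd c" by (simp add: cong_0_iff)
  then have "Q dvd v" using cv assms(7) by (metis dvd_add_left_iff dvd_mult dvd_triv_left)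
  moreover have "v \<le> M" unfolding v_def using assms(8) by (rule rem_le_divisor)
  ultimately show ?thesis using run by blast
qed

text \<open>For coprime arguments this is the unique residue given by the Chinese remainder theorem.
  The \<open>v\<close> that the program computes agrees with it modulo \<open>M\<close>, but may be
  \<open>M\<close> where this is 0.\<close>

definition lift :: "nat \<Rightarrow> nat \<Rightarrow> nat \<Rightarrow> nat" where
  "lift Q m a = (SOME e. e < Q * m \<and> [e = a] (mod m) \<and> Q dvd e)"

lemma lift:
  assumes "coprime Q m" "Q * m \<ge> 1"
  shows "lift Q m a < Q * m" "[lift Q m a = a] (mod m)" "Q dvd lift Q m a"
proof -
  obtain x where x: "[x = a] (mod m)" "[x = 0] (mod Q)"
    using binary_chinese_remainder_nat[of m Q a 0] assms(1) by (auto simp: coprime_commute)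
  have "[x mod (Q * m) = a] (mod m)" using x(1) by (simp add: cong_def mod_mod_cancel)
  moreover have "Q dvd x mod (Q * m)" using x(2) by (simp add: cong_0_iff dvd_mod_iff)
  moreover have "x mod (Q * m) < Q * m" using assms(2) by simp
  ultimately have "\<exists>e. e < Q * m \<and> [e = a] (mod m) \<and> Q dvd e" by blast
  from someI_ex[OF this] show "lift Q m a < Q * m" "[lift Q m a = a] (mod m)" "Q dvd lift Q m a"
    by (simp_all add: lift_def)
qed

section \<open>Translating the list of partial sums by all lifts of a block\<close>

definition reduced_sum :: "nat \<Rightarrow> nat \<Rightarrow> nat \<Rightarrow> nat" where
  "reduced_sum M v x = (if x + v < M then x + v else x + v - M)"

text \<open>One conditional subtraction reduces the sum because \<open>x < M\<close> and
  \<open>v \<le> M\<close> give \<open>x + v < 2 * M\<close>; the case \<open>v = M\<close> does no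
  harm.\<close>

lemma reduced_sum_lift:
  assumes "coprime Q m" "M = Q * m" "[v = a] (mod m)" "Q dvd v" "v \<le> M" "x < M"
  shows "reduced_sum M v x = (x + lift Q m a) mod M"
proof -
  have M: "Q * m \<ge> 1" using assms(2,6) by linarith
  have "[lift Q m a = v] (mod m)"
    using lift(2)[OF assms(1) M] assms(3) by (metis cong_sym cong_trans)
  moreover have "[lift Q m a = v] (mod Q)"
    using lift(3)[OF assms(1) M, of a] assms(4) by (simp add: cong_def)
  ultimately have "[lift Q m a = v] (mod M)"
    unfolding assms(2) using assms(1) by (intro coprime_cong_mult_nat)
  then have "(x + lift Q m a) mod M = (x + v) mod M"
    by (metis cong_add_lcancel_nat cong_def)
  moreover have "x + v < 2 * M" using assms by simp
  ultimately show ?thesis by (auto simp: reduced_sum_def mod_if)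
qed

text \<open>The list on stack 21 is consumed once for every residue of the block, so each number is
  also transferred to the backup on stack 22, from which the list is restored at the end.\<close>

definition translate :: com where
  "translate =
     While (\<lambda>\<tau>. \<tau> 21 \<noteq> 0)
       (transfer digit 21 [24, 22];; Pop 21;; Push 22 (\<lambda>_. 3);; add 24 15;;
        if_less 24 10 Skip (sub 24 10);; push_number 24 23);;
     move_all 22 21;; clear 15"

text \<open>The loops recognize a further number by its first symbol, which must differ from the
  blank of an empty stack and from the end mark 4 of a block.\<close>

lemma hd_renc: "hd (renc x @ ys) \<noteq> 0" "hd (renc x @ ys) \<noteq> 4" "renc x \<noteq> []"
proof -
  have "hd (renc x @ ys) \<in> {1, 2, 3}"
  proof (cases "rev (binary x)")
    case (Cons s ds)
    then have "s \<in> set (binary x)" by (metis list.set_intros(1) set_rev)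
    with Cons show ?thesis using set_binary[of x] by (auto simp: renc_def)
  qed (simp add: renc_def)
  then show "hd (renc x @ ys) \<noteq> 0" "hd (renc x @ ys) \<noteq> 4" by auto
qed (simp add: renc_def)

lemma runs_translate:
  assumes "idle (\<sigma>(15 := []))" "\<sigma> 10 = binary M" "\<sigma> 15 = binary v" "v \<le> M" "\<sigma> 21 = rlist xs"
    "\<And>x. x \<in> set xs \<Longrightarrow> x < M" "blen M + 1 \<le> n"
  shows "runs translate \<sigma> (length xs * (162 * (n + 1)) + 4 * (n + 1))
    (\<sigma>(15 := [], 23 := rlist (rev (map (reduced_sum M v) xs)) @ \<sigma> 23))"
proof -
  let ?f = "reduced_sum M v"
  let ?body = "transfer digit 21 [24, 22];; Pop 21;; Push 22 (\<lambda>_. 3);; add 24 15;;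
        if_less 24 10 Skip (sub 24 10);; push_number 24 23"
  define S where "S i = \<sigma>(21 := rlist (drop i xs), 22 := rev (rlist (take i xs)),
    23 := rlist (rev (map ?f (take i xs))) @ \<sigma> 23)" for i
  have idle: "scratch_empty \<sigma>" "\<sigma> 2 = []" "\<sigma> 22 = []" "\<sigma> 24 = []"
    using idleD[OF assms(1)] by simp_all
  have lv: "blen v \<le> n" using blen_mono[OF assms(4)] assms(7) by linarith
  have body: "runs ?body (S i) (155 * (n + 1)) (S (Suc i))" if i: "i < length xs" for i
  proof -
    define x where "x = xs ! i"
    have x: "drop i xs = x # drop (Suc i) xs" "take (Suc i) xs = take i xs @ [x]" "x < M"
      using i assms(6) by (simp_all add: x_def Cons_nth_drop_Suc take_Suc_conv_app_nth)
    have lx: "blen x \<le> n" using blen_mono[of x M] x(3) assms(7) by linarith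
    have lxv: "blen (x + v) \<le> n"
      using blen_add[of x "blen M" v] blen_mono[of x M] blen_mono[OF assms(4)] x(3) assms(7) by linarith
    have "?f x \<le> x + v" by (simp add: reduced_sum_def)
    then have lf: "blen (?f x) \<le> n" using blen_mono lxv le_trans by blast
    let ?r = "rlist (drop (Suc i) xs)"
    let ?s1 = "(S i)(21 := 3 # ?r, 24 := binary x, 22 := binary x @ S i 22)"
    let ?s2 = "?s1(21 := ?r)"
    let ?s3 = "?s2(22 := 3 # ?s2 22)"
    let ?s4 = "?s3(24 := binary (x + v))"
    let ?s5 = "?s4(24 := binary (?f x))"
    let ?s6 = "?s5(24 := [], 23 := renc (?f x) @ ?s5 23)"
    have 1: "runs (transfer digit 21 [24, 22]) (S i) (7 * n + 1) ?s1"
      by (rule runs_weaken, rule runs_transfer[where ds = "rev (binary x)" and rest = "3 # ?r"])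
        (use set_binary[of x] x idle lx in \<open>auto simp: S_def renc_def digit_def fun_eq_iff\<close>)
    have 2: "runs (Pop 21) ?s1 1 ?s2" by (rule runs_weaken[OF runs_Pop]) auto
    have 3: "runs (Push 22 (\<lambda>_. 3)) ?s2 2 ?s3" by (rule runs_Push) auto
    have 4: "runs (add 24 15) ?s3 (50 * (n + 1)) ?s4"
      using assms lv lx idle by (intro runs_add) (auto simp: S_def)
    have "runs (if x + v < M then Skip else sub 24 10) ?s4 (50 * (n + 1)) ?s5"
    proof (cases "x + v < M")
      case True
      then show ?thesis by (auto simp: reduced_sum_def intro!: runs_weaken[OF runs_Skip])
    next
      case False
      then have "runs (sub 24 10) ?s4 (50 * (n + 1)) (?s4(24 := binary (x + v - M)))"
        using assms lxv idle by (intro runs_sub) (auto simp: S_def)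
      with False show ?thesis by (simp add: reduced_sum_def)
    qed
    then have 5: "runs (if_less 24 10 Skip (sub 24 10)) ?s4 (43 * (n + 1) + 50 * (n + 1)) ?s5"
      using assms lxv idle by (intro runs_if_less) (auto simp: S_def)
    have 6: "runs (push_number 24 23) ?s5 (5 * n + 3) ?s6"
      using lf by (intro runs_push_number) auto
    have "?s6 = S (Suc i)"
      unfolding S_def x(2) by (auto simp: fun_eq_iff renc_def idle)
    moreover from 1 2 3 4 5 6 have "runs ?body (S i)
      (7 * n + 1 + (1 + (2 + (50 * (n + 1) + (43 * (n + 1) + 50 * (n + 1) + (5 * n + 3)))))) ?s6"
      by (intro runs_Seq)
    ultimately show ?thesis by (elim runs_weaken) auto
  qed
  have iter: "runs (While (\<lambda>\<tau>. \<tau> 21 \<noteq> 0) ?body) (S 0) ((\<Sum>i<length xs. 155 * (n + 1) + 2) + 1) (S (length xs))"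
  proof (rule runs_While_iter[where S = S and t = "\<lambda>_. 155 * (n + 1)"])
    fix i assume i: "i < length xs"
    then show "runs ?body (S i) (155 * (n + 1)) (S (Suc i))" by (rule body)
    from i show "tops (S i) 21 \<noteq> 0"
      using hd_renc[of "xs ! i"] by (simp add: tops_def S_def flip: Cons_nth_drop_Suc)
  qed (simp_all add: tops_def S_def)
  have S0: "S 0 = \<sigma>" using idle assms by (auto simp: S_def fun_eq_iff)
  from iter[unfolded S0] have loop: "runs (While (\<lambda>\<tau>. \<tau> 21 \<noteq> 0) ?body) \<sigma> (length xs * (155 * (n + 1) + 2) + 1) (S (length xs))"
    by (rule runs_weaken) auto
  let ?s1 = "(S (length xs))(22 := [], 21 := rev (S (length xs) 22) @ S (length xs) 21)"
  have "length (rlist xs) \<le> length xs * (n + 1)"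
    using assms(6,7) blen_mono[OF less_imp_le, of _ M] by (intro length_rlist) (meson le_trans add_leD1)
  then have mv: "runs (move_all 22 21) (S (length xs)) (5 * (length xs * (n + 1)) + 1) ?s1"
    using set_rlist[of xs] by (intro runs_move_all) (auto simp: S_def)
  have cl: "runs (clear 15) ?s1 (3 * n + 1) (?s1(15 := []))"
    using assms lv by (intro runs_clear_number[where k = v]) (auto simp: S_def)
  have "?s1(15 := []) = \<sigma>(15 := [], 23 := rlist (rev (map ?f xs)) @ \<sigma> 23)"
    using idle assms by (auto simp: S_def fun_eq_iff)
  moreover from loop mv cl have "runs translate \<sigma>
      (length xs * (155 * (n + 1) + 2) + 1 + (5 * (length xs * (n + 1)) + 1 + (3 * n + 1))) (?s1(15 := []))"
    unfolding translate_def by (intro runs_Seq)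
  ultimately show ?thesis by (elim runs_weaken) (auto simp: algebra_simps)
qed

definition all_sums :: "nat \<Rightarrow> nat \<Rightarrow> nat list \<Rightarrow> nat list \<Rightarrow> nat list" where
  "all_sums M m as xs = concat (map (\<lambda>a. map (\<lambda>x. (x + lift (M div m) m a) mod M) xs) as)"

lemma length_all_sums: "length (all_sums M m as xs) = length as * length xs"
  by (induction as) (simp_all add: all_sums_def)

definition lift_all :: com where
  "lift_all = While (\<lambda>\<tau>. \<tau> 20 \<noteq> 4) (pop_number 20 14;; lift_residue;; translate)"

lemma runs_lift_all:
  assumes "idle \<sigma>" "\<sigma> 9 = binary 1" "\<sigma> 10 = binary M" "\<sigma> 11 = binary m" "\<sigma> 13 = binary (M div m)"
    "\<sigma> 20 = rlist as @ 4 # rest" "\<sigma> 21 = rlist xs" "\<sigma> 23 = []"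
    "m dvd M" "M \<ge> 1" "coprime (M div m) m" "\<And>a. a \<in> set as \<Longrightarrow> a < m"
    "\<And>x. x \<in> set xs \<Longrightarrow> x < M" "2 * blen M + 2 \<le> n"
  shows "runs lift_all \<sigma> (length as * (2112 * (n + 1)\<^sup>2 + length xs * (162 * (n + 1))) + 1)
    (\<sigma>(20 := 4 # rest, 23 := rlist (rev (all_sums M m as xs))))"
proof -
  let ?Q = "M div m"
  define S where "S i = \<sigma>(20 := rlist (drop i as) @ 4 # rest, 23 := rlist (rev (all_sums M m (take i as) xs)))" for i
  have M: "M = ?Q * m" using assms(9) by simp
  then have mM: "m \<le> M" using assms(9,10) by (simp add: dvd_imp_le)
  have body: "runs (pop_number 20 14;; lift_residue;; translate) (S i)
      (5 * n + 2 + (2100 * (n + 1)\<^sup>2 + (length xs * (162 * (n + 1)) + 4 * (n + 1)))) (S (Suc i))"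
    if i: "i < length as" for i
  proof -
    define a where "a = as ! i"
    have a: "drop i as = a # drop (Suc i) as" "take (Suc i) as = take i as @ [a]" "a < m"
      using i assms(12) by (simp_all add: a_def Cons_nth_drop_Suc take_Suc_conv_app_nth)
    have la: "blen a \<le> n" using blen_mono[of a M] a(3) mM assms(14) by linarith
    let ?s1 = "(S i)(20 := rlist (drop (Suc i) as) @ 4 # rest, 14 := binary a)"
    have 1: "runs (pop_number 20 14) (S i) (5 * n + 2) ?s1"
      using a la idleD[OF assms(1)] by (intro runs_pop_number) (auto simp: S_def)
    have i1: "idle (?s1(14 := []))" using assms(1) by (auto simp: idle_def S_def)
    have "\<exists>v\<le>M. [v = a] (mod m) \<and> ?Q dvd v \<and>
      runs lift_residue ?s1 (2100 * (n + 1)\<^sup>2) (?s1(14 := [], 15 := binary v))"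
      using assms i1 a by (intro runs_lift_residue) (auto simp: S_def)
    then obtain v where v: "v \<le> M" "[v = a] (mod m)" "?Q dvd v"
      "runs lift_residue ?s1 (2100 * (n + 1)\<^sup>2) (?s1(14 := [], 15 := binary v))" by blast
    let ?s2 = "?s1(14 := [], 15 := binary v)"
    let ?s3 = "?s2(15 := [], 23 := rlist (rev (map (reduced_sum M v) xs)) @ ?s2 23)"
    have i2: "idle (?s2(15 := []))" using assms(1) by (auto simp: idle_def S_def)
    have 3: "runs translate ?s2 (length xs * (162 * (n + 1)) + 4 * (n + 1)) ?s3"
      using assms i2 v(1) by (intro runs_translate) (auto simp: S_def)
    have eq: "map (reduced_sum M v) xs = map (\<lambda>x. (x + lift ?Q m a) mod M) xs"
      using reduced_sum_lift[OF assms(11) M v(2,3,1)] assms(13) by simp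
    have "?s3 = S (Suc i)"
      unfolding eq using idleD[OF assms(1)] by (auto simp: S_def a(2) all_sums_def fun_eq_iff)
    with runs_Seq[OF 1 runs_Seq[OF v(4) 3]] show ?thesis by simp
  qed
  let ?t = "5 * n + 2 + (2100 * (n + 1)\<^sup>2 + (length xs * (162 * (n + 1)) + 4 * (n + 1)))"
  have loop: "runs lift_all (S 0) ((\<Sum>i<length as. ?t + 2) + 1) (S (length as))"
    unfolding lift_all_def
  proof (rule runs_While_iter[where S = S and t = "\<lambda>_. ?t"])
    fix i assume i: "i < length as"
    then show "runs (pop_number 20 14;; lift_residue;; translate) (S i) ?t (S (Suc i))" by (rule body)
    from i show "tops (S i) 20 \<noteq> 4"
      using hd_renc[of "as ! i"] by (simp add: tops_def S_def flip: Cons_nth_drop_Suc)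
  qed (simp_all add: tops_def S_def)
  have "?t + 2 \<le> 2112 * (n + 1)\<^sup>2 + length xs * (162 * (n + 1))"
    by (simp add: power2_eq_square)
  then have "length as * (?t + 2) \<le> length as * (2112 * (n + 1)\<^sup>2 + length xs * (162 * (n + 1)))"
    by (rule mult_le_mono2)
  then have t: "(\<Sum>i<length as. ?t + 2) \<le> length as * (2112 * (n + 1)\<^sup>2 + length xs * (162 * (n + 1)))"
    by (simp only: sum_constant card_lessThan of_nat_id)
  have S0: "S 0 = \<sigma>" using assms by (auto simp: S_def all_sums_def fun_eq_iff)
  show ?thesis
    by (rule runs_weaken[OF loop[unfolded S0] _ add_right_mono[OF t]]) (simp add: S_def)
qed

definition process_block :: com where
  "process_block =
     pop_number 20 11;; copy 10 12;; Push 13 (\<lambda>_. 2);; divide 12 13 11 9;; clear 12;;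
     lift_all;;
     Pop 20;; clear 11;; clear 13;; clear_all 21;; move_all 23 22;; move_all 22 21"

text \<open>With remainders between 1 and the divisor, an exact division leaves remainder
  \<open>m\<close> and a quotient that is one too small. For this reason
  \<open>process_block\<close> starts accumulating \<open>M div m\<close> at 1, the digit 2 on stack
  13.\<close>

lemma quot_dvd:
  assumes "m dvd M" "M \<ge> 1"
  shows "1 + quot M m = M div m" "rem M m = m"
proof -
  obtain k where k: "M = m * k" "m \<ge> 1" "k \<ge> 1" using assms by (cases "M = 0") auto
  then obtain j where "k = Suc j" by (cases k) auto
  moreover have "(m * j + m - 1) div m = j"
    using k(2) by (metis add_diff_assoc diff_less div_less div_mult_self4 less_le_trans less_one
      add.right_neutral not_one_le_zero zero_less_one mult.commute neq0_conv)
  ultimately have "quot M m = j" using k by (simp add: quot_def add.commute)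
  then show "1 + quot M m = M div m" "rem M m = m" using k \<open>k = Suc j\<close> by (simp_all add: rem_def)
qed

lemma runs_process_block:
  assumes "idle \<sigma>" "\<sigma> 9 = binary 1" "\<sigma> 10 = binary M" "\<sigma> 11 = []" "\<sigma> 13 = []"
    "\<sigma> 20 = renc m @ rlist as @ 4 # rest" "\<sigma> 21 = rlist xs" "\<sigma> 23 = []"
    "m dvd M" "M \<ge> 1" "coprime (M div m) m" "\<And>a. a \<in> set as \<Longrightarrow> a < m"
    "\<And>x. x \<in> set xs \<Longrightarrow> x < M" "2 * blen M + 2 \<le> n"
  shows "runs process_block \<sigma>
      ((length as + 1) * (2400 * (n + 1)\<^sup>2) + (length as * length xs + length xs) * (180 * (n + 1)))
    (\<sigma>(20 := rest, 21 := rlist (rev (all_sums M m as xs))))"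
proof -
  let ?Q = "M div m"
  let ?ys = "rev (all_sums M m as xs)"
  have mM: "m \<le> M" "m \<ge> 1" using assms(9,10) by (auto simp: dvd_imp_le Suc_le_eq intro!: gr0I)
  have QM: "?Q \<le> M" by simp
  have len: "blen k + 1 \<le> n" if "k \<le> M" for k using blen_mono[OF that] assms(14) by linarith
  have len1: "blen k \<le> n" if "k \<le> M" for k using len[OF that] by simp
  note idle = idleD[OF assms(1)]
  let ?s1 = "\<sigma>(20 := rlist as @ 4 # rest, 11 := binary m)"
  let ?s2 = "?s1(12 := binary M)"
  let ?s3 = "?s2(13 := 2 # ?s2 13)"
  let ?s4 = "?s3(12 := binary m, 13 := binary ?Q)"
  let ?s5 = "?s4(12 := [])"
  let ?s6 = "?s5(20 := 4 # rest, 23 := rlist ?ys)"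
  let ?s7 = "?s6(20 := rest)"
  let ?s8 = "?s7(11 := [])"
  let ?s9 = "?s8(13 := [])"
  let ?s10 = "?s9(21 := [])"
  let ?s11 = "?s10(23 := [], 22 := rev (?s10 23) @ ?s10 22)"
  let ?s12 = "?s11(22 := [], 21 := rev (?s11 22) @ ?s11 21)"
  have 1: "runs (pop_number 20 11) \<sigma> (5 * n + 2) ?s1"
    using assms(4,6) len1[OF mM(1)] by (intro runs_pop_number) auto
  have 2: "runs (copy 10 12) ?s1 (12 * n + 2) ?s2"
    using assms(3) idle len1[of M] by (intro runs_copy) auto
  have 3: "runs (Push 13 (\<lambda>_. 2)) ?s2 2 ?s3" by (rule runs_Push) auto
  have "runs (divide 12 13 11 9) ?s3 ((shifts M m + 1) * (250 * (n + 1)))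
      (?s3(12 := binary (rem M m), 13 := binary (1 + quot M m * 1)))"
    using assms(2,5) idle len1[of ?Q] len1[OF mM(1)] len1[of 1] mM QM len[of M] assms(10) quot_dvd[OF assms(9,10)]
    by (intro runs_divide[where Y = 1]) auto
  moreover have "shifts M m \<le> n" using shifts_le_blen[of m M] mM(2) len1[of M] by simp
  ultimately have 4: "runs (divide 12 13 11 9) ?s3 ((n + 1) * (250 * (n + 1))) ?s4"
    using quot_dvd[OF assms(9,10)] by (elim runs_weaken) (auto intro: mult_le_mono1)
  have 5: "runs (clear 12) ?s4 (3 * n + 1) ?s5"
    using len1[OF mM(1)] by (intro runs_clear_number[where k = m]) auto
  have i5: "idle ?s5" using assms(1) by (auto simp: idle_def)
  have 6: "runs lift_all ?s5 (length as * (2112 * (n + 1)\<^sup>2 + length xs * (162 * (n + 1))) + 1) ?s6"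
    using assms i5 by (intro runs_lift_all) auto
  have 7: "runs (Pop 20) ?s6 1 ?s7" by (rule runs_weaken[OF runs_Pop]) auto
  have 8: "runs (clear 11) ?s7 (3 * n + 1) ?s8"
    using len1[OF mM(1)] by (intro runs_clear_number[where k = m]) auto
  have 9: "runs (clear 13) ?s8 (3 * n + 1) ?s9"
    using len1[of ?Q] by (intro runs_clear_number[where k = ?Q]) auto
  have "length (rlist xs) \<le> length xs * (n + 1)"
    using assms(13) len1 by (intro length_rlist) (auto simp: less_imp_le)
  then have 10: "runs (clear_all 21) ?s9 (3 * (length xs * (n + 1)) + 1) ?s10"
    using assms(7) set_rlist[of xs] by (intro runs_clear_all) auto
  have "length (rlist ?ys) \<le> length ?ys * (n + 1)"
    using assms(10) len1 by (intro length_rlist) (auto simp: less_imp_le all_sums_def)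
  then have ly: "length (rlist ?ys) \<le> length as * length xs * (n + 1)" by (simp add: length_all_sums)
  have 11: "runs (move_all 23 22) ?s10 (5 * (length as * length xs * (n + 1)) + 1) ?s11"
    using ly set_rlist[of ?ys] by (intro runs_move_all) auto
  have 12: "runs (move_all 22 21) ?s11 (5 * (length as * length xs * (n + 1)) + 1) ?s12"
    using ly set_rlist[of ?ys] idle by (intro runs_move_all) auto
  have final: "?s12 = \<sigma>(20 := rest, 21 := rlist ?ys)"
    using assms idle by (auto simp: fun_eq_iff)
  from 1 2 3 4 5 6 7 8 9 10 11 12 have "runs process_block \<sigma>
    (5 * n + 2 + (12 * n + 2 + (2 + ((n + 1) * (250 * (n + 1)) + (3 * n + 1 +
      (length as * (2112 * (n + 1)\<^sup>2 + length xs * (162 * (n + 1))) + 1 + (1 + (3 * n + 1 + (3 * n + 1 +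
      (3 * (length xs * (n + 1)) + 1 + (5 * (length as * length xs * (n + 1)) + 1 +
       (5 * (length as * length xs * (n + 1)) + 1)))))))))))) ?s12"
    unfolding process_block_def by (intro runs_Seq)
  then show ?thesis
    by (rule runs_weaken) (use final in \<open>simp_all add: power2_eq_square algebra_simps\<close>)
qed

section \<open>The loop over the blocks\<close>

type_synonym block = "nat \<times> nat list"

definition benc :: "block \<Rightarrow> nat list" where
  "benc b = renc (fst b) @ rlist (snd b) @ [4]"

definition block_step :: "nat \<Rightarrow> block \<Rightarrow> nat list \<Rightarrow> nat list" where
  "block_step M b xs = rev (all_sums M (fst b) (snd b) xs)"

definition combine :: com where
  "combine = While (\<lambda>\<tau>. \<tau> 20 \<noteq> 0) process_block"

text \<open>Here \<open>k\<close> residues are lifted, and the list grows from length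
  \<open>l\<close> to length \<open>l'\<close>. The constant 2402 is that of
  \<open>process_block\<close> with the loop test absorbed.\<close>

definition block_cost :: "nat \<Rightarrow> nat \<Rightarrow> nat \<Rightarrow> nat \<Rightarrow> nat" where
  "block_cost n k l l' = (k + 1) * (2402 * (n + 1)\<^sup>2) + (l' + l) * (180 * (n + 1))"

lemma cost_slack: "(k + 1) * (c * (n + 1)\<^sup>2) + 2 \<le> (k + 1) * ((c + 2) * (n + 1)\<^sup>2)" for n :: nat
proof -
  have "1 \<le> (k + 1) * (n + 1)\<^sup>2" by (simp add: power2_eq_square)
  moreover have "(k + 1) * ((c + 2) * (n + 1)\<^sup>2) = (k + 1) * (c * (n + 1)\<^sup>2) + 2 * ((k + 1) * (n + 1)\<^sup>2)"
    by (simp only: distrib_left distrib_right mult_ac)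
  ultimately show ?thesis by linarith
qed

lemma runs_combine:
  fixes M bs xs
  defines "L \<equiv> \<lambda>i. fold (block_step M) (take i bs) xs"
  assumes "idle \<sigma>" "\<sigma> 9 = binary 1" "\<sigma> 10 = binary M" "\<sigma> 11 = []" "\<sigma> 13 = []"
    "\<sigma> 20 = concat (map benc bs)" "\<sigma> 21 = rlist xs" "\<sigma> 23 = []" "M \<ge> 1"
    "\<And>m as. (m, as) \<in> set bs \<Longrightarrow> m dvd M \<and> coprime (M div m) m \<and> (\<forall>a\<in>set as. a < m)"
    "\<And>x. x \<in> set xs \<Longrightarrow> x < M" "2 * blen M + 2 \<le> n"
  shows "runs combine \<sigma>
      ((\<Sum>i<length bs. block_cost n (length (snd (bs ! i))) (length (L i)) (length (L (Suc i)))) + 1)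
    (\<sigma>(20 := [], 21 := rlist (L (length bs))))"
proof -
  define S where "S i = \<sigma>(20 := concat (map benc (drop i bs)), 21 := rlist (L i))" for i
  let ?t = "\<lambda>i. block_cost n (length (snd (bs ! i))) (length (L i)) (length (L (Suc i))) - 2"
  have L: "L (Suc i) = block_step M (bs ! i) (L i)" if "i < length bs" for i
    using that by (simp add: L_def take_Suc_conv_app_nth)
  have LM: "x < M" if "x \<in> set (L i)" "i \<le> length bs" for i x
    using that
  proof (induction i arbitrary: x)
    case 0
    then show ?case using assms(12) by (simp add: L_def)
  next
    case (Suc i)
    then show ?case using assms(10) by (auto simp: L block_step_def all_sums_def)
  qed
  have "runs combine (S 0) ((\<Sum>i<length bs. ?t i + 2) + 1) (S (length bs))"
    unfolding combine_def
  proof (rule runs_While_iter[where S = S and t = ?t])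
    fix i assume i: "i < length bs"
    obtain m as where b: "bs ! i = (m, as)" by (cases "bs ! i")
    have d: "drop i bs = (m, as) # drop (Suc i) bs" using i b by (simp flip: Cons_nth_drop_Suc)
    have mem: "(m, as) \<in> set bs" using i b nth_mem by metis
    have ll: "length (L (Suc i)) = length as * length (L i)"
      using i by (simp add: L b block_step_def length_all_sums)
    have "runs process_block (S i)
        ((length as + 1) * (2400 * (n + 1)\<^sup>2) + (length as * length (L i) + length (L i)) * (180 * (n + 1)))
        ((S i)(20 := concat (map benc (drop (Suc i) bs)), 21 := rlist (rev (all_sums M m as (L i)))))"
      using assms(2-10) assms(11)[OF mem] assms(13) LM[of _ i] i d
      by (intro runs_process_block) (auto simp: S_def benc_def)
    moreover have "(S i)(20 := concat (map benc (drop (Suc i) bs)), 21 := rlist (rev (all_sums M m as (L i)))) = S (Suc i)"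
      using i by (auto simp: S_def L b block_step_def fun_eq_iff)
    moreover have "(length as + 1) * (2400 * (n + 1)\<^sup>2) + 2 \<le> (length as + 1) * (2402 * (n + 1)\<^sup>2)"
      using cost_slack[of "length as" 2400 n] by simp
    ultimately show "runs process_block (S i) (?t i) (S (Suc i))"
      unfolding block_cost_def ll b by (elim runs_weaken) simp_all
    show "tops (S i) 20 \<noteq> 0"
      using d hd_renc[of m] by (simp add: tops_def S_def benc_def)
  qed (simp_all add: tops_def S_def)
  note loop = this
  have S0: "S 0 = \<sigma>" using assms by (auto simp: S_def L_def fun_eq_iff)
  have t: "?t i + 2 = block_cost n (length (snd (bs ! i))) (length (L i)) (length (L (Suc i)))" for i
    by (simp add: block_cost_def power2_eq_square)
  show ?thesis
    by (rule runs_weaken[OF loop[unfolded S0 t]]) (simp_all add: S_def)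
qed

text \<open>The elements go to stack 20 digit by digit, which gives them the reversed digit order of
  the internal lists. The running product of the moduli on stack 10 is updated by dividing
  \<open>m + 1\<close> by 1; it must be complete before any lift is computed, which is why parsing
  is a separate pass.\<close>

definition parse_block :: com where
  "parse_block =
     move 0 2;; Pop 0;; move 2 11;; clear 0;; Pop 0;; Push 20 (\<lambda>_. 4);;
     While (\<lambda>\<tau>. \<tau> 0 \<noteq> 4) (Push 20 (\<lambda>_. 3);; move 0 20;; Pop 0);;
     Pop 0;;
     copy 11 12;; add 12 9;; divide 12 15 9 10;; clear 12;; clear 10;; move 15 2;; move 2 10;;
     push_number 11 20"

lemma encode_list_simps [simp]:
  "encode_list [] = []" "encode_list (x # xs) = binary x @ 3 # encode_list xs"
  "encode_list (xs @ ys) = encode_list xs @ encode_list ys"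
  by (simp_all add: encode_list_def)

lemma runs_parse_block:
  assumes "idle \<sigma>" "\<sigma> 9 = binary 1" "\<sigma> 10 = binary M" "\<sigma> 11 = []"
    "\<sigma> 0 = encode_list (m # k # as) @ 4 # rest"
    "M \<ge> 1" "m \<ge> 1" "blen (m * M) + 2 \<le> n" "blen k \<le> n" "\<And>a. a \<in> set as \<Longrightarrow> blen a \<le> n"
  shows "runs parse_block \<sigma> ((length as + 1) * (400 * (n + 1)\<^sup>2))
    (\<sigma>(0 := rest, 10 := binary (m * M), 20 := benc (m, rev as) @ \<sigma> 20))"
proof -
  note idle = idleD[OF assms(1)]
  have "m \<le> m * M" "M \<le> m * M" using assms(6,7) by simp_all
  then have l: "blen m + 2 \<le> n" "blen M \<le> n" using blen_mono assms(8) by (meson add_le_mono1 le_trans le_add1)+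
  have "blen (m + 1) \<le> blen m + 1" using blen_add[of m "blen m" 1] assms(7) blen_mono[of 1 m] by simp
  then have lm1: "blen (m + 1) + 1 \<le> n" using l by linarith
  have q: "quot (m + 1) 1 = m" "rem (m + 1) 1 = 1" "quot (Suc m) (Suc 0) = m" "rem (Suc m) (Suc 0) = 1"
    by (simp_all add: quot_def rem_def)
  define S where "S i = \<sigma>(11 := binary m, 0 := encode_list (drop i as) @ 4 # rest,
    20 := rlist (rev (take i as)) @ 4 # \<sigma> 20)" for i
  let ?body = "Push 20 (\<lambda>_. 3);; move 0 20;; Pop 0"
  let ?w = "encode_list as @ 4 # rest"
  let ?s1 = "\<sigma>(0 := 3 # binary k @ 3 # ?w, 2 := rev (binary m) @ \<sigma> 2)"
  let ?s2 = "?s1(0 := binary k @ 3 # ?w)"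
  let ?s3 = "?s2(2 := [], 11 := rev (rev (binary m)) @ ?s2 11)"
  let ?s4 = "?s3(0 := 3 # ?w)"
  let ?s5 = "?s4(0 := ?w)"
  let ?s6 = "?s5(20 := 4 # ?s5 20)"
  have s6: "?s6 = S 0" using idle assms by (auto simp: S_def fun_eq_iff)
  have 1: "runs (move 0 2) \<sigma> (5 * n + 1) ?s1"
    using assms(5) set_binary l by (intro runs_move[where ds = "binary m"]) auto
  have 2: "runs (Pop 0) ?s1 1 ?s2" by (rule runs_weaken[OF runs_Pop]) auto
  have 3: "runs (move 2 11) ?s2 (5 * n + 1) ?s3"
    using set_binary[of m] l idle by (intro runs_move) auto
  have 4: "runs (clear 0) ?s3 (3 * n + 1) ?s4"
    using set_binary assms(9) by (intro runs_clear[where ds = "binary k"]) auto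
  have 5: "runs (Pop 0) ?s4 1 ?s5" by (rule runs_weaken[OF runs_Pop]) auto
  have 6: "runs (Push 20 (\<lambda>_. 4)) ?s5 2 ?s6" by (rule runs_Push) auto
  have body: "runs ?body (S i) (2 + (5 * n + 1 + 1)) (S (Suc i))" if i: "i < length as" for i
  proof -
    define a where "a = as ! i"
    have a: "drop i as = a # drop (Suc i) as" "take (Suc i) as = take i as @ [a]" "a \<in> set as"
      using i by (simp_all add: a_def Cons_nth_drop_Suc take_Suc_conv_app_nth)
    let ?u = "encode_list (drop (Suc i) as) @ 4 # rest"
    let ?r1 = "(S i)(20 := 3 # S i 20)"
    let ?r2 = "?r1(0 := 3 # ?u, 20 := rev (binary a) @ ?r1 20)"
    let ?r3 = "?r2(0 := ?u)"
    have "runs (Push 20 (\<lambda>_. 3)) (S i) 2 ?r1" by (rule runs_Push) auto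
    moreover have "runs (move 0 20) ?r1 (5 * n + 1) ?r2"
      using a set_binary[of a] assms(10) by (intro runs_move) (auto simp: S_def)
    moreover have "runs (Pop 0) ?r2 1 ?r3" by (rule runs_weaken[OF runs_Pop]) auto
    ultimately have "runs ?body (S i) (2 + (5 * n + 1 + 1)) ?r3" by (intro runs_Seq)
    moreover have "?r3 = S (Suc i)" by (auto simp: S_def a(2) renc_def fun_eq_iff)
    ultimately show ?thesis by simp
  qed
  have 7: "runs (While (\<lambda>\<tau>. \<tau> 0 \<noteq> 4) ?body) (S 0) ((\<Sum>i<length as. 2 + (5 * n + 1 + 1) + 2) + 1) (S (length as))"
  proof (rule runs_While_iter[where S = S and t = "\<lambda>_. 2 + (5 * n + 1 + 1)"])
    fix i assume i: "i < length as"
    then show "runs ?body (S i) (2 + (5 * n + 1 + 1)) (S (Suc i))" by (rule body)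
    have "hd (binary (as ! i) @ 3 # ys) \<noteq> 4" for ys
      using set_binary[of "as ! i"] by (cases "binary (as ! i)") auto
    with i show "tops (S i) 0 \<noteq> 4" by (simp add: tops_def S_def flip: Cons_nth_drop_Suc)
  qed (simp_all add: tops_def S_def)
  let ?t1 = "(S (length as))(0 := rest)"
  let ?t2 = "?t1(12 := binary m)"
  let ?t3 = "?t2(12 := binary (m + 1))"
  let ?t4 = "?t3(12 := binary 1, 15 := binary (m * M))"
  let ?t5 = "?t4(12 := [])"
  let ?t6 = "?t5(10 := [])"
  let ?t7 = "?t6(15 := [], 2 := rev (binary (m * M)) @ ?t6 2)"
  let ?t8 = "?t7(2 := [], 10 := rev (rev (binary (m * M))) @ ?t7 10)"
  let ?t9 = "?t8(11 := [], 20 := renc m @ ?t8 20)"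
  have 8: "runs (Pop 0) (S (length as)) 1 ?t1" by (rule runs_weaken[OF runs_Pop]) (auto simp: S_def)
  have 9: "runs (copy 11 12) ?t1 (12 * n + 2) ?t2"
    using idle l by (intro runs_copy) (auto simp: S_def)
  have 10: "runs (add 12 9) ?t2 (50 * (n + 1)) ?t3"
    using idle l assms(2) lm1 by (intro runs_add[where b = 1]) (auto simp: S_def)
  have "runs (divide 12 15 9 10) ?t3 ((shifts (m + 1) 1 + 1) * (250 * (n + 1)))
      (?t3(12 := binary (rem (m + 1) 1), 15 := binary (0 + quot (m + 1) 1 * M)))"
    using idle l lm1 assms(2,3,8) by (intro runs_divide[where y = 1]) (auto simp: S_def q)
  moreover have "shifts (m + 1) 1 \<le> n" using shifts_le_blen[of 1 "m + 1"] lm1 by linarith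
  ultimately have 11: "runs (divide 12 15 9 10) ?t3 ((n + 1) * (250 * (n + 1))) ?t4"
    by (elim runs_weaken) (auto simp: q intro: mult_le_mono1)
  have 12: "runs (clear 12) ?t4 (3 * n + 1) ?t5"
    using lm1 by (intro runs_clear_number[where k = 1]) auto
  have 13: "runs (clear 10) ?t5 (3 * n + 1) ?t6"
    using l assms by (intro runs_clear_number[where k = M]) (auto simp: S_def)
  have 14: "runs (move 15 2) ?t6 (5 * n + 1) ?t7"
    using set_binary[of "m * M"] assms(8) by (intro runs_move) auto
  have 15: "runs (move 2 10) ?t7 (5 * n + 1) ?t8"
    using set_binary[of "m * M"] assms(8) idle by (intro runs_move) (auto simp: S_def)
  have 16: "runs (push_number 11 20) ?t8 (5 * n + 3) ?t9"
    using l by (intro runs_push_number) (auto simp: S_def)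
  have final: "?t9 = \<sigma>(0 := rest, 10 := binary (m * M), 20 := benc (m, rev as) @ \<sigma> 20)"
    using idle assms(4) by (auto simp: S_def fun_eq_iff benc_def)
  from 1 2 3 4 5 6[unfolded s6] 7 8 9 10 11 12 13 14 15 16 have "runs parse_block \<sigma>
    (5 * n + 1 + (1 + (5 * n + 1 + (3 * n + 1 + (1 + (2 + ((\<Sum>i<length as. 2 + (5 * n + 1 + 1) + 2) + 1 +
      (1 + (12 * n + 2 + (50 * (n + 1) + ((n + 1) * (250 * (n + 1)) + (3 * n + 1 + (3 * n + 1 +
      (5 * n + 1 + (5 * n + 1 + (5 * n + 3)))))))))))))))) ?t9"
    unfolding parse_block_def by (intro runs_Seq)
  then show ?thesis
    by (rule runs_weaken) (use final in \<open>simp_all add: power2_eq_square algebra_simps\<close>)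
qed

definition parse :: com where
  "parse = While (\<lambda>\<tau>. \<tau> 0 \<noteq> 0) parse_block"

definition ienc :: "block \<times> nat \<Rightarrow> nat list" where
  "ienc b = encode_list (fst (fst b) # snd b # snd (fst b)) @ [4]"

definition modulus_prod :: "(block \<times> nat) list \<Rightarrow> nat" where
  "modulus_prod bs = prod_list (map (fst \<circ> fst) bs)"

text \<open>Parsing onto a stack reverses the order of the blocks. The cardinalities decrease in the
  input, so the smallest sets end up on top without any sorting.\<close>

definition stored :: "(block \<times> nat) list \<Rightarrow> block list" where
  "stored bs = rev (map (\<lambda>b. (fst (fst b), rev (snd (fst b)))) bs)"

lemma runs_parse:
  assumes "idle \<sigma>" "\<sigma> 9 = binary 1" "\<sigma> 10 = binary 1" "\<sigma> 11 = []" "\<sigma> 20 = []"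
    "\<sigma> 0 = concat (map ienc bs)"
    "\<And>m as k. ((m, as), k) \<in> set bs \<Longrightarrow> m \<ge> 1 \<and> blen k \<le> n \<and> (\<forall>a\<in>set as. blen a \<le> n)"
    "blen (modulus_prod bs) + 2 \<le> n"
  shows "runs parse \<sigma> ((\<Sum>i<length bs. (length (snd (fst (bs ! i))) + 1) * (402 * (n + 1)\<^sup>2)) + 1)
    (\<sigma>(0 := [], 10 := binary (modulus_prod bs), 20 := concat (map benc (stored bs))))"
proof -
  define S where "S i = \<sigma>(0 := concat (map ienc (drop i bs)), 10 := binary (modulus_prod (take i bs)),
    20 := concat (map benc (stored (take i bs))))" for i
  let ?t = "\<lambda>i. (length (snd (fst (bs ! i))) + 1) * (402 * (n + 1)\<^sup>2) - 2"
  have pos: "modulus_prod bs \<ge> 1" if "\<forall>b\<in>set bs. fst (fst b) \<ge> 1" for bs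
    using that by (induction bs) (auto simp: modulus_prod_def Suc_le_eq)
  have pos_bs: "\<forall>b\<in>set bs. fst (fst b) \<ge> 1" using assms(7) by fastforce
  have "runs parse (S 0) ((\<Sum>i<length bs. ?t i + 2) + 1) (S (length bs))"
    unfolding parse_def
  proof (rule runs_While_iter[where S = S and t = ?t])
    fix i assume i: "i < length bs"
    obtain m as k where b: "bs ! i = ((m, as), k)" by (metis surj_pair)
    have d: "drop i bs = ((m, as), k) # drop (Suc i) bs" using i b by (simp flip: Cons_nth_drop_Suc)
    have t: "take (Suc i) bs = take i bs @ [((m, as), k)]" using i b by (simp add: take_Suc_conv_app_nth)
    have mem: "((m, as), k) \<in> set bs" using i b nth_mem by metis
    let ?P = "modulus_prod (take i bs)"
    have P: "modulus_prod (take (Suc i) bs) = m * ?P" by (simp add: t modulus_prod_def)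
    have "modulus_prod bs = modulus_prod (take (Suc i) bs) * modulus_prod (drop (Suc i) bs)"
      unfolding modulus_prod_def by (metis append_take_drop_id map_append prod_list.append)
    moreover have "modulus_prod (drop (Suc i) bs) \<ge> 1" using pos_bs by (intro pos) (meson in_set_dropD)
    ultimately have "m * ?P \<le> modulus_prod bs" unfolding P by simp
    then have len: "blen (m * ?P) + 2 \<le> n" using blen_mono assms(8) by (meson add_le_mono1 le_trans)
    have P1: "?P \<ge> 1" using pos_bs by (intro pos) (meson in_set_takeD)
    have "runs parse_block (S i) ((length as + 1) * (400 * (n + 1)\<^sup>2))
      ((S i)(0 := concat (map ienc (drop (Suc i) bs)), 10 := binary (m * ?P), 20 := benc (m, rev as) @ S i 20))"
      using assms(1-6) assms(7)[OF mem] len P1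
      by (intro runs_parse_block) (auto simp: S_def d ienc_def)
    moreover have "(S i)(0 := concat (map ienc (drop (Suc i) bs)), 10 := binary (m * ?P), 20 := benc (m, rev as) @ S i 20) = S (Suc i)"
      by (auto simp: S_def P fun_eq_iff) (simp add: t stored_def)
    moreover have "(length as + 1) * (400 * (n + 1)\<^sup>2) + 2 \<le> (length as + 1) * (402 * (n + 1)\<^sup>2)"
      using cost_slack[of "length as" 400 n] by simp
    ultimately show "runs parse_block (S i) (?t i) (S (Suc i))"
      unfolding b by (elim runs_weaken) simp_all
    have "hd (binary m @ 3 # ys) \<noteq> 0" for ys
      using set_binary[of m] by (cases "binary m") auto
    with d show "tops (S i) 0 \<noteq> 0"
      by (simp add: tops_def S_def ienc_def)
  qed (simp_all add: tops_def S_def)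
  note loop = this
  have S0: "S 0 = \<sigma>" using assms by (auto simp: S_def fun_eq_iff modulus_prod_def stored_def)
  have t: "?t i + 2 = (length (snd (fst (bs ! i))) + 1) * (402 * (n + 1)\<^sup>2)" for i
    by (simp add: power2_eq_square)
  show ?thesis
    by (rule runs_weaken[OF loop[unfolded S0 t]]) (simp_all add: S_def)
qed

section \<open>Output and the complete program\<close>

definition write_output :: com where
  "write_output = While (\<lambda>\<tau>. \<tau> 21 \<noteq> 0)
     (pop_number 21 24;; While (\<lambda>\<tau>. digit (\<tau> 24)) (Out (\<lambda>\<tau>. \<tau> 24);; Pop 24);; Out (\<lambda>_. 3))"

lemma runs_write_output:
  assumes "\<sigma> 21 = rlist xs" "\<sigma> 24 = []" "\<And>x. x \<in> set xs \<Longrightarrow> blen x \<le> n"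
  shows "runs write_output \<sigma> (length xs * (10 * (n + 1)) + 1) (\<sigma>(21 := [], 1 := \<sigma> 1 @ encode_list xs))"
proof -
  define S where "S i = \<sigma>(21 := rlist (drop i xs), 1 := \<sigma> 1 @ encode_list (take i xs))" for i
  let ?inner = "While (\<lambda>\<tau>. digit (\<tau> 24)) (Out (\<lambda>\<tau>. \<tau> 24);; Pop 24)"
  let ?body = "pop_number 21 24;; ?inner;; Out (\<lambda>_. 3)"
  have "runs write_output (S 0) ((\<Sum>i<length xs. (10 * n + 6) + 2) + 1) (S (length xs))"
    unfolding write_output_def
  proof (rule runs_While_iter[where S = S and t = "\<lambda>_. 10 * n + 6"])
    fix i assume i: "i < length xs"
    define x where "x = xs ! i"
    have x: "drop i xs = x # drop (Suc i) xs" "take (Suc i) xs = take i xs @ [x]" "blen x \<le> n"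
      using i assms(3) by (simp_all add: x_def Cons_nth_drop_Suc take_Suc_conv_app_nth)
    show "tops (S i) 21 \<noteq> 0"
      using x(1) hd_renc[of x] by (simp add: tops_def S_def)
    let ?s1 = "(S i)(21 := rlist (drop (Suc i) xs), 24 := binary x)"
    let ?s2 = "?s1(24 := [], 1 := S i 1 @ binary x)"
    have 1: "runs (pop_number 21 24) (S i) (5 * n + 2) ?s1"
      using x assms(2) by (intro runs_pop_number) (auto simp: S_def)
    define R where "R j = ?s1(24 := drop j (binary x), 1 := S i 1 @ take j (binary x))" for j
    have "runs ?inner (R 0) ((\<Sum>j<blen x. 2 + 2) + 1) (R (blen x))"
    proof (rule runs_While_iter[where S = R and t = "\<lambda>_. 2"])
      fix j assume j: "j < blen x"
      define s where "s = binary x ! j"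
      have s: "drop j (binary x) = s # drop (Suc j) (binary x)" "take (Suc j) (binary x) = take j (binary x) @ [s]"
        using j by (simp_all add: s_def Cons_nth_drop_Suc take_Suc_conv_app_nth)
      have "s \<in> set (binary x)" using j by (simp add: s_def)
      then have d: "s \<in> {1, 2}" using set_binary[of x] by blast
      have t: "tops (R j) 24 = s" using s(1) by (simp add: tops_def R_def)
      then show "digit (tops (R j) 24)" using d by (auto simp: digit_def)
      let ?r1 = "(R j)(1 := R j 1 @ [s])"
      have "runs (Out (\<lambda>\<tau>. \<tau> 24)) (R j) 1 ?r1" using t d by (intro runs_Out) auto
      moreover have "runs (Pop 24) ?r1 1 (?r1(24 := tl (?r1 24)))" by (rule runs_Pop)
      ultimately have "runs (Out (\<lambda>\<tau>. \<tau> 24);; Pop 24) (R j) (1 + 1) (?r1(24 := tl (?r1 24)))"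
        by (rule runs_Seq)
      moreover have "?r1(24 := tl (?r1 24)) = R (Suc j)"
        using s by (auto simp: R_def fun_eq_iff)
      ultimately show "runs (Out (\<lambda>\<tau>. \<tau> 24);; Pop 24) (R j) 2 (R (Suc j))" by (elim runs_weaken) simp_all
    qed (simp_all add: tops_def R_def)
    note inner = this
    have R: "R 0 = ?s1" "R (blen x) = ?s2" by (auto simp: R_def S_def fun_eq_iff)
    have 2: "runs ?inner ?s1 (4 * n + 1) ?s2"
      by (rule runs_weaken[OF inner[unfolded R] refl]) (use x(3) in simp)
    have 3: "runs (Out (\<lambda>_. 3)) ?s2 1 (?s2(1 := ?s2 1 @ [3]))" by (rule runs_Out) auto
    have "?s2(1 := ?s2 1 @ [3]) = S (Suc i)"
      using assms(2) by (auto simp: S_def x(2) fun_eq_iff)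
    moreover from 1 2 3 have "runs ?body (S i) (5 * n + 2 + (4 * n + 1 + 1)) (?s2(1 := ?s2 1 @ [3]))"
      by (intro runs_Seq)
    ultimately show "runs ?body (S i) (10 * n + 6) (S (Suc i))" by (elim runs_weaken) auto
  qed (simp_all add: tops_def S_def)
  note loop = this
  have S0: "S 0 = \<sigma>" using assms by (auto simp: S_def fun_eq_iff)
  show ?thesis
    by (rule runs_weaken[OF loop[unfolded S0]]) (simp_all add: S_def)
qed

text \<open>The symbol 2 alone is the number 1: the empty product on stack 10 and the constant on
  stack 9. The symbol 3 on stack 21 is the list with the single entry 0, the empty sum.\<close>

definition program :: com where
  "program = Push 10 (\<lambda>_. 2);; Push 9 (\<lambda>_. 2);; parse;; Push 21 (\<lambda>_. 3);; combine;; write_output"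

lemma stacks_ok_program: "stacks_ok 26 program"
  by (simp add: program_def parse_def parse_block_def combine_def process_block_def write_output_def
      lift_all_def lift_residue_def translate_def euclid_def divide_def while_less_def if_less_def less_def
      add_def sub_def arith_def finish_def strip_def ripple_def double_def copy_def move_def clear_def
      pop_number_def push_number_def move_all_def clear_all_def transfer_def)

text \<open>For empty code the final program counter would be 0, which is the start state and not
  the halting one.\<close>

lemma clen_program: "clen program > 0"
  by (simp add: program_def)

lemma runs_program:
  fixes bs
  defines "M \<equiv> modulus_prod bs"
  defines "L \<equiv> \<lambda>i. fold (block_step M) (take i (stored bs)) [0]"
  assumes "\<And>m as k. ((m, as), k) \<in> set bs \<Longrightarrow> m \<ge> 1 \<and> k \<le> m \<and> (\<forall>a\<in>set as. a < m) \<and> m dvd M \<and> coprime (M div m) m"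
    and "M \<ge> 1" "n = 2 * blen M + 2"
  shows "\<exists>\<sigma>'. runs program ((\<lambda>_. [])(0 := concat (map ienc bs)))
      ((\<Sum>i<length bs. (length (snd (fst (bs ! i))) + 1) * (402 * (n + 1)\<^sup>2)) +
       (\<Sum>i<length bs. block_cost n (length (snd (stored bs ! i))) (length (L i)) (length (L (Suc i)))) +
       length (L (length bs)) * (10 * (n + 1)) + 9) \<sigma>' \<and>
    \<sigma>' 1 = encode_list (L (length bs))"
proof -
  let ?s0 = "(\<lambda>_. [])(0 := concat (map ienc bs)) :: store"
  let ?s1 = "?s0(10 := 2 # ?s0 10)"
  let ?s2 = "?s1(9 := 2 # ?s1 9)"
  let ?s3 = "?s2(0 := [], 10 := binary M, 20 := concat (map benc (stored bs)))"
  let ?s4 = "?s3(21 := 3 # ?s3 21)"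
  let ?s5 = "?s4(20 := [], 21 := rlist (L (length (stored bs))))"
  let ?s6 = "?s5(21 := [], 1 := ?s5 1 @ encode_list (L (length (stored bs))))"
  have len: "blen k + 2 \<le> n" if "k \<le> M" for k using blen_mono[OF that] assms(5) by linarith
  have [simp]: "length (stored bs) = length bs" by (simp add: stored_def)
  have 1: "runs (Push 10 (\<lambda>_. 2)) ?s0 2 ?s1" by (rule runs_Push) auto
  have 2: "runs (Push 9 (\<lambda>_. 2)) ?s1 2 ?s2" by (rule runs_Push) auto
  have "m \<ge> 1 \<and> blen k \<le> n \<and> (\<forall>a\<in>set as. blen a \<le> n)" if "((m, as), k) \<in> set bs" for m as k
  proof -
    have "m \<le> M" using assms(3)[OF that] assms(4) by (auto intro: dvd_imp_le)
    then have "k \<le> M" "\<And>a. a \<in> set as \<Longrightarrow> a \<le> M" using assms(3)[OF that] by auto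
    then show ?thesis using len assms(3)[OF that] by (meson add_leD1)
  qed
  then have 3: "runs parse ?s2 ((\<Sum>i<length bs. (length (snd (fst (bs ! i))) + 1) * (402 * (n + 1)\<^sup>2)) + 1) ?s3"
    unfolding M_def using len[of M] unfolding M_def
    by (intro runs_parse) (auto simp: idle_def)
  have 4: "runs (Push 21 (\<lambda>_. 3)) ?s3 2 ?s4" by (rule runs_Push) auto
  have st: "m dvd M \<and> coprime (M div m) m \<and> (\<forall>a\<in>set as. a < m)" if "(m, as) \<in> set (stored bs)" for m as
    using that assms(3) by (fastforce simp: stored_def)
  have 5: "runs combine ?s4 ((\<Sum>i<length (stored bs). block_cost n (length (snd (stored bs ! i))) (length (L i)) (length (L (Suc i)))) + 1) ?s5"
    unfolding L_def using st assms(4,5)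
    by (intro runs_combine) (auto simp: idle_def renc_def)
  have LM: "x < M" if "x \<in> set (L i)" for x i
    using that
  proof (cases "take i (stored bs) = []")
    case True
    have "L i = [0]" unfolding L_def True by simp
    then show ?thesis using that assms(4) by simp
  next
    case False
    then obtain b ys where "take i (stored bs) = ys @ [b]" by (metis rev_exhaust)
    then show ?thesis using that assms(4) by (auto simp: L_def block_step_def all_sums_def)
  qed
  have "blen x \<le> n" if "x \<in> set (L i)" for x i
    using len[OF less_imp_le[OF LM[OF that]]] by simp
  then have 6: "runs write_output ?s5 (length (L (length (stored bs))) * (10 * (n + 1)) + 1) ?s6"
    by (intro runs_write_output) auto
  from 1 2 3 4 5 6 have "runs program ?s0
    (2 + (2 + ((\<Sum>i<length bs. (length (snd (fst (bs ! i))) + 1) * (402 * (n + 1)\<^sup>2)) + 1 + (2 +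
     ((\<Sum>i<length (stored bs). block_cost n (length (snd (stored bs ! i))) (length (L i)) (length (L (Suc i)))) + 1 +
      (length (L (length (stored bs))) * (10 * (n + 1)) + 1)))))) ?s6"
    unfolding program_def by (intro runs_Seq)
  then have "runs program ?s0 ((\<Sum>i<length bs. (length (snd (fst (bs ! i))) + 1) * (402 * (n + 1)\<^sup>2)) +
       (\<Sum>i<length bs. block_cost n (length (snd (stored bs ! i))) (length (L i)) (length (L (Suc i)))) +
       length (L (length bs)) * (10 * (n + 1)) + 9) ?s6"
    by (rule runs_weaken) simp_all
  then show ?thesis by (intro exI[of _ ?s6]) simp
qed

section \<open>Correctness and running time\<close>

lemma all_sums_product:
  "all_sums M m as xs = map (\<lambda>(a, x). (x + lift (M div m) m a) mod M) (List.product as xs)"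
  by (induction as) (simp_all add: all_sums_def comp_def)

lemma coprime_cofactor:
  fixes m :: "'i \<Rightarrow> nat"
  assumes "finite I" "pairwise (\<lambda>i j. coprime (m i) (m j)) I" "i \<in> I" "m i \<ge> 1"
  shows "(\<Prod>i\<in>I. m i) div m i = (\<Prod>k\<in>I - {i}. m k)" "coprime ((\<Prod>i\<in>I. m i) div m i) (m i)"
proof -
  have "(\<Prod>i\<in>I. m i) = m i * (\<Prod>k\<in>I - {i}. m k)" using assms by (simp add: prod.remove)
  then show 1: "(\<Prod>i\<in>I. m i) div m i = (\<Prod>k\<in>I - {i}. m k)" using assms(4) by simp
  show "coprime ((\<Prod>i\<in>I. m i) div m i) (m i)"
    unfolding 1 using assms(2,3) by (intro prod_coprime_left) (auto simp: pairwise_def)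
qed

text \<open>
  The residues modulo \<open>M\<close> that lie in \<open>A i\<close> modulo \<open>m i\<close> for the indices in \<open>J\<close>, which have been
  processed, and are 0 modulo the other moduli.
\<close>

definition partial_set :: "'i set \<Rightarrow> ('i \<Rightarrow> nat) \<Rightarrow> ('i \<Rightarrow> nat set) \<Rightarrow> 'i set \<Rightarrow> nat set" where
  "partial_set I m A J = {x. x < (\<Prod>i\<in>I. m i) \<and> (\<forall>i\<in>J. x mod m i \<in> A i) \<and> (\<forall>i\<in>I - J. m i dvd x)}"

text \<open>Adding the lift of \<open>a\<close> changes only the residue modulo \<open>m i\<close>,
  from 0 to \<open>a\<close>. Therefore \<open>a\<close> can be read off from the sum modulo
  \<open>m i\<close>, and \<open>x\<close> follows by cancelling the lift modulo \<open>M\<close>;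
  this gives injectivity. Subtracting the lift of \<open>z mod m i\<close> from \<open>z\<close>
  gives surjectivity.\<close>

lemma block_step_partial_set:
  fixes m :: "'i \<Rightarrow> nat"
  assumes "finite I" "pairwise (\<lambda>i j. coprime (m i) (m j)) I" "i \<in> I" "\<forall>i\<in>I. m i \<ge> 1"
    "J \<subseteq> I" "i \<notin> J" "distinct xs" "set xs = partial_set I m A J"
    "distinct as" "set as = A i" "A i \<subseteq> {..<m i}"
  defines "M \<equiv> \<Prod>i\<in>I. m i"
  shows "distinct (block_step M (m i, as) xs)"
    "set (block_step M (m i, as) xs) = partial_set I m A (insert i J)"
proof -
  let ?e = "lift (M div m i) (m i)"
  let ?f = "\<lambda>a x. (x + ?e a) mod M"
  have M: "M \<ge> 1" unfolding M_def by (rule prod_ge_1) (use assms(4) in blast)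
  have dvdM: "m k dvd M" if "k \<in> I" for k using that assms(1) by (auto simp: M_def intro: dvd_prodI)
  have Mi: "M div m i * m i = M" using dvdM[OF assms(3)] by simp
  have e: "?e a < M" "[?e a = a] (mod m i)" "M div m i dvd ?e a" for a
    using lift[of "M div m i" "m i" a] coprime_cofactor(2)[OF assms(1-3)] assms(3,4) M Mi
    unfolding M_def by auto
  have e0: "[?e a = 0] (mod m k)" if "k \<in> I" "k \<noteq> i" for k a
  proof -
    have "m k dvd (\<Prod>k\<in>I - {i}. m k)" using that assms(1) by (intro dvd_prodI) auto
    also have "\<dots> = M div m i" using coprime_cofactor(1)[OF assms(1-3)] assms(3,4) by (simp add: M_def)
    also have "\<dots> dvd ?e a" by (rule e(3))
    finally show ?thesis by (simp add: cong_0_iff)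
  qed
  have f: "[?f a x = x + ?e a] (mod m k)" if "k \<in> I" for a x k
    using dvdM[OF that] by (simp add: cong_def mod_mod_cancel)
  have f_other: "[?f a x = x] (mod m k)" if "k \<in> I" "k \<noteq> i" for a x k
    using cong_trans[OF f[OF that(1)] cong_add[OF cong_refl e0[OF that]]] by simp
  have f_i: "[?f a x = a] (mod m i)" if "m i dvd x" for a x
    using cong_trans[OF f[OF assms(3)] cong_add[of x 0 "m i" "?e a" a]] that e(2) by (simp add: cong_0_iff)
  have f_i': "?f a x mod m i = a" if "a \<in> A i" "m i dvd x" for a x
    using f_i[OF that(2), of a] that(1) assms(11) by (auto simp: cong_def)
  have xs: "x < M" "m i dvd x" if "x \<in> set xs" for x
    using that assms(3,6,8) by (auto simp: partial_set_def M_def)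
  have inj: "inj_on (\<lambda>(a, x). ?f a x) (set as \<times> set xs)"
  proof (rule inj_onI, clarify)
    fix a x b y assume *: "a \<in> set as" "x \<in> set xs" "b \<in> set as" "y \<in> set xs" "?f a x = ?f b y"
    then have "a = b" using f_i'[of a x] f_i'[of b y] xs assms(10) by auto
    with * have "[x + ?e a = y + ?e a] (mod M)" by (simp add: cong_def)
    then have "[x = y] (mod M)" by (simp add: cong_add_rcancel_nat)
    then have "x = y" using xs * by (simp add: cong_def)
    with \<open>a = b\<close> show "a = b \<and> x = y" by simp
  qed
  then show "distinct (block_step M (m i, as) xs)"
    using assms(7,9) by (auto simp: block_step_def all_sums_product distinct_map intro: distinct_product)
  have "set (block_step M (m i, as) xs) = (\<lambda>(a, x). ?f a x) ` (set as \<times> set xs)"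
    by (simp add: block_step_def all_sums_product)
  also have "\<dots> = partial_set I m A (insert i J)"
  proof (intro equalityI subsetI)
    fix z assume "z \<in> (\<lambda>(a, x). ?f a x) ` (set as \<times> set xs)"
    then obtain a x where z: "z = ?f a x" "a \<in> A i" "x \<in> set xs" using assms(10) by auto
    have "z mod m k = x mod m k" if "k \<in> I" "k \<noteq> i" for k
      using f_other[OF that] z(1) by (simp add: cong_def)
    moreover have "z mod m i = a" using f_i' z xs by simp
    moreover have "z < M" using z M by simp
    ultimately show "z \<in> partial_set I m A (insert i J)"
      using z(2,3) assms(5,6,8) by (fastforce simp: partial_set_def M_def dvd_eq_mod_eq_0)
  next
    fix z assume z: "z \<in> partial_set I m A (insert i J)"
    define a where "a = z mod m i"
    \<comment> \<open>This is \<open>z\<close> minus the lift modulo \<open>M\<close>, written so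
      that the subtraction on naturals is exact, the lift being less than \<open>M\<close>.\<close>
    define x where "x = (z + (M - ?e a)) mod M"
    have zM: "z < M" and a: "a \<in> A i" using z by (auto simp: partial_set_def a_def M_def)
    have "?f a x = (z + (M - ?e a) + ?e a) mod M" by (simp add: x_def mod_add_left_eq)
    also have "\<dots> = z" using zM e(1)[of a] by simp
    finally have fz: "?f a x = z" .
    have xz: "x mod m k = z mod m k" if "k \<in> I" "k \<noteq> i" for k
      using f_other[OF that, of x a] fz by (simp add: cong_def)
    have mi: "m i dvd x"
    proof -
      have "[x + ?e a = 0 + ?e a] (mod m i)"
        using f[OF assms(3), of x a] e(2)[of a] unfolding fz by (simp add: a_def cong_def)
      then have "[x = 0] (mod m i)" by (simp only: cong_add_rcancel_nat)
      then show ?thesis by (simp add: cong_0_iff)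
    qed
    have "x mod m k \<in> A k" if "k \<in> J" for k
    proof -
      have "k \<in> I" "k \<noteq> i" using that assms(5,6) by auto
      then show ?thesis using xz[of k] z that by (simp add: partial_set_def)
    qed
    moreover have "m k dvd x" if "k \<in> I - J" for k
    proof (cases "k = i")
      case False
      then have "m k dvd z" using z that by (simp add: partial_set_def)
      then show ?thesis using xz[of k] that False by (simp add: dvd_eq_mod_eq_0)
    qed (use mi in simp)
    moreover have "x < M" using M by (simp add: x_def)
    ultimately have "x \<in> set xs"
      unfolding assms(8) partial_set_def M_def[symmetric] by blast
    with a fz show "z \<in> (\<lambda>(a, x). ?f a x) ` (set as \<times> set xs)"
      using assms(10) by force
  qed
  finally show "set (block_step M (m i, as) xs) = partial_set I m A (insert i J)" .
qed

text \<open>Uniqueness in the Chinese remainder theorem: only 0 is below \<open>M\<close> and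
  divisible by all moduli. It justifies the initial list.\<close>

lemma partial_set_empty:
  assumes "finite I" "pairwise (\<lambda>i j. coprime (m i) (m j)) I" "\<forall>i\<in>I. m i \<ge> 1"
  shows "partial_set I m A {} = {0}"
proof -
  have "x = 0" if "x < (\<Prod>i\<in>I. m i)" "\<forall>i\<in>I. m i dvd x" for x
  proof -
    have "[x = 0] (mod (\<Prod>i\<in>I. m i))"
      using that(2) assms(1,2) by (intro coprime_cong_prod_nat) (auto simp: cong_0_iff pairwise_def)
    then show ?thesis using that(1) by (simp add: cong_def)
  qed
  moreover have "(\<Prod>i\<in>I. m i) \<ge> 1" by (rule prod_ge_1) (use assms(3) in blast)
  ultimately show ?thesis by (auto simp: partial_set_def)
qed

text \<open>The elements of \<open>A i\<close> are reduced residues, so a witness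
  \<open>\<alpha> i\<close> can only be \<open>x mod m i\<close>.\<close>

lemma crt_set_eq_partial_set:
  assumes "\<forall>i\<in>{1..d}. A i \<subseteq> residue_classes (m i)"
  shows "crt_set d m A = partial_set {1..d} m A {1..d}"
proof -
  have "(\<exists>\<alpha>. (\<forall>i\<in>{1..d}. \<alpha> i \<in> A i) \<and> (\<forall>i\<in>{1..d}. [x = \<alpha> i] (mod m i))) \<longleftrightarrow> (\<forall>i\<in>{1..d}. x mod m i \<in> A i)" for x
  proof
    assume "\<exists>\<alpha>. (\<forall>i\<in>{1..d}. \<alpha> i \<in> A i) \<and> (\<forall>i\<in>{1..d}. [x = \<alpha> i] (mod m i))"
    then obtain \<alpha> where \<alpha>: "\<forall>i\<in>{1..d}. \<alpha> i \<in> A i" "\<forall>i\<in>{1..d}. [x = \<alpha> i] (mod m i)" by blast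
    show "\<forall>i\<in>{1..d}. x mod m i \<in> A i"
    proof
      fix i assume i: "i \<in> {1..d}"
      then have "\<alpha> i \<in> A i" "A i \<subseteq> {..<m i}" using \<alpha>(1) assms by (simp_all add: residue_classes_def)
      then have "\<alpha> i < m i" by blast
      then have "x mod m i = \<alpha> i" using \<alpha> i by (simp add: cong_def)
      with \<alpha> i show "x mod m i \<in> A i" by simp
    qed
  next
    assume "\<forall>i\<in>{1..d}. x mod m i \<in> A i"
    then show "\<exists>\<alpha>. (\<forall>i\<in>{1..d}. \<alpha> i \<in> A i) \<and> (\<forall>i\<in>{1..d}. [x = \<alpha> i] (mod m i))"
      by (intro exI[of _ "\<lambda>i. x mod m i"]) (simp add: cong_def)
  qed
  then show ?thesis by (auto simp: crt_set_def partial_set_def residue_classes_def)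
qed

text \<open>While all factors seen so far are 1, each partial product is 1; from then on they at least double.\<close>

lemma sum_partial_products:
  fixes k l :: "nat \<Rightarrow> nat"
  assumes "l 0 = 1" "\<And>j. j < n \<Longrightarrow> l (Suc j) = k j * l j" "\<And>j. j < n \<Longrightarrow> k j \<ge> 1"
    "\<And>i j. i \<le> j \<Longrightarrow> j < n \<Longrightarrow> k i \<le> k j"
  shows "(\<Sum>j\<le>n. l j) \<le> 2 * l n + n"
  using assms
proof (induction n)
  case (Suc n)
  have IH: "(\<Sum>j\<le>n. l j) \<le> 2 * l n + n" using Suc.prems by (intro Suc.IH) auto
  show ?case
  proof (cases "k n \<ge> 2")
    case True
    then have "2 * l n \<le> l (Suc n)" using Suc.prems(2)[of n] by simp
    with IH show ?thesis by simp
  next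
    case False
    have "k j = 1" if "j \<le> n" for j
      using Suc.prems(3)[of j] Suc.prems(4)[of j n] that False by linarith
    then have "l j = 1" if "j \<le> Suc n" for j
      using that by (induction j) (simp_all add: Suc.prems(1,2))
    then show ?thesis by simp
  qed
qed simp

text \<open>From \<open>ln 2 \<ge> 1 / 2\<close> follows \<open>blen M - 1 \<le> 2 * ln M\<close>,
  so the left side is at most \<open>4 * ln M + 5\<close>; as \<open>ln M \<ge> 1 / 2\<close>, the 5
  is at most \<open>10 * ln M\<close>.\<close>

lemma blen_le_ln:
  assumes "M \<ge> 2"
  shows "real (2 * blen M + 3) \<le> 14 * ln (real M)"
proof -
  have ln2: "ln (2::real) \<ge> 1 / 2" using ln_le_minus_one[of "1 / 2"] by (simp add: ln_div)
  have "2 ^ (blen M - 1) \<le> M" using power_blen_le[of M] assms by simp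
  then have "real (2 ^ (blen M - 1)) \<le> real M" by (simp only: of_nat_le_iff)
  then have "2 ^ (blen M - 1) \<le> real M" by simp
  then have "ln (2 ^ (blen M - 1)) \<le> ln (real M)" using assms by (subst ln_le_cancel_iff) auto
  then have "real (blen M - 1) * ln 2 \<le> ln (real M)" by (simp add: ln_realpow)
  moreover have "real (blen M - 1) * (1 / 2) \<le> real (blen M - 1) * ln 2"
    using ln2 by (intro mult_left_mono) auto
  moreover have "ln (real M) \<ge> ln 2" using assms by simp
  ultimately show ?thesis using ln2 by (cases "blen M") auto
qed

lemma set_encode_list: "set (encode_list xs) \<subseteq> {1..4}"
  using set_binary by (induction xs) fastforce+

text \<open>The time bound assumes a nonempty CRT set: then all \<open>\<kappa> i\<close> are
  positive, so \<open>d \<le> K\<close> and the overheads of the blocks are covered by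
  \<open>K\<close>.\<close>

lemma program_correct:
  fixes d :: nat and m \<kappa> :: "nat \<Rightarrow> nat" and A :: "nat \<Rightarrow> nat set"
  assumes m: "\<forall>i\<in>{1..d}. m i \<ge> 1" and cop: "pairwise (\<lambda>i j. coprime (m i) (m j)) {1..d}"
    and A: "\<forall>i\<in>{1..d}. A i \<subseteq> residue_classes (m i)" and \<kappa>: "\<forall>i\<in>{1..d}. \<kappa> i = card (A i)"
    and mono: "\<forall>i\<in>{1..d}. \<forall>j\<in>{1..d}. i \<le> j \<longrightarrow> \<kappa> i \<ge> \<kappa> j"
    and w: "encodes_instance w d m A \<kappa>"
  defines "M \<equiv> \<Prod>i=1..d. m i" and "N \<equiv> card (crt_set d m A)" and "K \<equiv> \<Sum>i=1..d. \<kappa> i"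
  shows "\<exists>xs t \<sigma>'. set w \<subseteq> {1..4} \<and> lists_set xs (crt_set d m A) \<and>
    exec program ((\<lambda>_. [])(0 := w)) t \<sigma>' \<and> \<sigma>' 1 = encode_list xs \<and>
    (N \<ge> 1 \<longrightarrow> t \<le> 6000 * K * (2 * blen M + 3)\<^sup>2 + 1000 * (N + K) * (2 * blen M + 3))"
proof -
  obtain as where as: "\<forall>i\<in>{1..d}. lists_set (as i) (A i)"
    "w = concat (map (\<lambda>i. encode_list (m i # \<kappa> i # as i) @ [4]) [1..<Suc d])"
    using w by (auto simp: encodes_instance_def)
  define bs where "bs = map (\<lambda>i. ((m i, as i), \<kappa> i)) [1..<Suc d]"
  define L where "L j = fold (block_step M) (take j (stored bs)) [0]" for j
  let ?I = "{1..d}"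
  have len_bs: "length bs = d" by (simp add: bs_def)
  have w_bs: "w = concat (map ienc bs)" by (simp add: as(2) bs_def ienc_def comp_def)
  have "(\<Prod>i\<in>set [1..<Suc d]. m i) = prod_list (map m [1..<Suc d])"
    by (rule prod.distinct_set_conv_list) simp
  then have "prod_list (map m [1..<Suc d]) = M"
    unfolding M_def by (simp only: set_upt atLeastLessThanSuc_atLeastAtMost)
  then have M_bs: "modulus_prod bs = M"
    by (simp add: modulus_prod_def bs_def comp_def del: upt_Suc)
  have M1: "M \<ge> 1" unfolding M_def by (rule prod_ge_1) (use m in blast)
  have as': "distinct (as i)" "set (as i) = A i" "length (as i) = \<kappa> i" "A i \<subseteq> {..<m i}" "\<kappa> i \<le> m i"
    if "i \<in> ?I" for i
  proof -
    show 1: "distinct (as i)" "set (as i) = A i" using as(1) that by (auto simp: lists_set_def)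
    show "length (as i) = \<kappa> i" using \<kappa> that distinct_card[OF 1(1)] 1(2) by simp
    show 2: "A i \<subseteq> {..<m i}" using A that by (simp add: residue_classes_def)
    show "\<kappa> i \<le> m i" using \<kappa> that card_mono[OF _ 2] by simp
  qed
  have stored: "stored bs ! j = (m (d - j), rev (as (d - j)))" if "j < d" for j
    using that by (simp add: stored_def bs_def rev_nth Suc_diff_Suc del: upt_Suc)
  have len_stored: "length (stored bs) = d" by (simp add: stored_def len_bs)
  have L_Suc: "L (Suc j) = block_step M (m (d - j), rev (as (d - j))) (L j)" if "j < d" for j
    using that stored[OF that] by (simp add: L_def take_Suc_conv_app_nth len_stored)
  \<comment> \<open>After \<open>j\<close> blocks exactly the last \<open>j\<close> indices have
    been processed.\<close>
  have L_set: "distinct (L j) \<and> set (L j) = partial_set ?I m A {d - j<..d}" if "j \<le> d" for j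
    using that
  proof (induction j)
    case 0
    then show ?case using partial_set_empty[OF _ cop m, of A] by (simp add: L_def)
  next
    case (Suc j)
    then have i: "d - j \<in> ?I" by auto
    have "insert (d - j) {d - j<..d} = {d - Suc j<..d}" "{d - j<..d} \<subseteq> ?I" using Suc.prems by auto
    then show ?case
      using block_step_partial_set[of ?I m "d - j" "{d - j<..d}" "L j" A "rev (as (d - j))"]
        Suc i cop m as'[OF i] L_Suc[of j] unfolding M_def by auto
  qed
  have "{d - d<..d} = ?I" by auto
  then have result: "lists_set (L d) (crt_set d m A)"
    using L_set[of d] crt_set_eq_partial_set[OF A] by (simp add: lists_set_def)
  then have N: "length (L d) = N" using distinct_card[of "L d"] by (simp add: lists_set_def N_def)
  have len_L: "length (L (Suc j)) = \<kappa> (d - j) * length (L j)" if "j < d" for j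
    using that as'(3)[of "d - j"] by (simp add: L_Suc block_step_def length_all_sums)
  let ?n = "2 * blen M + 2"
  let ?t1 = "\<Sum>i<d. (length (snd (fst (bs ! i))) + 1) * (402 * (?n + 1)\<^sup>2)"
  let ?t2 = "\<Sum>i<d. block_cost ?n (length (snd (stored bs ! i))) (length (L i)) (length (L (Suc i)))"
  have "k \<ge> 1 \<and> c \<le> k \<and> (\<forall>a\<in>set ys. a < k) \<and> k dvd M \<and> coprime (M div k) k" if mem: "((k, ys), c) \<in> set bs" for k ys c
  proof -
    obtain i where "i \<in> set [1..<Suc d]" "((k, ys), c) = ((m i, as i), \<kappa> i)"
      using mem unfolding bs_def set_map by blast
    then have i: "i \<in> ?I" "k = m i" "ys = as i" "c = \<kappa> i"
      by (simp_all only: set_upt atLeastLessThanSuc_atLeastAtMost prod.inject)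
    have "m i dvd M" unfolding M_def using i(1) by (intro dvd_prodI) auto
    then show ?thesis
      using i as'[OF i(1)] m coprime_cofactor(2)[OF _ cop i(1)] by (auto simp: M_def)
  qed
  then obtain \<sigma>' where "runs program ((\<lambda>_. [])(0 := w)) (?t1 + ?t2 + N * (10 * (?n + 1)) + 9) \<sigma>'"
    "\<sigma>' 1 = encode_list (L d)"
    using runs_program[of bs ?n] M1 unfolding M_bs len_bs w_bs[symmetric] L_def[symmetric] N by blast
  then obtain t where t: "exec program ((\<lambda>_. [])(0 := w)) t \<sigma>'" "\<sigma>' 1 = encode_list (L d)"
    "t \<le> ?t1 + ?t2 + N * (10 * (?n + 1)) + 9" by (auto simp: runs_def)
  have "set w \<subseteq> {1..4}"
    using set_encode_list by (auto simp: as(2) simp del: encode_list_simps)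
  moreover have "t \<le> 6000 * K * (2 * blen M + 3)\<^sup>2 + 1000 * (N + K) * (2 * blen M + 3)" if "N \<ge> 1"
  proof -
    define P where "P = ?n + 1"
    \<comment> \<open>Downwards from \<open>j = d\<close>, where the length is \<open>N\<close>:
      each length divides the next one, so none is 0.\<close>
    have pos: "length (L j) \<ge> 1" if "j \<le> d" for j
      using that
    proof (induction rule: inc_induct)
      case base
      then show ?case using N \<open>N \<ge> 1\<close> by simp
    next
      case (step j)
      then show ?case using len_L[of j] by (cases "length (L j)") auto
    qed
    have \<kappa>1: "\<kappa> (d - j) \<ge> 1" if "j < d" for j
      using pos[of "Suc j"] len_L[of j] that by (cases "\<kappa> (d - j)") auto
    have reindex: "(\<Sum>j<d. f (d - j)) = (\<Sum>i=1..d. f i)" for f :: "nat \<Rightarrow> nat"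
      by (rule sum.reindex_bij_witness[of _ "\<lambda>i. d - i" "\<lambda>j. d - j"]) auto
    have sumK: "(\<Sum>j<d. \<kappa> (d - j) + 1) \<le> 2 * K" "d \<le> K"
    proof -
      have "(\<Sum>j<d. \<kappa> (d - j)) = K" unfolding K_def by (rule reindex)
      moreover have "(\<Sum>j<d. 1) \<le> (\<Sum>j<d. \<kappa> (d - j))" using \<kappa>1 by (intro sum_mono) auto
      moreover have "(\<Sum>j<d. \<kappa> (d - j) + 1) = (\<Sum>j<d. \<kappa> (d - j)) + (\<Sum>j<d. 1)"
        by (rule sum.distrib)
      moreover have "(\<Sum>j<d. 1) = d" by simp
      ultimately show "(\<Sum>j<d. \<kappa> (d - j) + 1) \<le> 2 * K" "d \<le> K" by linarith+
    qed
    have "?t1 = (\<Sum>i<d. \<kappa> (i + 1) + 1) * (402 * P\<^sup>2)"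
      unfolding sum_distrib_right P_def
      by (intro sum.cong refl) (use as'(3) in \<open>simp add: bs_def del: upt_Suc\<close>)
    also have "(\<Sum>i<d. \<kappa> (i + 1) + 1) = (\<Sum>j<d. \<kappa> (d - j) + 1)"
      by (rule sum.reindex_bij_witness[of _ "\<lambda>i. d - 1 - i" "\<lambda>j. d - 1 - j"]) auto
    finally have t1: "?t1 \<le> 2 * K * (402 * P\<^sup>2)" using sumK by (simp only: mult_le_mono1)
    \<comment> \<open>Read from the end, the cardinalities increase, as
      \<open>sum_partial_products\<close> requires; this is where the order of the blocks
      enters.\<close>
    have partial: "(\<Sum>j\<le>d. length (L j)) \<le> 2 * N + d"
      unfolding N[symmetric] using len_L \<kappa>1 mono
      by (intro sum_partial_products[of "\<lambda>j. length (L j)" d "\<lambda>j. \<kappa> (d - j)"]) (auto simp: L_def)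
    have "(\<Sum>i<d. length (L (Suc i)) + length (L i)) \<le> 2 * (\<Sum>j\<le>d. length (L j))"
    proof -
      have "(\<Sum>i<d. length (L i)) \<le> (\<Sum>j\<le>d. length (L j))" by (rule sum_mono2) auto
      moreover have "(\<Sum>i<d. length (L (Suc i))) \<le> (\<Sum>j\<le>d. length (L j))"
        by (simp add: sum.atMost_shift)
      ultimately show ?thesis by (simp add: sum.distrib)
    qed
    then have lengths: "(\<Sum>i<d. length (L (Suc i)) + length (L i)) \<le> 4 * N + 2 * K"
      using partial sumK by linarith
    have "?t2 = (\<Sum>j<d. (\<kappa> (d - j) + 1) * (2402 * P\<^sup>2) + (length (L (Suc j)) + length (L j)) * (180 * P))"
      unfolding P_def block_cost_def
      by (intro sum.cong refl) (use as'(3) stored in simp)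
    also have "\<dots> = (\<Sum>j<d. \<kappa> (d - j) + 1) * (2402 * P\<^sup>2) + (\<Sum>i<d. length (L (Suc i)) + length (L i)) * (180 * P)"
      by (simp only: sum.distrib[symmetric] sum_distrib_right)
    also have "\<dots> \<le> 2 * K * (2402 * P\<^sup>2) + (4 * N + 2 * K) * (180 * P)"
      using sumK lengths by (intro add_mono mult_le_mono1)
    finally have "t \<le> 2 * K * (402 * P\<^sup>2) + (2 * K * (2402 * P\<^sup>2) + (4 * N + 2 * K) * (180 * P)) + N * (10 * P) + 9"
      using t(3) t1 unfolding P_def by linarith
    moreover have "9 \<le> 9 * (N * P)" using \<open>N \<ge> 1\<close> by (simp add: P_def Suc_le_eq)
    moreover have "2 * K * (402 * P\<^sup>2) + (2 * K * (2402 * P\<^sup>2) + (4 * N + 2 * K) * (180 * P)) + N * (10 * P)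
        = 5608 * (K * P\<^sup>2) + 730 * (N * P) + 360 * (K * P)"
      by (simp add: algebra_simps)
    moreover have "6000 * K * P\<^sup>2 + 1000 * (N + K) * P = 6000 * (K * P\<^sup>2) + 1000 * (N * P) + 1000 * (K * P)"
      by (simp add: algebra_simps)
    ultimately have "t \<le> 6000 * K * P\<^sup>2 + 1000 * (N + K) * P" by linarith
    moreover have "P = 2 * blen M + 3" by (simp add: P_def)
    ultimately show ?thesis by (simp only:)
  qed
  ultimately show ?thesis using result t by blast
qed

theorem theorem4p1:
  "\<exists>(T :: turing_machine) (C :: real). wf_tm T \<and>
     (\<forall>(d :: nat) (m :: nat \<Rightarrow> nat) (A :: nat \<Rightarrow> nat set) (\<kappa> :: nat \<Rightarrow> nat) (w :: nat list).
        d \<ge> 1 \<and>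
        (\<forall>i\<in>{1..d}. m i \<ge> 1) \<and>
        pairwise (\<lambda>i j. coprime (m i) (m j)) {1..d} \<and>
        (\<forall>i\<in>{1..d}. A i \<subseteq> residue_classes (m i)) \<and>
        (\<forall>i\<in>{1..d}. \<kappa> i = card (A i)) \<and>
        (\<forall>i\<in>{1..d}. \<forall>j\<in>{1..d}. i \<le> j \<longrightarrow> \<kappa> i \<ge> \<kappa> j) \<and>
        encodes_instance w d m A \<kappa> \<longrightarrow>
        (\<exists>xs. lists_set xs (crt_set d m A) \<and> outputs T w (encode_list xs)) \<and>
        (let M = (\<Prod>i=1..d. m i); N = card (crt_set d m A) in
           real N \<ge> (\<Sum>i=1..d. real (\<kappa> i)) * ln (real M) \<and> real N * ln (real M) > 0 \<longrightarrow>
           real (runtime T w) \<le> C * (real N * ln (real M))))"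
proof (rule exI[of _ "machine 26 (compile program 0)"], rule exI[of _ 2000000], intro conjI allI impI)
  let ?T = "machine 26 (compile program 0)"
  \<comment> \<open>A generous choice: the estimate below ends with 1176000 + 14000 + 28000.\<close>
  let ?C = "2000000 :: real"
  have "compile program 0 \<noteq> []" using clen_program by (metis length_compile length_0_conv less_irrefl)
  then show "wf_tm ?T" by (intro wf_machine) auto
  fix d :: nat and m :: "nat \<Rightarrow> nat" and A :: "nat \<Rightarrow> nat set" and \<kappa> :: "nat \<Rightarrow> nat" and w :: "nat list"
  assume "d \<ge> 1 \<and>
        (\<forall>i\<in>{1..d}. m i \<ge> 1) \<and>
        pairwise (\<lambda>i j. coprime (m i) (m j)) {1..d} \<and>
        (\<forall>i\<in>{1..d}. A i \<subseteq> residue_classes (m i)) \<and>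
        (\<forall>i\<in>{1..d}. \<kappa> i = card (A i)) \<and>
        (\<forall>i\<in>{1..d}. \<forall>j\<in>{1..d}. i \<le> j \<longrightarrow> \<kappa> i \<ge> \<kappa> j) \<and>
        encodes_instance w d m A \<kappa>"
  then obtain xs t \<sigma>' where *: "set w \<subseteq> {1..4}" "lists_set xs (crt_set d m A)"
    "exec program ((\<lambda>_. [])(0 := w)) t \<sigma>'" "\<sigma>' 1 = encode_list xs"
    and t: "card (crt_set d m A) \<ge> 1 \<Longrightarrow> t \<le> 6000 * (\<Sum>i=1..d. \<kappa> i) * (2 * blen (\<Prod>i=1..d. m i) + 3)\<^sup>2
      + 1000 * (card (crt_set d m A) + (\<Sum>i=1..d. \<kappa> i)) * (2 * blen (\<Prod>i=1..d. m i) + 3)"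
    using program_correct[of d m A \<kappa> w] by blast
  have run: "outputs ?T w (encode_list xs)" "runtime ?T w \<le> t"
    using machine_exec[OF *(3) stacks_ok_program _ clen_program *(1)] *(4) by auto
  from *(2) run(1) show "\<exists>xs. lists_set xs (crt_set d m A) \<and> outputs ?T w (encode_list xs)" by blast
  show "let M = (\<Prod>i=1..d. m i); N = card (crt_set d m A) in
           real N \<ge> (\<Sum>i=1..d. real (\<kappa> i)) * ln (real M) \<and> real N * ln (real M) > 0 \<longrightarrow>
           real (runtime ?T w) \<le> ?C * (real N * ln (real M))"
    unfolding Let_def
  proof (intro impI, elim conjE)
    define M where "M = (\<Prod>i=1..d. m i)"
    define N where "N = card (crt_set d m A)"
    define K where "K = (\<Sum>i=1..d. \<kappa> i)"
    define l where "l = ln (real M)"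
    define P where "P = real (2 * blen M + 3)"
    assume "real (card (crt_set d m A)) \<ge> (\<Sum>i=1..d. real (\<kappa> i)) * ln (real (\<Prod>i=1..d. m i))"
      "real (card (crt_set d m A)) * ln (real (\<Prod>i=1..d. m i)) > 0"
    then have KN: "real K * l \<le> real N" and pos: "real N * l > 0"
      by (simp_all add: K_def N_def l_def M_def)
    then have N1: "N \<ge> 1" and "l > 0" by (auto simp: zero_less_mult_iff)
    then have "M \<ge> 2" unfolding l_def by (cases "M \<le> 1") (auto simp: le_Suc_eq)
    then have P: "P \<le> 14 * l" "P \<ge> 0" unfolding P_def l_def by (rule blen_le_ln) simp
    \<comment> \<open>The number 2 has two digits, so \<open>P \<ge> 2 * 2 + 3 = 7\<close>, and
      \<open>P \<le> 14 * l\<close> turns this into \<open>l \<ge> 1 / 2\<close>.\<close>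
    have "blen M \<ge> blen 2" using \<open>M \<ge> 2\<close> by (rule blen_mono)
    then have "P \<ge> 7" by (simp add: P_def binary.simps[of 2])
    then have l: "l \<ge> 1 / 2" using P by simp
    have "real t \<le> 6000 * real K * P\<^sup>2 + 1000 * (real N + real K) * P"
    proof -
      have "real t \<le> real (6000 * K * (2 * blen M + 3)\<^sup>2 + 1000 * (N + K) * (2 * blen M + 3))"
        using t N1 unfolding M_def[symmetric] N_def[symmetric] K_def[symmetric] by (simp only: of_nat_le_iff)
      then show ?thesis by (simp add: P_def)
    qed
    also have "\<dots> \<le> 6000 * real K * (14 * l)\<^sup>2 + 1000 * (real N + real K) * (14 * l)"
      using P by (intro add_mono mult_left_mono power_mono) auto
    \<comment> \<open>The factor \<open>K * l\<close> is isolated because the hypothesis bounds it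
      by \<open>N\<close>: the quadratic cost of the lifts becomes \<open>N * l\<close>, and the
      last term becomes \<open>N\<close>, which is at most \<open>2 * (N * l)\<close>.\<close>
    also have "\<dots> = 1176000 * (real K * l) * l + 14000 * real N * l + 14000 * (real K * l)"
      by (simp add: power2_eq_square algebra_simps)
    also have "\<dots> \<le> 1176000 * real N * l + 14000 * real N * l + 14000 * real N"
      using KN \<open>l > 0\<close> by (intro add_mono mult_right_mono mult_left_mono) auto
    also have "\<dots> \<le> 1176000 * real N * l + 14000 * real N * l + 28000 * (real N * l)"
      using mult_left_mono[OF l, of "real N"] by linarith
    finally have "real t \<le> ?C * (real N * l)" using pos by linarith
    then show "real (runtime ?T w) \<le> ?C * (real (card (crt_set d m A)) * ln (real (\<Prod>i=1..d. m i)))"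
      using run(2) unfolding N_def l_def M_def by linarith
  qed
qed

end
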